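(* Let $r,n$ be positive integers, $W=C_r\wr S_n$, and for $g\in W$ let $\theta(g)=\frac1r|\{(c,i)\in C_r\times[n]:g\cdot(c,i)=(c,i)\}|$. For each integer $k$ with $0\le k\le n/2$ and each $\underline\lambda\in\Lambda_n(C_r)$ we have $\langle C^{(1/r)}_k(\theta),\chi^{\underline\lambda}\rangle\ge 0$, and $\langle C^{(1/r)}_k(\theta),\chi^{\underline\lambda}\rangle\neq0$ if and only if $\underline\lambda(0)_1=n-k$. In particular $C^{(1/r)}_k(\theta)$ is a character of $W$.
   Context: $C_r=\mathbb{Z}/r\mathbb{Z}$ with identity $0$; $[n]=\{1,\dots,n\}$. $W=C_r\wr S_n$ consists of pairs $(g,\pi)$, $g\in C_r^n$, $\pi\in S_n$, with $(f,\pi)(g,\sigma)=(f+g^\pi,\pi\sigma)$, $g^\pi=(g_{\pi^{-1}(1)},\dots,g_{\pi^{-1}(n)})$, acting on $C_r\times[n]$ by $(g,\pi)\cdot(c,i)=(c+g_{\pi(i)},\pi(i))$. The Charlier polynomial of degree $k$ with parameter $a>0$ is $C^{(a)}_k(x)=\sum_{j=0}^k(-1)^{k-j}\binom kj a^{-j}(x)_j$, where $(x)_j=x(x-1)\cdots(x-j+1)$. For a polynomial $f=\sum f_ix^i$, $f(\theta)$ denotes the class function $\sum f_i\theta^i$. $\langle\phi,\psi\rangle=\frac1{|W|}\sum_{w\in W}\phi(w)\overline{\psi(w)}$. $\Lambda_n(C_r)$ is the set of maps $\underline\lambda$ from $C_r$ to partitions with $\sum_g|\underline\lambda(g)|=n$;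 $\underline\lambda(0)_1$ is the largest part of $\underline\lambda(0)$ (0 if empty). Irreducible characters: fix an isomorphism $g\mapsto\theta^g$ of $C_r$ onto its linear characters; $\psi^\mu$ is the irreducible character of $S_k$ indexed by the partition $\mu$ of $k$ ($\psi^{(k)}$ trivial). For $\underline\lambda\in\Lambda_n(C_r)$ choose a partition of $[n]$ into sets $P_g$ with $|P_g|=|\underline\lambda(g)|$, $S=\prod_gS_{P_g}$, and let $\chi^{\underline\lambda}$ be the induction from $C_r^n\rtimes S$ to $W$ of $((x_i),\pi)\mapsto\prod_g\big(\prod_{i\in P_g}\theta^g(x_i)\big)\psi^{\underline\lambda(g)}(\pi|_{P_g})$; these are all the irreducible characters of $W$. *)

theory Defs
  imports
    "HOL-Algebra.Elementary_Groups"
    "HOL-Algebra.Product_Groups"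
    "HOL-Algebra.Sym_Groups"
    "HOL-Combinatorics.Orbits"
    "HOL-Computational_Algebra.Polynomial"
    "HOL-Library.Disjoint_Sets"
    "HOL-Library.Function_Algebras"
    "HOL-Library.Nonpos_Ints"
    "Jordan_Normal_Form.Matrix"
begin

section \<open>Characters of finite groups\<close>

definition class_inner :: "('a, 'b) monoid_scheme \<Rightarrow> ('a \<Rightarrow> complex) \<Rightarrow> ('a \<Rightarrow> complex) \<Rightarrow> complex"
  where "class_inner G \<phi> \<psi> = (\<Sum>w\<in>carrier G. \<phi> w * cnj (\<psi> w)) / of_nat (Coset.order G)"

text \<open>Representations act on nonzero spaces, so the zero function is not a character.\<close>

definition is_character :: "('a, 'b) monoid_scheme \<Rightarrow> ('a \<Rightarrow> complex) \<Rightarrow> bool"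
  where "is_character G \<chi> \<longleftrightarrow>
    (\<exists>d > 0. \<exists>\<rho> :: 'a \<Rightarrow> complex mat.
      (\<forall>x\<in>carrier G. \<rho> x \<in> carrier_mat d d) \<and>
      \<rho> \<one>\<^bsub>G\<^esub> = 1\<^sub>m d \<and>
      (\<forall>x\<in>carrier G. \<forall>y\<in>carrier G. \<rho> (x \<otimes>\<^bsub>G\<^esub> y) = \<rho> x * \<rho> y) \<and>
      (\<forall>x\<in>carrier G. \<chi> x = (\<Sum>i<d. \<rho> x $$ (i, i))))"

definition induced_char ::
  "('a, 'b) monoid_scheme \<Rightarrow> 'a set \<Rightarrow> ('a \<Rightarrow> complex) \<Rightarrow> 'a \<Rightarrow> complex"
  where "induced_char G H \<phi> w =
    (\<Sum>x\<in>{x \<in> carrier G. inv\<^bsub>G\<^esub> x \<otimes>\<^bsub>G\<^esub> w \<otimes>\<^bsub>G\<^esub> x \<in> H}.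
       \<phi> (inv\<^bsub>G\<^esub> x \<otimes>\<^bsub>G\<^esub> w \<otimes>\<^bsub>G\<^esub> x)) / of_nat (card H)"

text \<open>The group of linear characters of \<open>G\<close>, i.e. of homomorphisms from \<open>G\<close> to the nonzero
  complex numbers, under pointwise multiplication.\<close>

definition linear_characters :: "('a, 'b) monoid_scheme \<Rightarrow> ('a \<Rightarrow> complex) monoid"
  where "linear_characters G =
    \<lparr> carrier = {\<chi> \<in> carrier G \<rightarrow>\<^sub>E - {0}.
                  \<forall>x\<in>carrier G. \<forall>y\<in>carrier G. \<chi> (x \<otimes>\<^bsub>G\<^esub> y) = \<chi> x * \<chi> y},
      monoid.mult = (\<lambda>\<phi> \<psi>. \<lambda>x\<in>carrier G. \<phi> x * \<psi> x),
      one = (\<lambda>x\<in>carrier G. 1) \<rparr>"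


section \<open>Specht modules and the irreducible characters of symmetric groups\<close>

text \<open>Complex-valued functions as a complex vector space.\<close>

global_interpretation cfun: vector_space "\<lambda>(c::complex) (f::'t \<Rightarrow> complex) x. c * f x"
  by unfold_locales (auto simp: fun_eq_iff algebra_simps)

text \<open>The trace of a linear map on a finite-dimensional invariant subspace \<open>V\<close>, computed in
  an arbitrary basis of \<open>V\<close>.\<close>

definition trace_on ::
  "('t \<Rightarrow> complex) set \<Rightarrow> (('t \<Rightarrow> complex) \<Rightarrow> 't \<Rightarrow> complex) \<Rightarrow> complex"
  where "trace_on V f =
    (let B = (SOME B. cfun.independent B \<and> cfun.span B = V)
     in \<Sum>b\<in>B. cfun.representation B (f b) b)"

definition is_partition :: "nat list \<Rightarrow> bool"
  where "is_partition \<mu> \<longleftrightarrow> sorted_wrt (\<ge>) \<mu> \<and> 0 \<notin> set \<mu>"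

definition largest_part :: "nat list \<Rightarrow> nat"
  where "largest_part \<mu> = (if \<mu> = [] then 0 else hd \<mu>)"

definition young_diagram :: "nat list \<Rightarrow> (nat \<times> nat) set"
  where "young_diagram \<mu> = {(i, j). i < length \<mu> \<and> j < \<mu> ! i}"

text \<open>A tableau of shape \<open>\<mu>\<close> with entry set \<open>A\<close> is encoded by the map sending every entry to
  its cell (row, column). A permutation \<open>\<pi>\<close> of \<open>A\<close> replaces each entry \<open>x\<close> by \<open>\<pi> x\<close>,
  i.e. it sends the tableau \<open>t\<close> to \<open>t \<circ> \<pi>\<^sup>-\<^sup>1\<close>.\<close>

definition tableaux :: "'a set \<Rightarrow> nat list \<Rightarrow> ('a \<Rightarrow> nat \<times> nat) set"
  where "tableaux A \<mu> = {t \<in> extensional A. bij_betw t A (young_diagram \<mu>)}"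

text \<open>Two tableaux are row equivalent iff each entry lies in the same row in both, so a tabloid
  is encoded by its row function.\<close>

definition tabloid :: "('a \<Rightarrow> nat \<times> nat) \<Rightarrow> 'a \<Rightarrow> nat"
  where "tabloid t = fst \<circ> t"

definition column_group :: "'a set \<Rightarrow> ('a \<Rightarrow> nat \<times> nat) \<Rightarrow> ('a \<Rightarrow> 'a) set"
  where "column_group A t = {\<sigma>. \<sigma> permutes A \<and> (\<forall>x\<in>A. snd (t (\<sigma> x)) = snd (t x))}"

text \<open>Formal linear combinations of tabloids are functions on tabloids (the coefficients). The
  polytabloid of \<open>t\<close> is the signed sum of the tabloids \<open>\<sigma>{t}\<close> over the column group.\<close>

definition polytabloid :: "'a set \<Rightarrow> ('a \<Rightarrow> nat \<times> nat) \<Rightarrow> ('a \<Rightarrow> nat) \<Rightarrow> complex"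
  where "polytabloid A t T =
    (\<Sum>\<sigma>\<in>column_group A t. of_int (sign \<sigma>) * of_bool (T = tabloid (t \<circ> inv' \<sigma>)))"

definition specht_module :: "'a set \<Rightarrow> nat list \<Rightarrow> (('a \<Rightarrow> nat) \<Rightarrow> complex) set"
  where "specht_module A \<mu> = cfun.span (polytabloid A ` tableaux A \<mu>)"

text \<open>Since \<open>\<pi>\<close> sends the tabloid \<open>T\<close> to \<open>T \<circ> \<pi>\<^sup>-\<^sup>1\<close>, the linear extension sends the coefficient
  function \<open>f\<close> to \<open>\<lambda>T. f (T \<circ> \<pi>)\<close>.\<close>

definition perm_act :: "('a \<Rightarrow> 'a) \<Rightarrow> (('a \<Rightarrow> nat) \<Rightarrow> complex) \<Rightarrow> ('a \<Rightarrow> nat) \<Rightarrow> complex"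
  where "perm_act \<pi> f = (\<lambda>T. f (T \<circ> \<pi>))"

text \<open>The irreducible character of the symmetric group on the finite set \<open>A\<close> indexed by a
  partition \<open>\<mu>\<close> of \<open>card A\<close>. The one-row partition gives the trivial character.\<close>

definition sym_char :: "'a set \<Rightarrow> nat list \<Rightarrow> ('a \<Rightarrow> 'a) \<Rightarrow> complex"
  where "sym_char A \<mu> \<pi> = trace_on (specht_module A \<mu>) (perm_act \<pi>)"


section \<open>The wreath product of a cyclic group with a symmetric group\<close>

abbreviation cyc :: "nat \<Rightarrow> int monoid"
  where "cyc r \<equiv> integer_mod_group r"

definition wreath :: "nat \<Rightarrow> nat \<Rightarrow> ((nat \<Rightarrow> int) \<times> (nat \<Rightarrow> nat)) monoid"
  where "wreath r n =
    \<lparr> carrier = carrier (product_group {1..n} (\<lambda>_. cyc r)) \<times> carrier (sym_group n),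
      monoid.mult = (\<lambda>(f, \<pi>) (g, \<sigma>).
        (f \<otimes>\<^bsub>product_group {1..n} (\<lambda>_. cyc r)\<^esub> (\<lambda>i\<in>{1..n}. g (inv' \<pi> i)),
         \<pi> \<otimes>\<^bsub>sym_group n\<^esub> \<sigma>)),
      one = (\<one>\<^bsub>product_group {1..n} (\<lambda>_. cyc r)\<^esub>, \<one>\<^bsub>sym_group n\<^esub>) \<rparr>"

fun wreath_act :: "nat \<Rightarrow> (nat \<Rightarrow> int) \<times> (nat \<Rightarrow> nat) \<Rightarrow> int \<times> nat \<Rightarrow> int \<times> nat"
  where "wreath_act r (g, \<pi>) (c, i) = (c \<otimes>\<^bsub>cyc r\<^esub> g (\<pi> i), \<pi> i)"

definition fix_theta :: "nat \<Rightarrow> nat \<Rightarrow> (nat \<Rightarrow> int) \<times> (nat \<Rightarrow> nat) \<Rightarrow> real"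
  where "fix_theta r n w =
    real (card {p \<in> carrier (cyc r) \<times> {1..n}. wreath_act r w p = p}) / real r"

definition colored_partitions :: "nat \<Rightarrow> nat \<Rightarrow> (int \<Rightarrow> nat list) set"
  where "colored_partitions r n =
    {L \<in> carrier (cyc r) \<rightarrow>\<^sub>E {\<mu>. is_partition \<mu>}. (\<Sum>g\<in>carrier (cyc r). sum_list (L g)) = n}"

definition is_block_choice :: "nat \<Rightarrow> nat \<Rightarrow> (int \<Rightarrow> nat list) \<Rightarrow> (int \<Rightarrow> nat set) \<Rightarrow> bool"
  where "is_block_choice r n L P \<longleftrightarrow>
    disjoint_family_on P (carrier (cyc r)) \<and>
    (\<Union>g\<in>carrier (cyc r). P g) = {1..n} \<and>
    (\<forall>g\<in>carrier (cyc r). card (P g) = sum_list (L g))"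

text \<open>The subgroup of all \<open>(x, \<pi>)\<close> for which \<open>\<pi>\<close> lies in the product of the symmetric groups of
  the blocks \<open>P g\<close>.\<close>

definition block_subgroup ::
  "nat \<Rightarrow> nat \<Rightarrow> (int \<Rightarrow> nat set) \<Rightarrow> ((nat \<Rightarrow> int) \<times> (nat \<Rightarrow> nat)) set"
  where "block_subgroup r n P =
    {(x, \<pi>) \<in> carrier (wreath r n). \<forall>g\<in>carrier (cyc r). \<pi> ` P g = P g}"

fun block_char ::
  "nat \<Rightarrow> (int \<Rightarrow> int \<Rightarrow> complex) \<Rightarrow> (int \<Rightarrow> nat list) \<Rightarrow> (int \<Rightarrow> nat set)
    \<Rightarrow> (nat \<Rightarrow> int) \<times> (nat \<Rightarrow> nat) \<Rightarrow> complex"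
  where "block_char r \<Theta> L P (x, \<pi>) =
    (\<Prod>g\<in>carrier (cyc r).
       (\<Prod>i\<in>P g. \<Theta> g (x i)) * sym_char (P g) (L g) (perm_restrict \<pi> (P g)))"

definition wreath_char ::
  "nat \<Rightarrow> nat \<Rightarrow> (int \<Rightarrow> int \<Rightarrow> complex) \<Rightarrow> (int \<Rightarrow> nat list) \<Rightarrow> (int \<Rightarrow> nat set)
    \<Rightarrow> (nat \<Rightarrow> int) \<times> (nat \<Rightarrow> nat) \<Rightarrow> complex"
  where "wreath_char r n \<Theta> L P =
    induced_char (wreath r n) (block_subgroup r n P) (block_char r \<Theta> L P)"


section \<open>Charlier polynomials\<close>

definition falling_poly :: "nat \<Rightarrow> real poly"
  where "falling_poly j = (\<Prod>i<j. [:- real i, 1:])"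

definition charlier :: "real \<Rightarrow> nat \<Rightarrow> real poly"
  where "charlier a k =
    (\<Sum>j\<le>k. Polynomial.smult ((- 1) ^ (k - j) * real (k choose j) * inverse (a ^ j)) (falling_poly j))"

definition charlier_theta :: "nat \<Rightarrow> nat \<Rightarrow> nat \<Rightarrow> (nat \<Rightarrow> int) \<times> (nat \<Rightarrow> nat) \<Rightarrow> complex"
  where "charlier_theta r n k w = complex_of_real (poly (charlier (1 / real r) k) (fix_theta r n w))"

end

theory Submission
  imports Defs
begin

text \<open>Let \<open>M\<^sub>K\<close> be the space of functions on the tuples, indexed by \<open>K\<close>, of points of \<open>C \<times> A\<close> in distinct
  columns, with values in a module \<open>V\<close>, and let \<open>\<sigma>\<^sub>p\<close> sum over the \<open>p\<close>-th entry. Its character counts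
  fixed tuples, so it is a falling factorial in \<open>\<theta>\<close> times the character of \<open>V\<close>. If
  \<open>2 |K| \<le> |A|\<close>, then \<open>\<sigma>\<^sub>q\<close> maps \<open>\<Inter>\<^bsub>p \<in> J\<^esub> ker \<sigma>\<^sub>p\<close> onto the same intersection for \<open>K - {q}\<close>; by
  inclusion-exclusion the common kernel of all \<open>\<sigma>\<^sub>p\<close> has character \<open>C\<^sub>k(\<theta>)\<close> times that of \<open>V\<close>. For
  trivial \<open>V\<close> this realises \<open>C\<^sub>k(\<theta>)\<close> as a character of the wreath product.

  For a single color and a Specht module \<open>V\<close>, the multiplicity is the dimension of the invariants of that
  common kernel. They vanish if the first row of the shape is shorter than \<open>n - k\<close>, since then every
  polytabloid is antisymmetric in two of the \<open>n - k\<close> entries missed by a tuple; they vanish if it is longer,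
  since a function invariant under many permutations with vanishing sums is zero; and if the length is
  \<open>n - k\<close>, averaging a polytabloid over the group gives a nonzero invariant.

  In general, Frobenius reciprocity leaves a sum over \<open>C\<^sub>r\<^sup>n \<rtimes> S\<close>. As \<open>C\<^sub>k(\<theta>)\<close> is a linear functional
  of the polynomial \<open>(1 + r t)\<^sup>\<theta>\<close>, which is a product over the positions, orthogonality of the linear
  characters turns the sum over \<open>C\<^sub>r\<^sup>n\<close> into a sum over the symmetric group of the block of color \<open>0\<close>, with
  \<open>k\<close> lowered by the size of the other blocks.\<close>

section \<open>Traces on invariant subspaces\<close>

text \<open>The bound \<open>2 * k \<le> n\<close> enters through surjectivity. The conditions
  indexed by J are imposed one at a time: each new q gives a short exact sequence whose quotient is
  the kernel for J on \<open>K - {q}\<close>, so the traces obey Pascal's recurrence. The last step,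
  with J = K - {q}, asks for at least |J| + |K| = 2k - 1 columns. This is why J and K are kept apart
  and why surjectivity is proved relative to J.

  The color reduction rests on the generating function exp(-t) (1 + r t)^m of the Charlier
  polynomials: the functional takes k! times the coefficient of t^k in exp(-t) p(t). After summation
  over the base group, a position fixed by the permutation contributes r (1 + t) if its color is 0
  and r t otherwise; a moved one contributes r or 0. With m positions of nonzero color, t^m lowers k
  to k - m and the parameter becomes 1. Both requirements survive: 2 (k - m) \<le> n - m, and (n -
  m) - (k - m) = n - k, so the single color result singles out the same row length.\<close>

interpretation cfun_pair: vector_space_pair
  "\<lambda>(c::complex) (f::'t \<Rightarrow> complex) x. c * f x" "\<lambda>(c::complex) (f::'u \<Rightarrow> complex) x. c * f x" ..

abbreviation clinear :: "(('t \<Rightarrow> complex) \<Rightarrow> 'u \<Rightarrow> complex) \<Rightarrow> bool"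
  where "clinear \<equiv> Vector_Spaces.linear (\<lambda>c f x. c * f x) (\<lambda>c f x. c * f x)"

lemma clinearI:
  assumes "\<And>u v. f (u + v) = f u + f v" "\<And>c u. f (\<lambda>x. c * u x) = (\<lambda>x. c * f u x)"
  shows "clinear f"
  unfolding Vector_Spaces.linear_iff
  by (intro conjI allI cfun.vector_space_axioms) (rule assms)+

text \<open>Linearity is required on V only: the coordinates \<open>cfun.representation B\<close>
  are zero by convention outside the span of B, hence in general not additive on the whole function
  space.\<close>

definition functional_on :: "('t \<Rightarrow> complex) set \<Rightarrow> (('t \<Rightarrow> complex) \<Rightarrow> complex) \<Rightarrow> bool"
  where "functional_on V \<phi> \<longleftrightarrow>
    (\<forall>u\<in>V. \<forall>v\<in>V. \<phi> (u + v) = \<phi> u + \<phi> v) \<and> (\<forall>c. \<forall>v\<in>V. \<phi> (\<lambda>x. c * v x) = c * \<phi> v)"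

text \<open>The ambient function spaces can be infinite-dimensional, so finiteness is recorded for
  the subspace; the predicate also contains that V is a subspace.\<close>

definition fin_dim :: "('t \<Rightarrow> complex) set \<Rightarrow> bool"
  where "fin_dim V \<longleftrightarrow> (\<exists>B. finite B \<and> cfun.independent B \<and> cfun.span B = V)"

lemma functional_on_add: "functional_on V \<phi> \<Longrightarrow> u \<in> V \<Longrightarrow> v \<in> V \<Longrightarrow> \<phi> (u + v) = \<phi> u + \<phi> v"
  unfolding functional_on_def by simp

lemma functional_on_scale: "functional_on V \<phi> \<Longrightarrow> v \<in> V \<Longrightarrow> \<phi> (\<lambda>x. c * v x) = c * \<phi> v"
  unfolding functional_on_def by simp

lemma functional_on_sum:
  assumes \<phi>: "functional_on V \<phi>" and V: "cfun.subspace V" and "\<And>i. i \<in> I \<Longrightarrow> v i \<in> V"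
  shows "\<phi> (\<Sum>i\<in>I. (\<lambda>x. c i * v i x)) = (\<Sum>i\<in>I. c i * \<phi> (v i))"
proof -
  have zero: "\<phi> 0 = 0"
    using functional_on_add[OF \<phi> cfun.subspace_0[OF V] cfun.subspace_0[OF V]] by simp
  show ?thesis
    using assms(3)
  proof (induction I rule: infinite_finite_induct)
    case (insert i I)
    have s: "(\<lambda>x. c j * v j x) \<in> V" if "j \<in> insert i I" for j
      by (rule cfun.subspace_scale[OF V insert.prems[OF that]])
    have "(\<Sum>i\<in>I. (\<lambda>x. c i * v i x)) \<in> V"
      by (rule cfun.subspace_sum[OF V]) (rule s, simp)
    then have "\<phi> ((\<lambda>x. c i * v i x) + (\<Sum>i\<in>I. (\<lambda>x. c i * v i x)))
        = c i * \<phi> (v i) + \<phi> (\<Sum>i\<in>I. (\<lambda>x. c i * v i x))"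
      using functional_on_add[OF \<phi> s] functional_on_scale[OF \<phi> insert.prems] by simp
    then show ?case
      using insert by (simp only: sum.insert[OF insert.hyps(1,2)] insert_iff simp_thms)
  qed (simp_all add: zero)
qed

lemma functional_on_representation:
  assumes "cfun.independent B"
  shows "functional_on (cfun.span B) (\<lambda>v. cfun.representation B v b)"
  unfolding functional_on_def
  by (auto simp only: cfun.representation_add[OF assms] cfun.representation_scale[OF assms])

lemma fin_dim_span:
  assumes "finite S"
  shows "fin_dim (cfun.span S)"
proof -
  obtain B where B: "B \<subseteq> S" "cfun.independent B" "S \<subseteq> cfun.span B"
    using cfun.maximal_independent_subset by blast
  have "cfun.span B = cfun.span S"
    using B cfun.span_mono[OF B(1)] cfun.span_minimal[OF B(3) cfun.subspace_span] by simp
  then show ?thesis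
    unfolding fin_dim_def using B(2) finite_subset[OF B(1) assms] by metis
qed

lemma fin_dim_subspace:
  assumes "fin_dim V" "cfun.subspace W" "W \<subseteq> V"
  shows "fin_dim W"
proof -
  obtain B where B: "finite B" "cfun.span B = V"
    using assms(1) unfolding fin_dim_def by blast
  obtain C where C: "C \<subseteq> W" "cfun.independent C" "W \<subseteq> cfun.span C"
    using cfun.maximal_independent_subset by blast
  have "finite C"
    using cfun.independent_span_bound[OF B(1) C(2)] C(1) assms(3) B(2) by blast
  moreover have "cfun.span C = W"
    using C assms(2) by (simp add: cfun.span_minimal subset_antisym)
  ultimately show ?thesis
    using C(2) unfolding fin_dim_def by blast
qed

lemma fin_dim_imp_subspace: "fin_dim V \<Longrightarrow> cfun.subspace V"
  unfolding fin_dim_def by (metis cfun.subspace_span)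

text \<open>The basis chosen in \<open>trace_on\<close> depends on V alone, so one basis serves all
  maps at once; its finiteness follows by comparison with the basis provided by
  \<open>fin_dim\<close>.\<close>

lemma trace_on_some_basis:
  assumes "fin_dim V"
  obtains B where "finite B" "cfun.independent B" "cfun.span B = V"
    "trace_on V = (\<lambda>f. \<Sum>b\<in>B. cfun.representation B (f b) b)"
proof -
  define B where "B = (SOME B. cfun.independent B \<and> cfun.span B = V)"
  obtain B' where B': "finite B'" "cfun.independent B'" "cfun.span B' = V"
    using assms unfolding fin_dim_def by blast
  have B: "cfun.independent B \<and> cfun.span B = V"
    unfolding B_def by (rule someI[of _ B']) (use B' in blast)
  moreover have "finite B"
    using cfun.independent_span_bound[OF B'(1), of B] B B' cfun.span_superset by blast
  ultimately show ?thesis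
    using that unfolding trace_on_def Let_def B_def by blast
qed

text \<open>The expansion writes f on V as the sum of the rank one maps sending v to
  \<open>\<phi> i v\<close> times \<open>f (e i)\<close>, and such a map has trace
  \<open>\<phi> i (f (e i))\<close>. This yields independence of the chosen basis and allows traces
  to be computed in any convenient family with coordinate functionals.\<close>

lemma trace_on_frame:
  assumes V: "fin_dim V" and f: "clinear f" "\<And>v. v \<in> V \<Longrightarrow> f v \<in> V"
    and e: "\<And>i. i \<in> I \<Longrightarrow> e i \<in> V"
    and \<phi>: "\<And>i. i \<in> I \<Longrightarrow> functional_on V (\<phi> i)"
    and expand: "\<And>v. v \<in> V \<Longrightarrow> (\<Sum>i\<in>I. (\<lambda>x. \<phi> i v * e i x)) = v"
  shows "trace_on V f = (\<Sum>i\<in>I. \<phi> i (f (e i)))"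
proof -
  obtain B where B: "finite B" "cfun.independent B" "cfun.span B = V"
    "trace_on V = (\<lambda>f. \<Sum>b\<in>B. cfun.representation B (f b) b)"
    using trace_on_some_basis[OF V] by blast
  let ?r = "cfun.representation B"
  have sub: "cfun.subspace V"
    by (rule fin_dim_imp_subspace[OF V])
  have BV: "b \<in> V" if "b \<in> B" for b
    using B(3) cfun.span_base that by blast
  have "?r (f b) b = (\<Sum>i\<in>I. \<phi> i b * ?r (f (e i)) b)" if "b \<in> B" for b
  proof -
    have "f b = f (\<Sum>i\<in>I. (\<lambda>x. \<phi> i b * e i x))"
      using expand BV that by simp
    also have "\<dots> = (\<Sum>i\<in>I. (\<lambda>x. \<phi> i b * f (e i) x))"
      by (simp add: cfun_pair.linear_sum[OF f(1)] cfun_pair.linear_scale[OF f(1)])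
    finally have "?r (f b) b = ?r (\<Sum>i\<in>I. (\<lambda>x. \<phi> i b * f (e i) x)) b"
      by simp
    then show ?thesis
      using functional_on_sum[OF functional_on_representation[OF B(2)] cfun.subspace_span,
          where I = I and v = "\<lambda>i. f (e i)" and c = "\<lambda>i. \<phi> i b"] B(3) f(2) e by simp
  qed
  then have "trace_on V f = (\<Sum>b\<in>B. \<Sum>i\<in>I. \<phi> i b * ?r (f (e i)) b)"
    using B(4) by simp
  also have "\<dots> = (\<Sum>i\<in>I. \<Sum>b\<in>B. ?r (f (e i)) b * \<phi> i b)"
    by (subst sum.swap) (simp add: mult.commute)
  also have "\<dots> = (\<Sum>i\<in>I. \<phi> i (\<Sum>b\<in>B. (\<lambda>x. ?r (f (e i)) b * b x)))"
    using functional_on_sum[OF \<phi> sub, of _ B "\<lambda>b. b"] BV by simp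
  also have "\<dots> = (\<Sum>i\<in>I. \<phi> i (f (e i)))"
    by (rule sum.cong) (use cfun.sum_representation_eq[OF B(2) _ B(1)] B(3) f(2) e in auto)
  finally show ?thesis .
qed

lemma trace_on_basis:
  assumes "finite B" "cfun.independent B" "cfun.span B = V" "clinear f" "\<And>v. v \<in> V \<Longrightarrow> f v \<in> V"
  shows "trace_on V f = (\<Sum>b\<in>B. cfun.representation B (f b) b)"
proof (rule trace_on_frame)
  show "fin_dim V"
    using assms unfolding fin_dim_def by blast
  show "b \<in> V" if "b \<in> B" for b
    using assms(3) cfun.span_base that by blast
  show "functional_on V (\<lambda>v. cfun.representation B v b)" if "b \<in> B" for b
    using functional_on_representation[OF assms(2)] assms(3) by blast
  show "(\<Sum>b\<in>B. (\<lambda>x. cfun.representation B v b * b x)) = v" if "v \<in> V" for v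
    using cfun.sum_representation_eq[OF assms(2) _ assms(1)] assms(3) that by auto
qed (use assms in auto)

section \<open>Exact sequences and projections\<close>

lemma kernel_subspace:
  assumes "cfun.subspace V" "clinear T"
  shows "cfun.subspace {v \<in> V. T v = 0}"
  using cfun.subspace_inter[OF assms(1) cfun_pair.linear_subspace_kernel[OF assms(2)]]
  by (simp add: Int_def)

text \<open>Additivity of the trace along 0 -> ker T -> V -> W -> 0. A linear section of T splits V;
  in the resulting frame f is block triangular, so only the two diagonal blocks contribute, whether
  or not the section commutes with the maps.\<close>

lemma trace_on_exact:
  assumes V: "fin_dim V" and W: "fin_dim W"
    and T: "clinear T" "T ` V = W"
    and f: "clinear f" "\<And>v. v \<in> V \<Longrightarrow> f v \<in> V"
    and g: "clinear g" "\<And>v. v \<in> V \<Longrightarrow> T (f v) = g (T v)"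
  shows "trace_on V f = trace_on {v \<in> V. T v = 0} f + trace_on W g"
proof -
  define N where "N = {v \<in> V. T v = 0}"
  have subV: "cfun.subspace V"
    by (rule fin_dim_imp_subspace[OF V])
  have subN: "cfun.subspace N"
    unfolding N_def
    by (rule kernel_subspace[OF subV T(1)])
  have "fin_dim N"
    by (rule fin_dim_subspace[OF V subN]) (auto simp: N_def)
  then obtain B where B: "finite B" "cfun.independent B" "cfun.span B = N"
    unfolding fin_dim_def by blast
  obtain C where C: "finite C" "cfun.independent C" "cfun.span C = W"
    using W unfolding fin_dim_def by blast
  have "\<forall>c\<in>C. \<exists>v\<in>V. T v = c"
  proof
    fix c assume "c \<in> C"
    then have "c \<in> T ` V"
      using cfun.span_base[of c C] C(3) T(2) by simp
    then show "\<exists>v\<in>V. T v = c"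
      by (auto simp only: image_iff)
  qed
  then obtain s where s: "\<And>c. c \<in> C \<Longrightarrow> s c \<in> V" "\<And>c. c \<in> C \<Longrightarrow> T (s c) = c"
    by metis
  \<comment> \<open>S is the linear section of T determined by chosen preimages s of the basis
    vectors of W.\<close>
  define S where "S w = (\<Sum>c\<in>C. (\<lambda>x. cfun.representation C w c * s c x))" for w
  have SV: "S w \<in> V" for w
    unfolding S_def using s by (intro cfun.subspace_sum[OF subV] cfun.subspace_scale[OF subV])
  have TS: "T (S w) = w" if "w \<in> W" for w
  proof -
    have "T (S w) = (\<Sum>c\<in>C. (\<lambda>x. cfun.representation C w c * c x))"
      unfolding S_def using s
      by (simp add: cfun_pair.linear_sum[OF T(1)] cfun_pair.linear_scale[OF T(1)])
    then show ?thesis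
      using cfun.sum_representation_eq[OF C(2) _ C(1)] C(3) that by auto
  qed
  have TW: "T v \<in> W" if "v \<in> V" for v
    using imageI[OF that, of T] T(2) by simp
  have S_add: "S (u + v) = S u + S v" if "u \<in> W" "v \<in> W" for u v
  proof -
    have "cfun.representation C (u + v) c = cfun.representation C u c + cfun.representation C v c" for c
      using that C(3) cfun.representation_add[OF C(2), of v u] by simp
    moreover have "(\<lambda>x. (a + b) * w x) = (\<lambda>x. a * w x) + (\<lambda>x. b * w x)" for a b and w :: "'a \<Rightarrow> complex"
      by (simp add: fun_eq_iff distrib_right)
    ultimately show ?thesis
      by (simp only: S_def sum.distrib)
  qed
  have S_scale: "S (\<lambda>x. c * v x) = (\<lambda>x. c * S v x)" if "v \<in> W" for c v
  proof -
    have "cfun.representation C (\<lambda>x. c * v x) b = c * cfun.representation C v b" for b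
      using that C(3) cfun.representation_scale[OF C(2), of v c] by simp
    then show ?thesis
      using cfun.scale_sum_right[of c "\<lambda>b x. cfun.representation C v b * s b x" C]
      by (simp only: S_def mult.assoc)
  qed
  have diffN: "v - S (T v) \<in> N" if "v \<in> V" for v
  proof -
    have "T (v - S (T v)) = 0"
      using TS[OF TW[OF that]] by (simp add: cfun_pair.linear_diff[OF T(1)])
    then show ?thesis
      using cfun.subspace_diff[OF subV that SV] by (simp add: N_def)
  qed
  have S_eq_0: "S (T v) = 0" if "v \<in> N" for v
  proof -
    have "T v = 0"
      using that by (simp add: N_def)
    then show ?thesis
      by (simp add: S_def cfun.representation_zero flip: zero_fun_def)
  qed
  have NV: "N \<subseteq> V"
    unfolding N_def by blast
  have fN: "f v \<in> N" if "v \<in> N" for v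
    using that f(2)[of v] g(2)[of v] by (simp add: N_def cfun_pair.linear_0[OF g(1)])
  have gW: "g w \<in> W" if "w \<in> W" for w
  proof -
    obtain v where v: "v \<in> V" "w = T v"
      using \<open>w \<in> W\<close> unfolding T(2)[symmetric] by (rule imageE)
    have "T (f v) \<in> W"
      using TW f(2) v(1) by simp
    then show ?thesis
      using g(2)[OF v(1)] v(2) by simp
  qed
  \<comment> \<open>The frame is indexed by the disjoint sum of both bases: the kernel part
    \<open>v - S (T v)\<close> is expanded in B, the image \<open>T v\<close> in C.\<close>
  let ?e = "\<lambda>i. case i of Inl b \<Rightarrow> b | Inr c \<Rightarrow> s c"
  let ?\<phi> = "\<lambda>i v. case i of Inl b \<Rightarrow> cfun.representation B (v - S (T v)) b
    | Inr c \<Rightarrow> cfun.representation C (T v) c"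
  have "trace_on V f = (\<Sum>i\<in>B <+> C. ?\<phi> i (f (?e i)))"
  proof (rule trace_on_frame[OF V f])
    fix i assume i: "i \<in> B <+> C"
    show "?e i \<in> V"
    proof (cases i)
      case (Inl b)
      then have "b \<in> N"
        using i B(3) cfun.span_base[of b B] by auto
      then show ?thesis
        using Inl by (simp add: N_def)
    qed (use i s in auto)
    show "functional_on V (?\<phi> i)"
    proof (cases i)
      case (Inl b)
      have 1: "u + v - S (T (u + v)) = (u - S (T u)) + (v - S (T v))" if "u \<in> V" "v \<in> V" for u v
        using S_add[OF TW[OF that(1)] TW[OF that(2)]] by (simp add: cfun_pair.linear_add[OF T(1)])
      have 2: "(\<lambda>x. c * v x) - S (T (\<lambda>x. c * v x)) = (\<lambda>x. c * (v - S (T v)) x)"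
        if "v \<in> V" for c v
        using S_scale[OF TW[OF that], of c]
        by (simp add: cfun_pair.linear_scale[OF T(1)] fun_eq_iff algebra_simps)
      have 3: "v - S (T v) \<in> cfun.span B" if "v \<in> V" for v
        using diffN[OF that] B(3) by simp
      show ?thesis
        unfolding functional_on_def Inl sum.case
        by (auto simp only: 1 2 cfun.representation_add[OF B(2) 3 3]
            cfun.representation_scale[OF B(2) 3])
    next
      case (Inr c)
      have 1: "T v \<in> cfun.span C" if "v \<in> V" for v
        using TW[OF that] C(3) by simp
      show ?thesis
        unfolding functional_on_def Inr sum.case cfun_pair.linear_add[OF T(1)]
          cfun_pair.linear_scale[OF T(1)]
        by (auto simp only: cfun.representation_add[OF C(2) 1 1]
            cfun.representation_scale[OF C(2) 1])
    qed
  next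
    fix v assume v: "v \<in> V"
    have "(\<Sum>i\<in>B <+> C. (\<lambda>x. ?\<phi> i v * ?e i x))
        = (\<Sum>b\<in>B. (\<lambda>x. cfun.representation B (v - S (T v)) b * b x)) + S (T v)"
      using B(1) C(1) by (subst sum.Plus) (simp_all add: S_def)
    also have "\<dots> = v - S (T v) + S (T v)"
      using cfun.sum_representation_eq[OF B(2) _ B(1) subset_refl, of "v - S (T v)"] B(3) diffN[OF v]
      by simp
    finally show "(\<Sum>i\<in>B <+> C. (\<lambda>x. ?\<phi> i v * ?e i x)) = v"
      by simp
  qed
  also have "\<dots> = (\<Sum>b\<in>B. cfun.representation B (f b) b) + (\<Sum>c\<in>C. cfun.representation C (g c) c)"
  proof -
    \<comment> \<open>As f preserves the kernel, the correction by S vanishes on \<open>f b\<close>;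
      and \<open>T (f (s c)) = g (T (s c))\<close>, so the choice of preimages disappears from the
      trace.\<close>
    have "f b - S (T (f b)) = f b" if "b \<in> B" for b
      using S_eq_0[OF fN, of b] cfun.span_base[OF that] B(3) by simp
    moreover have "T (f (s c)) = g c" if "c \<in> C" for c
      using s g(2) that by simp
    ultimately show ?thesis
      using B(1) C(1) by (subst sum.Plus) simp_all
  qed
  also have "\<dots> = trace_on N f + trace_on W g"
    using trace_on_basis[OF B f(1) fN] trace_on_basis[OF C g(1) gW] by simp
  finally show ?thesis
    unfolding N_def .
qed

lemma trace_on_id:
  assumes "finite B" "cfun.independent B" "cfun.span B = V" "\<And>v. v \<in> V \<Longrightarrow> f v = v" "clinear f"
  shows "trace_on V f = of_nat (card B)"
proof -
  have BV: "b \<in> V" if "b \<in> B" for b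
    using assms(3) cfun.span_base that by blast
  then show ?thesis
    using assms by (subst trace_on_basis[OF assms(1-3,5)])
      (simp_all add: cfun.representation_basis)
qed

lemma trace_on_zero:
  assumes "fin_dim V" "\<And>v. v \<in> V \<Longrightarrow> f v = 0" "clinear f"
  shows "trace_on V f = 0"
proof -
  have "0 \<in> V"
    using fin_dim_imp_subspace[OF assms(1)] cfun.subspace_0 by blast
  then have "\<And>v. v \<in> V \<Longrightarrow> f v \<in> V"
    using assms(2) by simp
  then obtain B where B: "finite B" "cfun.independent B" "cfun.span B = V"
    "trace_on V = (\<lambda>f. \<Sum>b\<in>B. cfun.representation B (f b) b)"
    using trace_on_some_basis[OF assms(1)] by blast
  have BV: "b \<in> V" if "b \<in> B" for b
    using B(3) cfun.span_base that by blast
  show ?thesis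
    using assms BV B by (auto simp: cfun.representation_zero)
qed

text \<open>The exact sequence is applied with T = f itself: f vanishes on its kernel and is the
  identity on its image, so the trace is the dimension of W.\<close>

lemma trace_on_projection:
  assumes V: "fin_dim V" and f: "clinear f" "f ` V = W" "\<And>w. w \<in> W \<Longrightarrow> f w = w" and "W \<subseteq> V"
  obtains d :: nat where "trace_on V f = of_nat d" "d = 0 \<longleftrightarrow> W = {0}"
proof -
  have sub: "cfun.subspace W"
    using cfun_pair.linear_subspace_image[OF f(1) fin_dim_imp_subspace[OF V]] f(2) by simp
  have W: "fin_dim W"
    by (rule fin_dim_subspace[OF V sub \<open>W \<subseteq> V\<close>])
  have id: "clinear (\<lambda>v::'a \<Rightarrow> complex. v)"
    by (rule clinearI) auto
  have f0: "f 0 = 0"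
    by (rule cfun_pair.linear_0[OF f(1)])
  define N where "N = {v \<in> V. f v = 0}"
  have "cfun.subspace N"
    unfolding N_def by (rule kernel_subspace[OF fin_dim_imp_subspace[OF V] f(1)])
  then have N: "fin_dim N"
    using fin_dim_subspace[OF V, of N] by (auto simp: N_def)
  have "trace_on V f = trace_on N f + trace_on W (\<lambda>v. v)"
    unfolding N_def
    by (rule trace_on_exact[OF V W f(1,2) f(1) _ id]) (use f assms(5) in auto)
  also have "trace_on N f = 0"
    by (rule trace_on_zero[OF N _ f(1)]) (auto simp: N_def)
  finally have tr: "trace_on V f = trace_on W (\<lambda>v. v)"
    by simp
  obtain B where B: "finite B" "cfun.independent B" "cfun.span B = W"
    using W unfolding fin_dim_def by blast
  have "card B = 0 \<longleftrightarrow> W = {0}"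
  proof
    assume "card B = 0" then show "W = {0}"
      using B by auto
  next
    assume "W = {0}"
    then have "B \<subseteq> {0}"
      using B(3) cfun.span_superset by blast
    moreover have "0 \<notin> B"
      using B(2) cfun.dependent_zero by blast
    ultimately show "card B = 0"
      by (metis card.empty subset_singletonD singletonI)
  qed
  then show ?thesis
    using that trace_on_id[OF B _ id] tr by simp
qed

section \<open>Tuples of points in distinct columns\<close>

text \<open>K is an index set and not a length because any entry may be deleted; tuples are
  extensional, so deleting entry p is the update \<open>x(p := undefined)\<close>.\<close>

definition inj_tuples :: "nat set \<Rightarrow> 'c set \<Rightarrow> 'a set \<Rightarrow> (nat \<Rightarrow> 'c \<times> 'a) set"
  where "inj_tuples K C A = {x \<in> K \<rightarrow>\<^sub>E C \<times> A. inj_on (\<lambda>i. snd (x i)) K}"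

text \<open>Here K lists the positions already filled; a sum over entry p of tuples indexed by K
  therefore uses the free points for \<open>K - {p}\<close>.\<close>

definition free_points :: "nat set \<Rightarrow> 'c set \<Rightarrow> 'a set \<Rightarrow> (nat \<Rightarrow> 'c \<times> 'a) \<Rightarrow> ('c \<times> 'a) set"
  where "free_points K C A y = C \<times> (A - (\<lambda>i. snd (y i)) ` K)"

text \<open>Values lie in an arbitrary abelian group, so that the same map serves scalars and
  vectors that are themselves functions.\<close>

definition sum_at ::
  "nat \<Rightarrow> nat set \<Rightarrow> 'c set \<Rightarrow> 'a set \<Rightarrow> ((nat \<Rightarrow> 'c \<times> 'a) \<Rightarrow> 'v::ab_group_add)
    \<Rightarrow> (nat \<Rightarrow> 'c \<times> 'a) \<Rightarrow> 'v"
  where "sum_at p K C A F y = (\<Sum>z\<in>free_points (K - {p}) C A y. F (y(p := z)))"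

lemma finite_free_points: "finite C \<Longrightarrow> finite A \<Longrightarrow> finite (free_points K C A y)"
  unfolding free_points_def by simp

lemma free_points_upd_mem:
  assumes "p \<in> K"
  shows "free_points K C A (y(p := z)) = {w \<in> free_points (K - {p}) C A y. snd w \<noteq> snd z}"
proof -
  let ?f = "\<lambda>i. snd ((y(p := z)) i)"
  have "K = insert p (K - {p})"
    using assms by blast
  then have "?f ` K = insert (?f p) (?f ` (K - {p}))"
    by (metis image_insert)
  moreover have "?f ` (K - {p}) = (\<lambda>i. snd (y i)) ` (K - {p})"
    by (intro image_cong) auto
  ultimately have "?f ` K = insert (snd z) ((\<lambda>i. snd (y i)) ` (K - {p}))"
    by simp
  then show ?thesis
    unfolding free_points_def by auto
qed

lemma inj_tuples_upd:
  assumes "p \<in> K" "y \<in> inj_tuples (K - {p}) C A" "z \<in> free_points (K - {p}) C A y"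
  shows "y(p := z) \<in> inj_tuples K C A"
proof -
  have "y(p := z) \<in> K \<rightarrow>\<^sub>E C \<times> A"
    using assms unfolding inj_tuples_def free_points_def
    by (auto simp: PiE_iff extensional_def)
  moreover have "inj_on (\<lambda>i. snd ((y(p := z)) i)) K"
    using assms unfolding inj_tuples_def free_points_def inj_on_def
    by (auto simp: image_iff)
  ultimately show ?thesis
    unfolding inj_tuples_def by blast
qed

lemma inj_tuples_del:
  assumes "p \<in> K" "x \<in> inj_tuples K C A"
  shows "x(p := undefined) \<in> inj_tuples (K - {p}) C A"
    "x p \<in> free_points (K - {p}) C A (x(p := undefined))"
proof -
  show "x(p := undefined) \<in> inj_tuples (K - {p}) C A"
    using assms unfolding inj_tuples_def by (auto simp: PiE_iff extensional_def inj_on_def)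
  have "snd (x p) \<notin> (\<lambda>i. snd ((x(p := undefined)) i)) ` (K - {p})"
  proof
    assume "snd (x p) \<in> (\<lambda>i. snd ((x(p := undefined)) i)) ` (K - {p})"
    then obtain i where "i \<in> K - {p}" "snd (x p) = snd (x i)"
      by (auto simp: image_iff)
    then show False
      using assms by (auto simp: inj_tuples_def inj_on_def)
  qed
  then show "x p \<in> free_points (K - {p}) C A (x(p := undefined))"
    using assms unfolding inj_tuples_def free_points_def by (auto simp: PiE_iff mem_Times_iff)
qed

lemma inj_tuples_eq_image:
  assumes "p \<in> K"
  shows "inj_tuples K C A =
    (\<lambda>(y, z). y(p := z)) ` (SIGMA y:inj_tuples (K - {p}) C A. free_points (K - {p}) C A y)"
  (is "_ = ?h ` ?S")
proof (intro equalityI subsetI)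
  fix x assume "x \<in> inj_tuples K C A"
  then have "(x(p := undefined), x p) \<in> ?S"
    using inj_tuples_del[OF assms] by blast
  then have "?h (x(p := undefined), x p) \<in> ?h ` ?S"
    by (rule imageI)
  then show "x \<in> ?h ` ?S"
    by simp
next
  fix x assume "x \<in> ?h ` ?S"
  then obtain w where w: "w \<in> ?S" "x = ?h w"
    by (rule imageE)
  obtain y z where "w = (y, z)"
    by (cases w)
  then show "x \<in> inj_tuples K C A"
    using w inj_tuples_upd[OF assms, of y C A z] by simp
qed

lemma inj_on_upd_inj_tuples:
  "inj_on (\<lambda>(y, z). y(p := z)) (SIGMA y:inj_tuples (K - {p}) C A. free_points (K - {p}) C A y)"
  (is "inj_on ?h ?S")
proof (rule inj_onI)
  fix v v' assume v: "v \<in> ?S" "v' \<in> ?S" "?h v = ?h v'"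
  obtain y z where yz: "v = (y, z)"
    by (cases v)
  obtain y' z' where yz': "v' = (y', z')"
    by (cases v')
  have eq: "y(p := z) = y'(p := z')" and y: "y \<in> inj_tuples (K - {p}) C A" "y' \<in> inj_tuples (K - {p}) C A"
    using v yz yz' by simp_all
  have u: "y p = undefined" "y' p = undefined"
    using y by (auto simp: inj_tuples_def PiE_iff extensional_def)
  have "y i = y' i" for i
    using u fun_cong[OF eq, of i] by (cases "i = p") simp_all
  then show "v = v'"
    using fun_cong[OF eq, of p] yz yz' by (simp add: fun_eq_iff)
qed

lemma inj_tuples_snd: "x \<in> inj_tuples K C A \<Longrightarrow> i \<in> K \<Longrightarrow> snd (x i) \<in> A"
  by (auto simp: inj_tuples_def PiE_iff mem_Times_iff)

lemma finite_inj_tuples: "finite K \<Longrightarrow> finite C \<Longrightarrow> finite A \<Longrightarrow> finite (inj_tuples K C A)"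
  unfolding inj_tuples_def by (rule finite_subset[of _ "K \<rightarrow>\<^sub>E C \<times> A"]) (auto intro: finite_PiE)

lemma inj_tuples_mono: "A \<subseteq> B \<Longrightarrow> inj_tuples K C A \<subseteq> inj_tuples K C B"
  unfolding inj_tuples_def by (auto simp: PiE_iff mem_Times_iff)

lemma sum_at_cong:
  assumes "p \<in> K" "y \<in> inj_tuples (K - {p}) C A" "\<And>x. x \<in> inj_tuples K C A \<Longrightarrow> F x = G x"
  shows "sum_at p K C A F y = sum_at p K C A G y"
  unfolding sum_at_def using assms inj_tuples_upd[OF assms(1,2)] by (intro sum.cong) auto

text \<open>Both sides sum over the ordered pairs of free points in distinct columns, a symmetric
  condition.\<close>

lemma sum_at_commute:
  assumes "finite C" "finite A" "p \<in> K" "q \<in> K" "p \<noteq> q"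
  shows "sum_at p (K - {q}) C A (sum_at q K C A F) y
    = sum_at q (K - {p}) C A (sum_at p K C A F) y"
proof -
  let ?S = "free_points (K - {p} - {q}) C A y"
  have S: "finite ?S"
    using assms by (simp add: finite_free_points)
  have K: "K - {q} - {p} = K - {p} - {q}"
    by blast
  have expand: "sum_at i (K - {j}) C A (sum_at j K C A F) y
      = (\<Sum>z\<in>?S. \<Sum>w\<in>?S. if snd w \<noteq> snd z then F (y(i := z, j := w)) else 0)"
    if "{i, j} = {p, q}" "i \<noteq> j" for i j
  proof -
    have ij: "K - {j} - {i} = K - {p} - {q}" "i \<in> K - {j}"
      using that assms by (auto simp: doubleton_eq_iff)
    have "sum_at j K C A F (y(i := z))
        = (\<Sum>w\<in>?S. if snd w \<noteq> snd z then F (y(i := z, j := w)) else 0)" for z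
      unfolding sum_at_def free_points_upd_mem[OF ij(2)] ij(1)
      by (rule sum.inter_filter[OF S])
    then show ?thesis
      unfolding sum_at_def[of i] ij(1) by simp
  qed
  have "sum_at p (K - {q}) C A (sum_at q K C A F) y
      = (\<Sum>z\<in>?S. \<Sum>w\<in>?S. if snd w \<noteq> snd z then F (y(p := z, q := w)) else 0)"
    by (rule expand) (use assms in auto)
  also have "\<dots> = (\<Sum>w\<in>?S. \<Sum>z\<in>?S. if snd z \<noteq> snd w then F (y(q := w, p := z)) else 0)"
    by (subst sum.swap) (use assms(5) in \<open>auto intro!: sum.cong simp: fun_upd_twist\<close>)
  also have "\<dots> = sum_at q (K - {p}) C A (sum_at p K C A F) y"
    by (rule expand[symmetric]) (use assms in auto)
  finally show ?thesis .
qed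

section \<open>Adding a column, and surjectivity of the summation maps\<close>

lemma sum_at_insert_absent:
  assumes "finite C" "finite A" "a \<notin> A" "y \<in> inj_tuples (K - {p}) C A"
  shows "sum_at p K C (insert a A) F y = sum_at p K C A F y + (\<Sum>c\<in>C. F (y(p := (c, a))))"
proof -
  let ?Y = "(\<lambda>i. snd (y i)) ` (K - {p})"
  have "a \<notin> ?Y"
    using assms(3,4) by (force simp: inj_tuples_def PiE_iff mem_Times_iff)
  then have "free_points (K - {p}) C (insert a A) y = free_points (K - {p}) C A y \<union> C \<times> {a}"
    unfolding free_points_def by auto
  moreover have "free_points (K - {p}) C A y \<inter> C \<times> {a} = {}"
    using assms(3) unfolding free_points_def by auto
  moreover have "(\<Sum>z\<in>C \<times> {a}. F (y(p := z))) = (\<Sum>c\<in>C. F (y(p := (c, a))))"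
    by (rule sum.reindex_bij_witness[of _ "\<lambda>c. (c, a)" fst]) auto
  ultimately show ?thesis
    unfolding sum_at_def using assms(1,2) by (simp add: sum.union_disjoint finite_free_points)
qed

text \<open>Entry i blocks column a for entry p, so the sum sees only the old columns and the
  remaining indices.\<close>

lemma sum_at_insert_present:
  assumes "a \<notin> A" "i \<in> K - {p}" "y \<in> inj_tuples (K - {p} - {i}) C A"
  shows "sum_at p K C (insert a A) F (y(i := (c, a)))
    = sum_at p (K - {i}) C A (\<lambda>x. F (x(i := (c, a)))) y"
proof -
  have K: "K - {i} - {p} = K - {p} - {i}"
    by blast
  let ?Y = "(\<lambda>j. snd (y j)) ` (K - {p} - {i})"
  have "a \<notin> ?Y"
    using assms(1,3) by (force simp: inj_tuples_def PiE_iff mem_Times_iff)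
  then have "free_points (K - {p}) C (insert a A) (y(i := (c, a))) = free_points (K - {i} - {p}) C A y"
    unfolding free_points_upd_mem[OF assms(2)] K using assms(1) unfolding free_points_def by auto
  then show ?thesis
    unfolding sum_at_def using assms(2) by (simp add: fun_upd_twist)
qed

lemma sum_at_diff: "sum_at p K C A (\<lambda>x. F x - G x) y = sum_at p K C A F y - sum_at p K C A G y"
  unfolding sum_at_def by (rule sum_subtractf)

lemma sum_at_uminus: "sum_at p K C A (\<lambda>x. - F x) y = - sum_at p K C A F y"
  unfolding sum_at_def by (rule sum_negf)

lemma sum_at_sum: "sum_at p K C A (\<lambda>x. \<Sum>i\<in>I. F i x) y = (\<Sum>i\<in>I. sum_at p K C A (F i) y)"
  unfolding sum_at_def by (rule sum.swap)

text \<open>Induction on the columns: remove a column \<open>a\<close> and lift separately the parts of \<open>G\<close> where the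
  entry \<open>p\<close> lies in \<open>a\<close>. The part of \<open>F\<close> avoiding \<open>a\<close> is a sum of lifts that corrects the sums at
  \<open>p \<in> J\<close>, and the values with entry \<open>q\<close> at \<open>(c0, a)\<close> absorb the remaining error.\<close>

lemma sum_at_surj:
  fixes G :: "(nat \<Rightarrow> 'c \<times> 'a) \<Rightarrow> 'v::ab_group_add"
  assumes "finite A" and C: "finite C" "C \<noteq> {}" and "finite K"
    and V: "0 \<in> V" "\<And>u v. u \<in> V \<Longrightarrow> v \<in> V \<Longrightarrow> u - v \<in> V"
    and "q \<in> K" "J \<subseteq> K - {q}" "card J + card K \<le> card A" "\<And>y. G y \<in> V"
    and "\<And>p y. p \<in> J \<Longrightarrow> y \<in> inj_tuples (K - {q} - {p}) C A \<Longrightarrow> sum_at p (K - {q}) C A G y = 0"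
  shows "\<exists>F. (\<forall>x. F x \<in> V) \<and>
    (\<forall>p\<in>J. \<forall>y\<in>inj_tuples (K - {p}) C A. sum_at p K C A F y = 0) \<and>
    (\<forall>y\<in>inj_tuples (K - {q}) C A. sum_at q K C A F y = G y)"
  using assms(1,4,7-)
proof (induction A arbitrary: K J q G rule: finite_induct)
  case empty
  then have "card K \<noteq> 0"
    by auto
  with empty show ?case
    by simp
next
  case (insert a A)
  note finK = \<open>finite K\<close> and q = \<open>q \<in> K\<close> and J = \<open>J \<subseteq> K - {q}\<close> and GV = \<open>\<And>y. G y \<in> V\<close>
    and A = \<open>finite A\<close> \<open>a \<notin> A\<close>
  note sum0 = \<open>\<And>p y. p \<in> J \<Longrightarrow> y \<in> inj_tuples (K - {q} - {p}) C (insert a A)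
    \<Longrightarrow> sum_at p (K - {q}) C (insert a A) G y = 0\<close>
  obtain c0 where c0: "c0 \<in> C"
    using C(2) by blast
  have uV: "- u \<in> V" if "u \<in> V" for u
    using V(2)[OF V(1) that] by simp
  have pV: "u + v \<in> V" if "u \<in> V" "v \<in> V" for u v
    using V(2)[OF that(1) uV[OF that(2)]] by simp
  have sV: "(\<Sum>i\<in>I. f i) \<in> V" if "\<And>i. i \<in> I \<Longrightarrow> f i \<in> V" for I :: "'i set" and f
    using that by (induction I rule: infinite_finite_induct) (auto simp: V(1) pV)
  have finJ: "finite J"
    using finite_subset[OF J] finK by simp
  have bound: "card J + card K \<le> Suc (card A)"
    using insert.prems(4) A by simp
  have up: "y(p := (c, a)) \<in> inj_tuples K C (insert a A)"
    if "p \<in> K" "y \<in> inj_tuples (K - {p}) C A" "c \<in> C" for p y c K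
  proof (rule inj_tuples_upd[OF that(1)])
    show "y \<in> inj_tuples (K - {p}) C (insert a A)"
      using that(2) inj_tuples_mono[of A "insert a A"] by blast
    show "(c, a) \<in> free_points (K - {p}) C (insert a A) y"
      using that(2,3) A(2) unfolding free_points_def
      by (force simp: inj_tuples_def PiE_iff mem_Times_iff)
  qed
  have "\<exists>F. (\<forall>x. F x \<in> V) \<and>
      (\<forall>i\<in>J - {p}. \<forall>y\<in>inj_tuples (K - {p} - {i}) C A. sum_at i (K - {p}) C A F y = 0) \<and>
      (\<forall>y\<in>inj_tuples (K - {p} - {q}) C A. sum_at q (K - {p}) C A F y = G (y(p := (c, a))))"
    if p: "p \<in> K - {q}" and c: "c \<in> C" for p c
  proof (rule insert.IH)
    \<comment> \<open>The lost column is paid for by p leaving K; if p also lies in J, there is one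
      to spare.\<close>
    show "card (J - {p}) + card (K - {p}) \<le> card A"
    proof (cases "p \<in> J")
      case True
      have "card J = Suc (card (J - {p}))"
        by (rule card.remove[OF finJ True])
      moreover have "card K = Suc (card (K - {p}))"
        by (rule card.remove[OF finK]) (use p in blast)
      ultimately show ?thesis
        using bound by simp
    next
      case False
      then have "J - {p} = J"
        by blast
      moreover have "card K = Suc (card (K - {p}))"
        by (rule card.remove[OF finK]) (use p in blast)
      ultimately show ?thesis
        using bound by simp
    qed
    fix i y assume i: "i \<in> J - {p}" and y: "y \<in> inj_tuples (K - {p} - {q} - {i}) C A"
    have K: "K - {p} - {q} - {i} = K - {q} - {i} - {p}" "K - {p} - {q} = K - {q} - {p}"
      by auto
    have pK: "p \<in> K - {q} - {i}"
      using p i by blast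
    have "sum_at i (K - {p} - {q}) C A (\<lambda>y. G (y(p := (c, a)))) y
        = sum_at i (K - {q}) C (insert a A) G (y(p := (c, a)))"
      unfolding K(2) by (rule sum_at_insert_present[symmetric, OF A(2) pK]) (use y K in simp)
    also have "\<dots> = 0"
      using sum0[of i "y(p := (c, a))"] up[OF pK _ c, of y] i y K(1) by simp
    finally show "sum_at i (K - {p} - {q}) C A (\<lambda>y. G (y(p := (c, a)))) y = 0" .
  qed (use p q J finK GV in auto)
  then obtain L where LV: "\<And>p c x. p \<in> K - {q} \<Longrightarrow> c \<in> C \<Longrightarrow> L p c x \<in> V"
    and L0: "\<And>p c i y. p \<in> K - {q} \<Longrightarrow> c \<in> C \<Longrightarrow> i \<in> J - {p} \<Longrightarrow> y \<in> inj_tuples (K - {p} - {i}) C A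
      \<Longrightarrow> sum_at i (K - {p}) C A (L p c) y = 0"
    and Lq: "\<And>p c y. p \<in> K - {q} \<Longrightarrow> c \<in> C \<Longrightarrow> y \<in> inj_tuples (K - {p} - {q}) C A
      \<Longrightarrow> sum_at q (K - {p}) C A (L p c) y = G (y(p := (c, a)))"
    by metis
  \<comment> \<open>The induction hypothesis is used with p in the role of q and the same K: now p
    leaving J pays for the lost column. The prescribed sum cancels what column a contributes to the
    sum at p.\<close>
  have "\<exists>F. (\<forall>x. F x \<in> V) \<and>
      (\<forall>i\<in>J - {p}. \<forall>y\<in>inj_tuples (K - {i}) C A. sum_at i K C A F y = 0) \<and>
      (\<forall>y\<in>inj_tuples (K - {p}) C A. sum_at p K C A F y = - (\<Sum>c\<in>C. L p c y))"
    if p: "p \<in> J" for p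
  proof (rule insert.IH)
    have "card J = Suc (card (J - {p}))"
      by (rule card.remove[OF finJ p])
    then show "card (J - {p}) + card K \<le> card A"
      using bound by simp
    show "- (\<Sum>c\<in>C. L p c y) \<in> V" for y
      using p J by (intro uV sV LV) auto
    fix i y assume i: "i \<in> J - {p}" "y \<in> inj_tuples (K - {p} - {i}) C A"
    have "p \<in> K - {q}"
      using p J by blast
    then show "sum_at i (K - {p}) C A (\<lambda>y. - (\<Sum>c\<in>C. L p c y)) y = 0"
      unfolding sum_at_uminus sum_at_sum using L0 i by simp
  qed (use p J finK in auto)
  then obtain M where MV: "\<And>p x. p \<in> J \<Longrightarrow> M p x \<in> V"
    and M0: "\<And>p i y. p \<in> J \<Longrightarrow> i \<in> J - {p} \<Longrightarrow> y \<in> inj_tuples (K - {i}) C A \<Longrightarrow> sum_at i K C A (M p) y = 0"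
    and Mp: "\<And>p y. p \<in> J \<Longrightarrow> y \<in> inj_tuples (K - {p}) C A
      \<Longrightarrow> sum_at p K C A (M p) y = - (\<Sum>c\<in>C. L p c y)"
    by metis
  define F0 where "F0 x = (\<Sum>p\<in>J. M p x)" for x
  have F0V: "F0 x \<in> V" for x
    unfolding F0_def by (intro sV MV)
  have F0: "sum_at p K C A F0 y = - (\<Sum>c\<in>C. L p c y)"
    if "p \<in> J" "y \<in> inj_tuples (K - {p}) C A" for p y
  proof -
    have "sum_at p K C A F0 y = (\<Sum>i\<in>J. sum_at p K C A (M i) y)"
      unfolding F0_def by (rule sum_at_sum)
    also have "\<dots> = sum_at p K C A (M p) y"
      using that M0[of _ p y] by (subst sum.remove[OF finJ that(1)]) simp
    finally show ?thesis
      using Mp that by simp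
  qed
  define H where "H y = G y - sum_at q K C A F0 y" for y
  have HV: "H y \<in> V" for y
    unfolding H_def sum_at_def by (intro V(2) GV sV F0V)
  \<comment> \<open>Both terms of H have the same sum at p: for F0 by commuting the sums at p and q
    and using \<open>Lq\<close>, for G by splitting \<open>sum0\<close> along column a.\<close>
  have H0: "sum_at p (K - {q}) C A H y = 0"
    if p: "p \<in> J" and y: "y \<in> inj_tuples (K - {p} - {q}) C A" for p y
  proof -
    have pK: "p \<in> K - {q}"
      using p J by blast
    have K: "K - {q} - {p} = K - {p} - {q}"
      by blast
    have y': "y \<in> inj_tuples (K - {q} - {p}) C A" "y \<in> inj_tuples (K - {q} - {p}) C (insert a A)"
      using y inj_tuples_mono[of A "insert a A"] K by auto
    have "sum_at p (K - {q}) C A (sum_at q K C A F0) y = sum_at q (K - {p}) C A (sum_at p K C A F0) y"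
      using C A pK q by (intro sum_at_commute) auto
    also have "\<dots> = sum_at q (K - {p}) C A (\<lambda>y. - (\<Sum>c\<in>C. L p c y)) y"
      using F0[OF p] q pK y by (intro sum_at_cong) auto
    also have "\<dots> = - (\<Sum>c\<in>C. G (y(p := (c, a))))"
      unfolding sum_at_uminus sum_at_sum using Lq[OF pK _ y] by simp
    finally have *: "sum_at p (K - {q}) C A (sum_at q K C A F0) y = - (\<Sum>c\<in>C. G (y(p := (c, a))))" .
    have "0 = sum_at p (K - {q}) C A G y + (\<Sum>c\<in>C. G (y(p := (c, a))))"
      using sum0[OF p y'(2)] sum_at_insert_absent[OF C(1) A y'(1), of G] by simp
    then show ?thesis
      unfolding H_def sum_at_diff * by simp
  qed
  \<comment> \<open>\<open>R p c\<close> prescribes F on the tuples with entry p at (c, a). For p =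
    q the single color c0 carries the whole of H, so that summing over column a yields H exactly
    once.\<close>
  define R where "R p c = (if p = q then (if c = c0 then H else (\<lambda>_. 0)) else L p c)" for p c
  \<comment> \<open>A tuple in distinct columns has at most one entry in column a, so there the
    choice is unambiguous; the default 0 keeps the remaining values in V.\<close>
  define F where "F x = (if \<exists>p\<in>K. snd (x p) = a
    then (let p = (SOME p. p \<in> K \<and> snd (x p) = a) in
      if fst (x p) \<in> C then R p (fst (x p)) (x(p := undefined)) else 0)
    else F0 x)" for x
  have Fa: "F (y(p := (c, a))) = R p c y"
    if "p \<in> K" "y \<in> inj_tuples (K - {p}) C A" "c \<in> C" for p y c
  proof -
    have "snd (y i) \<noteq> a" if "i \<in> K - {p}" for i
      using inj_tuples_snd[OF \<open>y \<in> inj_tuples (K - {p}) C A\<close> that] A(2) by blast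
    then have "(SOME i. i \<in> K \<and> snd ((y(p := (c, a))) i) = a) = p"
      using that(1) by (intro some_equality) (auto split: if_splits)
    moreover have "y p = undefined"
      using that(2) by (auto simp: inj_tuples_def PiE_iff extensional_def)
    ultimately show ?thesis
      unfolding F_def using that by (auto simp: Let_def fun_upd_idem)
  qed
  have Fno: "F x = F0 x" if "x \<in> inj_tuples K C A" for x
  proof -
    have "snd (x i) \<noteq> a" if "i \<in> K" for i
      using inj_tuples_snd[OF \<open>x \<in> inj_tuples K C A\<close> that] A(2) by blast
    then show ?thesis
      unfolding F_def by auto
  qed
  have split: "(y \<in> inj_tuples K' C A) \<or>
      (\<exists>i\<in>K'. \<exists>c\<in>C. \<exists>u\<in>inj_tuples (K' - {i}) C A. y = u(i := (c, a)))"
    if y: "y \<in> inj_tuples K' C (insert a A)" for y K'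
  proof (cases "\<exists>i\<in>K'. snd (y i) = a")
    case True
    then obtain i where i: "i \<in> K'" "snd (y i) = a"
      by blast
    have "y(i := undefined) \<in> inj_tuples (K' - {i}) C A"
      using y i unfolding inj_tuples_def
      by (auto simp: PiE_iff extensional_def inj_on_def mem_Times_iff)
    moreover have "fst (y i) \<in> C"
      using y i by (auto simp: inj_tuples_def PiE_iff mem_Times_iff)
    moreover have "y = (y(i := undefined))(i := (fst (y i), a))"
      using i by (metis fun_upd_triv fun_upd_upd prod.collapse)
    ultimately show ?thesis
      using i(1) by blast
  next
    case False
    then have "y \<in> inj_tuples K' C A"
      using y unfolding inj_tuples_def by (auto simp: PiE_iff mem_Times_iff)
    then show ?thesis ..
  qed
  have FV: "F x \<in> V" for x
  proof -
    have "R p c y \<in> V" if "p \<in> K" "c \<in> C" for p c y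
      using that HV LV V(1) unfolding R_def by auto
    moreover have "(SOME p. p \<in> K \<and> snd (x p) = a) \<in> K" if "\<exists>p\<in>K. snd (x p) = a"
      using someI_ex[of "\<lambda>p. p \<in> K \<and> snd (x p) = a"] that by blast
    ultimately show ?thesis
      unfolding F_def using F0V V(1) by (simp add: Let_def)
  qed
  show ?case
  proof (intro exI[of _ F] conjI ballI allI)
    show "F x \<in> V" for x
      by (rule FV)
  next
    fix p y assume p: "p \<in> J" and y: "y \<in> inj_tuples (K - {p}) C (insert a A)"
    have pK: "p \<in> K" "p \<noteq> q"
      using p J by auto
    from split[OF y] show "sum_at p K C (insert a A) F y = 0"
    proof
      assume y: "y \<in> inj_tuples (K - {p}) C A"
      have "sum_at p K C A F y = - (\<Sum>c\<in>C. L p c y)"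
        using sum_at_cong[OF pK(1) y Fno] F0[OF p y] by simp
      moreover have "(\<Sum>c\<in>C. F (y(p := (c, a)))) = (\<Sum>c\<in>C. L p c y)"
        using Fa[OF pK(1) y] pK(2) by (simp add: R_def)
      ultimately show ?thesis
        unfolding sum_at_insert_absent[OF C(1) A y] by simp
    next
      assume "\<exists>i\<in>K - {p}. \<exists>c\<in>C. \<exists>u\<in>inj_tuples (K - {p} - {i}) C A. y = u(i := (c, a))"
      then obtain i c u where i: "i \<in> K - {p}" and c: "c \<in> C"
        and u: "u \<in> inj_tuples (K - {p} - {i}) C A" and y_eq: "y = u(i := (c, a))"
        by blast
      have K: "K - {p} - {i} = K - {i} - {p}"
        by blast
      have "sum_at p K C (insert a A) F y = sum_at p (K - {i}) C A (\<lambda>x. F (x(i := (c, a)))) u"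
        unfolding y_eq by (rule sum_at_insert_present[OF A(2) i u])
      also have "\<dots> = sum_at p (K - {i}) C A (R i c) u"
        using pK(1) i u K c by (intro sum_at_cong Fa) auto
      also have "\<dots> = 0"
      proof (cases "i = q")
        case True
        then show ?thesis
          using H0[OF p] u by (simp add: R_def sum_at_def)
      next
        case False
        then show ?thesis
          using L0[of i c p u] i c p u K by (auto simp: R_def)
      qed
      finally show ?thesis .
    qed
  next
    fix y assume y: "y \<in> inj_tuples (K - {q}) C (insert a A)"
    from split[OF y] show "sum_at q K C (insert a A) F y = G y"
    proof
      assume y: "y \<in> inj_tuples (K - {q}) C A"
      have "(\<Sum>c\<in>C. F (y(q := (c, a)))) = (\<Sum>c\<in>C. if c = c0 then H y else 0)"
        using Fa[OF q y] by (intro sum.cong) (auto simp: R_def)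
      also have "\<dots> = H y"
        using C(1) c0 by simp
      finally show ?thesis
        unfolding sum_at_insert_absent[OF C(1) A y] using sum_at_cong[OF q y Fno]
        by (simp add: H_def)
    next
      assume "\<exists>i\<in>K - {q}. \<exists>c\<in>C. \<exists>u\<in>inj_tuples (K - {q} - {i}) C A. y = u(i := (c, a))"
      then obtain i c u where i: "i \<in> K - {q}" and c: "c \<in> C"
        and u: "u \<in> inj_tuples (K - {q} - {i}) C A" and y_eq: "y = u(i := (c, a))"
        by blast
      have K: "K - {q} - {i} = K - {i} - {q}"
        by blast
      have "sum_at q K C (insert a A) F y = sum_at q (K - {i}) C A (\<lambda>x. F (x(i := (c, a)))) u"
        unfolding y_eq by (rule sum_at_insert_present[OF A(2) i u])
      also have "\<dots> = sum_at q (K - {i}) C A (R i c) u"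
        using q i u K c by (intro sum_at_cong Fa) auto
      also have "\<dots> = G y"
        using Lq[OF i c] u K i y_eq by (simp add: R_def)
      finally show ?thesis .
    qed
  qed
qed

section \<open>Kernels of the summation maps\<close>

lemma sum_apply: "(\<Sum>i\<in>I. f i) t = (\<Sum>i\<in>I. f i t)" for f :: "'i \<Rightarrow> 't \<Rightarrow> 'v::comm_monoid_add"
  by (induction I rule: infinite_finite_induct) simp_all

lemma sum_at_apply: "sum_at p K C A F y t = sum_at p K C A (\<lambda>x. F x t) y"
  unfolding sum_at_def by (rule sum_apply)

text \<open>A model of M_K \<otimes> V. Vectors of V are complex functions on \<open>'t\<close>, so
  a V-valued function of tuples is stored uncurried and is again a complex function; vanishing off
  the tuples makes the space finite-dimensional when V is and the index sets are finite.\<close>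

definition tuple_space ::
  "nat set \<Rightarrow> 'c set \<Rightarrow> 'a set \<Rightarrow> ('t \<Rightarrow> complex) set \<Rightarrow> ((nat \<Rightarrow> 'c \<times> 'a) \<times> 't \<Rightarrow> complex) set"
  where "tuple_space K C A V =
    {\<Phi>. (\<forall>x. (\<lambda>t. \<Phi> (x, t)) \<in> V) \<and> (\<forall>x t. x \<notin> inj_tuples K C A \<longrightarrow> \<Phi> (x, t) = 0)}"

definition tuple_sum ::
  "nat \<Rightarrow> nat set \<Rightarrow> 'c set \<Rightarrow> 'a set \<Rightarrow> ((nat \<Rightarrow> 'c \<times> 'a) \<times> 't \<Rightarrow> complex)
    \<Rightarrow> (nat \<Rightarrow> 'c \<times> 'a) \<times> 't \<Rightarrow> complex"
  where "tuple_sum p K C A \<Phi> = (\<lambda>(y, t).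
    if y \<in> inj_tuples (K - {p}) C A then sum_at p K C A (\<lambda>x. \<Phi> (x, t)) y else 0)"

text \<open>J is separate from K so that conditions can be added one at a time; the space of
  interest has J = K.\<close>

definition kernel_space ::
  "nat set \<Rightarrow> nat set \<Rightarrow> 'c set \<Rightarrow> 'a set \<Rightarrow> ('t \<Rightarrow> complex) set
    \<Rightarrow> ((nat \<Rightarrow> 'c \<times> 'a) \<times> 't \<Rightarrow> complex) set"
  where "kernel_space J K C A V =
    {\<Phi> \<in> tuple_space K C A V. \<forall>p\<in>J. tuple_sum p K C A \<Phi> = 0}"

text \<open>A pullback in the tuple argument: \<gamma> plays the role of an inverse group element,
  which is why inverses appear whenever a representation is built from it.\<close>

definition tuple_act ::
  "nat set \<Rightarrow> 'c set \<Rightarrow> 'a set \<Rightarrow> ('c \<times> 'a \<Rightarrow> 'c \<times> 'a) \<Rightarrow> (('t \<Rightarrow> complex) \<Rightarrow> 't \<Rightarrow> complex)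
    \<Rightarrow> ((nat \<Rightarrow> 'c \<times> 'a) \<times> 't \<Rightarrow> complex) \<Rightarrow> (nat \<Rightarrow> 'c \<times> 'a) \<times> 't \<Rightarrow> complex"
  where "tuple_act K C A \<gamma> f \<Phi> = (\<lambda>(x, t).
    if x \<in> inj_tuples K C A then f (\<lambda>s. \<Phi> (\<lambda>i\<in>K. \<gamma> (x i), s)) t else 0)"

text \<open>Common abstraction of the elements of the wreath product and, for a single color, of the
  permutations of A.\<close>

definition column_perm :: "'c set \<Rightarrow> 'a set \<Rightarrow> ('c \<times> 'a \<Rightarrow> 'c \<times> 'a) \<Rightarrow> bool"
  where "column_perm C A \<gamma> \<longleftrightarrow> bij_betw \<gamma> (C \<times> A) (C \<times> A) \<and>
    (\<forall>z\<in>C \<times> A. \<forall>w\<in>C \<times> A. snd (\<gamma> z) = snd (\<gamma> w) \<longleftrightarrow> snd z = snd w)"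

lemma tuple_spaceD: "\<Phi> \<in> tuple_space K C A V \<Longrightarrow> (\<lambda>t. \<Phi> (x, t)) \<in> V"
  "\<Phi> \<in> tuple_space K C A V \<Longrightarrow> x \<notin> inj_tuples K C A \<Longrightarrow> \<Phi> (x, t) = 0"
  unfolding tuple_space_def by auto

lemma tuple_space_subspace:
  assumes "cfun.subspace V"
  shows "cfun.subspace (tuple_space K C A V)"
proof (rule cfun.subspaceI)
  show "0 \<in> tuple_space K C A V"
    using cfun.subspace_0[OF assms] unfolding tuple_space_def zero_fun_def by simp
next
  fix u c
  assume u: "u \<in> tuple_space K C A V"
  show "(\<lambda>x. c * u x) \<in> tuple_space K C A V"
    using cfun.subspace_scale[OF assms tuple_spaceD(1)[OF u], of c] tuple_spaceD(2)[OF u]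
    unfolding tuple_space_def by simp
next
  fix u v
  assume u: "u \<in> tuple_space K C A V" and v: "v \<in> tuple_space K C A V"
  show "u + v \<in> tuple_space K C A V"
    using cfun.subspace_add[OF assms tuple_spaceD(1)[OF u] tuple_spaceD(1)[OF v]]
      tuple_spaceD(2)[OF u] tuple_spaceD(2)[OF v]
    unfolding tuple_space_def plus_fun_def by simp
qed

lemma tuple_sum_linear: "clinear (tuple_sum p K C A)"
  by (rule clinearI)
    (simp_all add: tuple_sum_def fun_eq_iff sum_at_def sum.distrib sum_distrib_left)

lemma tuple_act_linear:
  fixes f :: "('t \<Rightarrow> complex) \<Rightarrow> 't \<Rightarrow> complex" and C :: "'c set" and A :: "'a set"
  assumes "clinear f"
  shows "clinear (tuple_act K C A \<gamma> f)"
proof (rule clinearI)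
  fix u v :: "(nat \<Rightarrow> 'c \<times> 'a) \<times> 't \<Rightarrow> complex" and c
  have "f (\<lambda>s. (u + v) (x, s)) = f (\<lambda>s. u (x, s)) + f (\<lambda>s. v (x, s))" for x
    using cfun_pair.linear_add[OF assms, of "\<lambda>s. u (x, s)" "\<lambda>s. v (x, s)"]
    by (simp add: plus_fun_def)
  then show "tuple_act K C A \<gamma> f (u + v) = tuple_act K C A \<gamma> f u + tuple_act K C A \<gamma> f v"
    by (simp add: tuple_act_def fun_eq_iff)
  have "f (\<lambda>s. c * u (x, s)) = (\<lambda>t. c * f (\<lambda>s. u (x, s)) t)" for x
    by (rule cfun_pair.linear_scale[OF assms])
  then show "tuple_act K C A \<gamma> f (\<lambda>x. c * u x) = (\<lambda>x. c * tuple_act K C A \<gamma> f u x)"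
    by (simp add: tuple_act_def fun_eq_iff)
qed

lemma column_perm_snd_iff:
  assumes "column_perm C A \<gamma>" "z \<in> C \<times> A" "w \<in> C \<times> A"
  shows "snd (\<gamma> z) = snd (\<gamma> w) \<longleftrightarrow> snd z = snd w"
  using assms(1)[unfolded column_perm_def, THEN conjunct2, THEN bspec, OF assms(2), THEN bspec,
      OF assms(3)] .

lemma column_perm_inj_tuples:
  assumes "column_perm C A \<gamma>" "x \<in> inj_tuples K C A"
  shows "(\<lambda>i\<in>K. \<gamma> (x i)) \<in> inj_tuples K C A"
proof -
  have x: "x i \<in> C \<times> A" if "i \<in> K" for i
    using assms(2) that by (auto simp: inj_tuples_def PiE_iff)
  have "\<gamma> (x i) \<in> C \<times> A" if "i \<in> K" for i
    using assms(1) x[OF that] unfolding column_perm_def by (meson bij_betwE)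
  moreover have "snd (\<gamma> (x i)) = snd (\<gamma> (x j)) \<longleftrightarrow> snd (x i) = snd (x j)" if "i \<in> K" "j \<in> K" for i j
    by (rule column_perm_snd_iff[OF assms(1) x[OF that(1)] x[OF that(2)]])
  ultimately show ?thesis
    using assms(2) unfolding inj_tuples_def inj_on_def by simp
qed

lemma column_perm_free_points:
  assumes "column_perm C A \<gamma>" "\<And>i. i \<in> K \<Longrightarrow> y i \<in> C \<times> A" "\<And>i. i \<in> K \<Longrightarrow> y' i = \<gamma> (y i)"
  shows "bij_betw \<gamma> (free_points K C A y) (free_points K C A y')"
proof -
  have bij: "inj_on \<gamma> (C \<times> A)" "\<gamma> ` (C \<times> A) = C \<times> A"
    using assms(1) unfolding column_perm_def bij_betw_def by auto
  have free: "z \<in> free_points K C A y \<longleftrightarrow> z \<in> C \<times> A \<and> (\<forall>i\<in>K. snd z \<noteq> snd (y i))" for z y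
    unfolding free_points_def by (auto simp: mem_Times_iff)
  have iff: "\<gamma> z \<in> free_points K C A y' \<longleftrightarrow> z \<in> free_points K C A y" if z: "z \<in> C \<times> A" for z
  proof -
    have "\<gamma> z \<in> C \<times> A"
      using bij(2) z by blast
    moreover have "snd (\<gamma> z) = snd (y' i) \<longleftrightarrow> snd z = snd (y i)" if "i \<in> K" for i
      unfolding assms(3)[OF that] by (rule column_perm_snd_iff[OF assms(1) z assms(2)[OF that]])
    ultimately show ?thesis
      unfolding free using z by simp
  qed
  have "\<gamma> ` free_points K C A y = free_points K C A y'"
  proof (intro equalityI subsetI)
    fix w assume w: "w \<in> free_points K C A y'"
    then have "w \<in> \<gamma> ` (C \<times> A)"
      using bij(2) free[of w y'] by simp
    then obtain z where z: "z \<in> C \<times> A" "w = \<gamma> z"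
      by (rule imageE)
    then show "w \<in> \<gamma> ` free_points K C A y"
      using iff[OF z(1)] w by simp
  next
    fix w assume "w \<in> \<gamma> ` free_points K C A y"
    then obtain z where z: "z \<in> free_points K C A y" "w = \<gamma> z"
      by (rule imageE)
    then show "w \<in> free_points K C A y'"
      using iff[of z] free[of z y] by simp
  qed
  moreover have "inj_on \<gamma> (free_points K C A y)"
    by (rule inj_on_subset[OF bij(1)]) (use free in blast)
  ultimately show ?thesis
    unfolding bij_betw_def by blast
qed

text \<open>A column permutation carries the free points of a tuple bijectively to those of its
  image, so summation is equivariant. This is the compatibility that the exact sequences
  require.\<close>

lemma tuple_sum_act:
  assumes f: "clinear f" and \<gamma>: "column_perm C A \<gamma>" and p: "p \<in> K"
  shows "tuple_sum p K C A (tuple_act K C A \<gamma> f \<Phi>) = tuple_act (K - {p}) C A \<gamma> f (tuple_sum p K C A \<Phi>)"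
proof (rule ext, unfold split_paired_all)
  fix y t
  show "tuple_sum p K C A (tuple_act K C A \<gamma> f \<Phi>) (y, t)
    = tuple_act (K - {p}) C A \<gamma> f (tuple_sum p K C A \<Phi>) (y, t)"
  proof (cases "y \<in> inj_tuples (K - {p}) C A")
    case True
    define y' where "y' = (\<lambda>i\<in>K - {p}. \<gamma> (y i))"
    have y': "y' \<in> inj_tuples (K - {p}) C A"
      unfolding y'_def by (rule column_perm_inj_tuples[OF \<gamma> True])
    have bij: "bij_betw \<gamma> (free_points (K - {p}) C A y) (free_points (K - {p}) C A y')"
      by (rule column_perm_free_points[OF \<gamma>]) (use True in \<open>auto simp: y'_def inj_tuples_def PiE_iff\<close>)
    have upd: "(\<lambda>i\<in>K. \<gamma> ((y(p := z)) i)) = y'(p := \<gamma> z)" for z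
      using p by (auto simp: y'_def fun_eq_iff)
    have act: "tuple_act K C A \<gamma> f \<Phi> (y(p := z), t) = f (\<lambda>s. \<Phi> (y'(p := \<gamma> z), s)) t"
      if "z \<in> free_points (K - {p}) C A y" for z
      unfolding tuple_act_def prod.case upd using inj_tuples_upd[OF p True that] by simp
    have "tuple_sum p K C A (tuple_act K C A \<gamma> f \<Phi>) (y, t)
        = (\<Sum>z\<in>free_points (K - {p}) C A y. f (\<lambda>s. \<Phi> (y'(p := \<gamma> z), s)) t)"
      unfolding tuple_sum_def sum_at_def prod.case if_P[OF True] by (rule sum.cong[OF refl act])
    also have "\<dots> = (\<Sum>w\<in>free_points (K - {p}) C A y'. f (\<lambda>s. \<Phi> (y'(p := w), s)) t)"
      by (rule sum.reindex_bij_betw[OF bij])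
    also have "\<dots> = f (\<Sum>w\<in>free_points (K - {p}) C A y'. (\<lambda>s. \<Phi> (y'(p := w), s))) t"
      by (simp only: cfun_pair.linear_sum[OF f] sum_apply)
    also have "(\<Sum>w\<in>free_points (K - {p}) C A y'. (\<lambda>s. \<Phi> (y'(p := w), s)))
        = (\<lambda>s. tuple_sum p K C A \<Phi> (y', s))"
      using y' by (simp add: fun_eq_iff tuple_sum_def sum_at_def sum_apply)
    finally show ?thesis
      using True by (simp add: tuple_act_def y'_def)
  next
    case False
    then show ?thesis
      by (simp add: tuple_sum_def tuple_act_def)
  qed
qed

lemma tuple_act_in_tuple_space:
  assumes "\<And>v. v \<in> V \<Longrightarrow> f v \<in> V" "0 \<in> V" "\<Phi> \<in> tuple_space K C A V"
  shows "tuple_act K C A \<gamma> f \<Phi> \<in> tuple_space K C A V"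
proof -
  have "f (\<lambda>s. \<Phi> (x, s)) \<in> V" for x
    using assms(1) tuple_spaceD(1)[OF assms(3)] by blast
  then have "(\<lambda>t. tuple_act K C A \<gamma> f \<Phi> (x, t)) \<in> V" for x
    using assms(2) by (cases "x \<in> inj_tuples K C A") (simp_all add: tuple_act_def flip: zero_fun_def)
  then show ?thesis
    unfolding tuple_space_def by (simp add: tuple_act_def)
qed

lemma kernel_space_act:
  assumes "clinear f" "column_perm C A \<gamma>" "\<And>v. v \<in> V \<Longrightarrow> f v \<in> V" "0 \<in> V" "J \<subseteq> K"
    and "\<Phi> \<in> kernel_space J K C A V"
  shows "tuple_act K C A \<gamma> f \<Phi> \<in> kernel_space J K C A V"
proof -
  have "tuple_sum p K C A (tuple_act K C A \<gamma> f \<Phi>) = 0" if "p \<in> J" for p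
  proof -
    have "tuple_sum p K C A \<Phi> = 0" "p \<in> K"
      using assms(5,6) that unfolding kernel_space_def by auto
    then show ?thesis
      unfolding tuple_sum_act[OF assms(1,2) \<open>p \<in> K\<close>]
      using cfun_pair.linear_0[OF tuple_act_linear[OF assms(1)]] by simp
  qed
  then show ?thesis
    using assms(6) unfolding kernel_space_def
    by (simp add: tuple_act_in_tuple_space[of V f, OF assms(3,4)])
qed

text \<open>The frame consists of the elementary tensors of a point mass at x with a basis vector b
  of V. The diagonal coefficient at (x, b) is that of f at b if the tuple x is fixed, and zero
  otherwise.\<close>

lemma
  fixes V :: "('t \<Rightarrow> complex) set" and C :: "'c set" and A :: "'a set"
  assumes V: "fin_dim V" and fin: "finite K" "finite C" "finite A"
  shows fin_dim_tuple_space: "fin_dim (tuple_space K C A V)"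
    and trace_on_tuple_space: "\<And>\<gamma> f. clinear f \<Longrightarrow> (\<And>v. v \<in> V \<Longrightarrow> f v \<in> V) \<Longrightarrow>
      trace_on (tuple_space K C A V) (tuple_act K C A \<gamma> f)
      = of_nat (card {x \<in> inj_tuples K C A. (\<lambda>i\<in>K. \<gamma> (x i)) = x}) * trace_on V f"
proof -
  obtain B where B: "finite B" "cfun.independent B" "cfun.span B = V"
    using V unfolding fin_dim_def by blast
  have sub: "cfun.subspace V"
    by (rule fin_dim_imp_subspace[OF V])
  let ?X = "inj_tuples K C A" and ?T = "tuple_space K C A V"
  have X: "finite ?X"
    by (rule finite_inj_tuples[OF fin])
  let ?I = "?X \<times> B"
  let ?e = "\<lambda>i u. if fst u = fst i then snd i (snd u) else 0"
  let ?\<phi> = "\<lambda>i \<Phi>. cfun.representation B (\<lambda>t. \<Phi> (fst i, t)) (snd i)"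
  have e: "?e i \<in> ?T" if iI: "i \<in> ?I" for i
  proof -
    obtain x b where i: "i = (x, b)" "x \<in> ?X" "b \<in> B"
      using iI by blast
    have "b \<in> V"
      using cfun.span_base[OF i(3)] B(3) by simp
    then have "(\<lambda>t. ?e i (x', t)) \<in> V" for x'
      using i cfun.subspace_0[OF sub] by (cases "x' = x") (simp_all flip: zero_fun_def)
    then show ?thesis
      unfolding tuple_space_def using i by auto
  qed
  have expand: "(\<Sum>i\<in>?I. (\<lambda>u. ?\<phi> i \<Phi> * ?e i u)) = \<Phi>" if \<Phi>: "\<Phi> \<in> ?T" for \<Phi>
  proof (rule ext, unfold split_paired_all)
    fix x t
    have "(\<Sum>i\<in>?I. (\<lambda>u. ?\<phi> i \<Phi> * ?e i u)) (x, t)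
        = (\<Sum>x'\<in>?X. \<Sum>b\<in>B. cfun.representation B (\<lambda>t. \<Phi> (x', t)) b * (if x = x' then b t else 0))"
      unfolding sum_apply sum.cartesian_product case_prod_beta fst_conv snd_conv by (rule refl)
    also have "\<dots> = (\<Sum>x'\<in>?X. if x = x'
        then (\<Sum>b\<in>B. cfun.representation B (\<lambda>t. \<Phi> (x', t)) b * b t) else 0)"
      by (rule sum.cong) auto
    also have "\<dots> = (if x \<in> ?X then (\<Sum>b\<in>B. cfun.representation B (\<lambda>t. \<Phi> (x, t)) b * b t) else 0)"
      using X by simp
    also have "\<dots> = \<Phi> (x, t)"
    proof (cases "x \<in> ?X")
      case True
      have "(\<Sum>b\<in>B. (\<lambda>t. cfun.representation B (\<lambda>t. \<Phi> (x, t)) b * b t)) = (\<lambda>t. \<Phi> (x, t))"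
        by (rule cfun.sum_representation_eq[OF B(2) _ B(1) subset_refl])
          (use tuple_spaceD(1)[OF \<Phi>] B(3) in simp)
      from fun_cong[OF this, of t] show ?thesis
        using True by (simp add: sum_apply)
    next
      case False
      then show ?thesis
        using tuple_spaceD(2)[OF \<Phi>] by simp
    qed
    finally show "(\<Sum>i\<in>?I. (\<lambda>u. ?\<phi> i \<Phi> * ?e i u)) (x, t) = \<Phi> (x, t)" .
  qed
  have "?T \<subseteq> cfun.span (?e ` ?I)"
  proof
    fix \<Phi> assume \<Phi>: "\<Phi> \<in> ?T"
    have "(\<Sum>i\<in>?I. (\<lambda>u. ?\<phi> i \<Phi> * ?e i u)) \<in> cfun.span (?e ` ?I)"
      by (rule cfun.span_sum, rule cfun.span_scale, rule cfun.span_base, rule imageI)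
    then show "\<Phi> \<in> cfun.span (?e ` ?I)"
      unfolding expand[OF \<Phi>] .
  qed
  moreover have "fin_dim (cfun.span (?e ` ?I))"
    by (rule fin_dim_span) (use X B(1) in simp)
  ultimately show T: "fin_dim ?T"
    using fin_dim_subspace tuple_space_subspace[OF sub] by blast
  fix \<gamma> :: "'c \<times> 'a \<Rightarrow> 'c \<times> 'a" and f
  assume f: "clinear f" "\<And>v. v \<in> V \<Longrightarrow> f v \<in> V"
  let ?\<gamma> = "\<lambda>x. \<lambda>i\<in>K. \<gamma> (x i)"
  have "trace_on ?T (tuple_act K C A \<gamma> f) = (\<Sum>i\<in>?I. ?\<phi> i (tuple_act K C A \<gamma> f (?e i)))"
  proof (rule trace_on_frame[OF T tuple_act_linear[OF f(1)]])
    show "tuple_act K C A \<gamma> f \<Phi> \<in> ?T" if "\<Phi> \<in> ?T" for \<Phi>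
      by (rule tuple_act_in_tuple_space[of V f, OF f(2) cfun.subspace_0[OF sub] that])
    show "functional_on ?T (?\<phi> i)" for i
    proof -
      have span: "(\<lambda>t. u (fst i, t)) \<in> cfun.span B" if "u \<in> ?T" for u
        using tuple_spaceD(1)[OF that] B(3) by simp
      have plus: "(\<lambda>t. (u + v) (fst i, t)) = (\<lambda>t. u (fst i, t)) + (\<lambda>t. v (fst i, t))"
        for u v :: "(nat \<Rightarrow> 'c \<times> 'a) \<times> 't \<Rightarrow> complex"
        by (simp add: fun_eq_iff)
      show ?thesis
        unfolding functional_on_def plus
        by (auto simp only: cfun.representation_add[OF B(2) span span]
            cfun.representation_scale[OF B(2) span])
    qed
  qed (use e expand in auto)
  also have "\<dots> = (\<Sum>x\<in>?X. \<Sum>b\<in>B. if ?\<gamma> x = x then cfun.representation B (f b) b else 0)"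
  proof -
    have "?\<phi> (x, b) (tuple_act K C A \<gamma> f (?e (x, b)))
        = (if ?\<gamma> x = x then cfun.representation B (f b) b else 0)" if "x \<in> ?X" for x b
    proof (cases "?\<gamma> x = x")
      case True
      then show ?thesis
        using that by (simp add: tuple_act_def)
    next
      case False
      have "f (\<lambda>s. 0) = (\<lambda>s. 0)"
        using cfun_pair.linear_0[OF f(1)] by (simp add: zero_fun_def)
      moreover have "cfun.representation B (\<lambda>s. 0) b = 0"
        using cfun.representation_zero[of B] by (simp add: zero_fun_def)
      ultimately show ?thesis
        using that False by (simp add: tuple_act_def)
    qed
    then show ?thesis
      unfolding sum.cartesian_product by (intro sum.cong) (auto simp only: prod.case mem_Sigma_iff)
  qed
  also have "\<dots> = (\<Sum>x\<in>?X. if ?\<gamma> x = x then trace_on V f else 0)"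
  proof -
    have "trace_on V f = (\<Sum>b\<in>B. cfun.representation B (f b) b)"
      by (rule trace_on_basis[OF B f(1)]) (rule f(2))
    then show ?thesis
      by (intro sum.cong) auto
  qed
  also have "\<dots> = (\<Sum>x\<in>{x \<in> ?X. ?\<gamma> x = x}. trace_on V f)"
    by (rule sum.inter_filter[OF X, symmetric])
  finally show "trace_on ?T (tuple_act K C A \<gamma> f)
      = of_nat (card {x \<in> ?X. ?\<gamma> x = x}) * trace_on V f"
    by simp
qed

section \<open>Tuple counts and Charlier polynomials\<close>

text \<open>With real factors the formula also covers \<open>card K > card A\<close>, where one
  factor is zero; hence the number of fixed tuples is one polynomial in the number of fixed
  columns.\<close>

lemma card_inj_tuples:
  assumes "finite K" "finite C" "finite A"
  shows "real (card (inj_tuples K C A)) = (\<Prod>i<card K. real (card C) * (real (card A) - real i))"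
  using assms(1)
proof (induction "card K" arbitrary: K)
  case 0
  then have "inj_tuples K C A = {\<lambda>i. undefined}"
    unfolding inj_tuples_def by simp
  then show ?case
    using 0 by simp
next
  case (Suc k)
  obtain p where p: "p \<in> K"
    using Suc.hyps(2) by fastforce
  have K: "finite (K - {p})" "card (K - {p}) = k"
    using Suc p by simp_all
  let ?X = "inj_tuples (K - {p}) C A"
  have free: "real (card (free_points (K - {p}) C A y)) = real (card C) * (real (card A) - real k)"
    if y: "y \<in> ?X" for y
  proof -
    have "(\<lambda>i. snd (y i)) ` (K - {p}) \<subseteq> A"
      using inj_tuples_snd[OF y] by blast
    moreover have "card ((\<lambda>i. snd (y i)) ` (K - {p})) = k"
      using y K(2) by (simp add: inj_tuples_def card_image)
    moreover have "card ((\<lambda>i. snd (y i)) ` (K - {p})) \<le> card A"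
      by (rule card_mono[OF assms(3) calculation(1)])
    ultimately show ?thesis
      unfolding free_points_def using K(1) assms
      by (simp add: card_Diff_subset card_cartesian_product of_nat_diff)
  qed
  have "card (inj_tuples K C A) = card (SIGMA y:?X. free_points (K - {p}) C A y)"
    unfolding inj_tuples_eq_image[OF p] by (rule card_image[OF inj_on_upd_inj_tuples])
  also have "\<dots> = (\<Sum>y\<in>?X. card (free_points (K - {p}) C A y))"
    using finite_inj_tuples[OF K(1) assms(2,3)] assms by (simp add: finite_free_points)
  finally have "real (card (inj_tuples K C A)) = real (card ?X) * (real (card C) * (real (card A) - real k))"
    by (simp add: free)
  also have "real (card ?X) = (\<Prod>i<k. real (card C) * (real (card A) - real i))"
    using Suc.hyps(1)[of "K - {p}"] K by simp
  finally show ?case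
    using Suc.hyps(2) by (simp flip: Suc.hyps(2))
qed

text \<open>Pascal's rule, in the shape of the recurrence that the traces satisfy when one more
  condition is imposed.\<close>

lemma alternating_binomial_sum_Suc:
  fixes g :: "nat \<Rightarrow> 'b::comm_ring_1"
  shows "(\<Sum>i\<le>Suc j. (- 1) ^ i * of_nat (Suc j choose i) * g i)
    = (\<Sum>i\<le>j. (- 1) ^ i * of_nat (j choose i) * g i) - (\<Sum>i\<le>j. (- 1) ^ i * of_nat (j choose i) * g (Suc i))"
proof -
  have "(\<Sum>i\<le>j. (- 1) ^ i * of_nat (j choose i) * g i) = (\<Sum>i\<le>Suc j. (- 1) ^ i * of_nat (j choose i) * g i)"
    by (simp add: binomial_eq_0)
  then show ?thesis
    by (simp only: sum.atMost_Suc_shift)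
      (simp add: algebra_simps sum.distrib sum_subtractf sum_negf)
qed

text \<open>For parameter 1/c the factor c^j turns the falling factorial of m into the number of
  j-tuples over m columns of c points each, so the Charlier polynomial becomes an alternating sum of
  tuple counts, reindexed by i = k - j.\<close>

lemma poly_charlier:
  assumes "c > 0"
  shows "poly (charlier (1 / real c) k) m
    = (\<Sum>i\<le>k. (- 1) ^ i * of_nat (k choose i) * (\<Prod>l<k - i. real c * (m - real l)))"
proof -
  have "(\<Prod>l<j. real c * (m - real l)) = real c ^ j * (\<Prod>l<j. m - real l)" for j
    by (simp add: prod.distrib)
  then have "poly (charlier (1 / real c) k) m
      = (\<Sum>j\<le>k. (- 1) ^ (k - j) * real (k choose j) * (\<Prod>l<j. real c * (m - real l)))"
    unfolding charlier_def falling_poly_def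
    by (simp add: poly_sum poly_prod power_one_over inverse_eq_divide mult_ac)
  also have "\<dots> = (\<Sum>i\<le>k. (- 1) ^ (k - (k - i)) * real (k choose (k - i)) * (\<Prod>l<k - i. real c * (m - real l)))"
    by (rule sum.reindex_bij_witness[of _ "\<lambda>i. k - i" "\<lambda>i. k - i"]) auto
  also have "\<dots> = (\<Sum>i\<le>k. (- 1) ^ i * of_nat (k choose i) * (\<Prod>l<k - i. real c * (m - real l)))"
    by (rule sum.cong) (auto simp: binomial_symmetric[symmetric])
  finally show ?thesis .
qed

lemma kernel_space_subspace:
  assumes "cfun.subspace V"
  shows "cfun.subspace (kernel_space J K C A V)"
proof (rule cfun.subspaceI)
  note T = tuple_space_subspace[OF assms, of K C A]
  show "0 \<in> kernel_space J K C A V"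
    using cfun.subspace_0[OF T]
    by (simp add: kernel_space_def cfun_pair.linear_0[OF tuple_sum_linear])
  fix u c assume u: "u \<in> kernel_space J K C A V"
  show "(\<lambda>x. c * u x) \<in> kernel_space J K C A V"
    using u cfun.subspace_scale[OF T, of u c]
    by (simp add: kernel_space_def cfun_pair.linear_scale[OF tuple_sum_linear, of _ _ _ _ c u] zero_fun_def)
  fix v assume v: "v \<in> kernel_space J K C A V"
  show "u + v \<in> kernel_space J K C A V"
    using u v cfun.subspace_add[OF T, of u v]
    by (simp add: kernel_space_def cfun_pair.linear_add[OF tuple_sum_linear, of _ _ _ _ u v])
qed

text \<open>Images satisfy the conditions in J because summations commute; the converse inclusion is
  \<open>sum_at_surj\<close> applied with V as the set of allowed values.\<close>

lemma tuple_sum_image_kernel_space: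
  assumes V: "cfun.subspace V" and fin: "finite K" "finite C" "finite A" and "C \<noteq> {}"
    and q: "q \<in> K" and J: "J \<subseteq> K - {q}" and le: "card J + card K \<le> card A"
  shows "tuple_sum q K C A ` kernel_space J K C A V = kernel_space J (K - {q}) C A V"
proof (intro equalityI subsetI)
  fix \<Psi> assume "\<Psi> \<in> tuple_sum q K C A ` kernel_space J K C A V"
  then obtain \<Phi> where \<Phi>: "\<Phi> \<in> kernel_space J K C A V" and \<Psi>: "\<Psi> = tuple_sum q K C A \<Phi>"
    by (rule imageE)
  have \<Phi>T: "\<Phi> \<in> tuple_space K C A V" and \<Phi>0: "\<And>p. p \<in> J \<Longrightarrow> tuple_sum p K C A \<Phi> = 0"
    using \<Phi> unfolding kernel_space_def by auto
  have "(\<lambda>t. \<Psi> (y, t)) \<in> V" for y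
  proof (cases "y \<in> inj_tuples (K - {q}) C A")
    case True
    have "(\<Sum>z\<in>free_points (K - {q}) C A y. (\<lambda>t. \<Phi> (y(q := z), t))) \<in> V"
      by (rule cfun.subspace_sum[OF V tuple_spaceD(1)[OF \<Phi>T]])
    moreover have "(\<lambda>t. \<Psi> (y, t)) = (\<Sum>z\<in>free_points (K - {q}) C A y. (\<lambda>t. \<Phi> (y(q := z), t)))"
      using True by (simp add: \<Psi> tuple_sum_def sum_at_def fun_eq_iff sum_apply)
    ultimately show ?thesis
      by simp
  next
    case False
    then show ?thesis
      using cfun.subspace_0[OF V] by (simp add: \<Psi> tuple_sum_def flip: zero_fun_def)
  qed
  then have \<Psi>T: "\<Psi> \<in> tuple_space (K - {q}) C A V"
    unfolding tuple_space_def by (simp add: \<Psi> tuple_sum_def)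
  have "tuple_sum p (K - {q}) C A \<Psi> (y, t) = 0" if p: "p \<in> J" for p y t
  proof (cases "y \<in> inj_tuples (K - {q} - {p}) C A")
    case True
    have pK: "p \<in> K - {q}" "q \<in> K - {p}" "p \<in> K" "p \<noteq> q"
      using p J q by auto
    have "K - {q} - {p} = K - {p} - {q}"
      by blast
    then have y: "y \<in> inj_tuples (K - {p} - {q}) C A"
      using True by simp
    have "tuple_sum p (K - {q}) C A \<Psi> (y, t) = sum_at p (K - {q}) C A (\<lambda>x. \<Psi> (x, t)) y"
      using True by (simp add: tuple_sum_def)
    also have "\<dots> = sum_at p (K - {q}) C A (sum_at q K C A (\<lambda>x. \<Phi> (x, t))) y"
      by (rule sum_at_cong[OF pK(1) True]) (simp add: \<Psi> tuple_sum_def)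
    also have "\<dots> = sum_at q (K - {p}) C A (sum_at p K C A (\<lambda>x. \<Phi> (x, t))) y"
      by (rule sum_at_commute[OF fin(2,3) pK(3) q pK(4)])
    also have "\<dots> = sum_at q (K - {p}) C A (\<lambda>x. 0) y"
    proof (rule sum_at_cong[OF pK(2) y])
      fix x assume "x \<in> inj_tuples (K - {p}) C A"
      then show "sum_at p K C A (\<lambda>x. \<Phi> (x, t)) x = 0"
        using fun_cong[OF \<Phi>0[OF p], of "(x, t)"] by (simp add: tuple_sum_def)
    qed
    finally show ?thesis
      by (simp add: sum_at_def)
  qed (simp add: tuple_sum_def)
  then have "tuple_sum p (K - {q}) C A \<Psi> = 0" if "p \<in> J" for p
    using that by (simp add: fun_eq_iff)
  then show "\<Psi> \<in> kernel_space J (K - {q}) C A V"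
    using \<Psi>T unfolding kernel_space_def by blast
next
  fix \<Psi> assume \<Psi>: "\<Psi> \<in> kernel_space J (K - {q}) C A V"
  have \<Psi>T: "\<Psi> \<in> tuple_space (K - {q}) C A V" and \<Psi>0: "\<And>p. p \<in> J \<Longrightarrow> tuple_sum p (K - {q}) C A \<Psi> = 0"
    using \<Psi> unfolding kernel_space_def by auto
  have "\<exists>F. (\<forall>x. F x \<in> V) \<and>
    (\<forall>p\<in>J. \<forall>y\<in>inj_tuples (K - {p}) C A. sum_at p K C A F y = 0) \<and>
    (\<forall>y\<in>inj_tuples (K - {q}) C A. sum_at q K C A F y = (\<lambda>y t. \<Psi> (y, t)) y)"
  proof (rule sum_at_surj[OF fin(3) fin(2) assms(5) fin(1) cfun.subspace_0[OF V] cfun.subspace_diff[OF V] q J le])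
    show "(\<lambda>t. \<Psi> (y, t)) \<in> V" for y
      by (rule tuple_spaceD(1)[OF \<Psi>T])
    fix p y assume p: "p \<in> J" and y: "y \<in> inj_tuples (K - {q} - {p}) C A"
    have "sum_at p (K - {q}) C A (\<lambda>x. \<Psi> (x, t)) y = 0" for t
      using fun_cong[OF \<Psi>0[OF p], of "(y, t)"] y by (simp add: tuple_sum_def)
    then show "sum_at p (K - {q}) C A (\<lambda>y t. \<Psi> (y, t)) y = 0"
      by (simp add: fun_eq_iff sum_at_apply)
  qed
  then obtain F where FV: "\<And>x. F x \<in> V"
    and F0: "\<And>p y. p \<in> J \<Longrightarrow> y \<in> inj_tuples (K - {p}) C A \<Longrightarrow> sum_at p K C A F y = 0"
    and Fq: "\<And>y. y \<in> inj_tuples (K - {q}) C A \<Longrightarrow> sum_at q K C A F y = (\<lambda>t. \<Psi> (y, t))"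
    by blast
  define \<Phi> where "\<Phi> u = (if fst u \<in> inj_tuples K C A then F (fst u) (snd u) else 0)" for u
  have \<Phi>_sum: "sum_at p K C A (\<lambda>x. \<Phi> (x, t)) y = sum_at p K C A F y t"
    if "p \<in> K" "y \<in> inj_tuples (K - {p}) C A" for p y t
    unfolding sum_at_apply by (rule sum_at_cong[OF that]) (simp add: \<Phi>_def)
  have "(\<lambda>t. \<Phi> (x, t)) \<in> V" for x
    using FV[of x] cfun.subspace_0[OF V] by (cases "x \<in> inj_tuples K C A") (simp_all add: \<Phi>_def flip: zero_fun_def)
  then have "\<Phi> \<in> tuple_space K C A V"
    unfolding tuple_space_def by (simp add: \<Phi>_def)
  moreover have "tuple_sum p K C A \<Phi> = 0" if "p \<in> J" for p
  proof -
    have "p \<in> K"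
      using that J by blast
    then show ?thesis
      using \<Phi>_sum F0[OF that] by (simp add: fun_eq_iff tuple_sum_def)
  qed
  moreover have "tuple_sum q K C A \<Phi> = \<Psi>"
    using \<Phi>_sum[OF q] Fq tuple_spaceD(2)[OF \<Psi>T] by (simp add: fun_eq_iff tuple_sum_def)
  ultimately show "\<Psi> \<in> tuple_sum q K C A ` kernel_space J K C A V"
    unfolding kernel_space_def by blast
qed

text \<open>Induction on J: the exact sequence for a new q subtracts the trace for
  \<open>K - {q}\<close>. The \<open>Suc\<close> in the bound is the index q itself, as enlarging J
  by q uses surjectivity for the old J.\<close>

lemma trace_on_kernel_space:
  fixes \<gamma> :: "'c \<times> 'a \<Rightarrow> 'c \<times> 'a"
  assumes V: "fin_dim V" and fin: "finite C" "finite A" and "C \<noteq> {}"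
    and f: "clinear f" "\<And>v. v \<in> V \<Longrightarrow> f v \<in> V"
    and \<gamma>: "column_perm C A \<gamma>" "{z \<in> C \<times> A. \<gamma> z = z} = C \<times> A0" "A0 \<subseteq> A"
    and "finite K" "J \<subseteq> K" "card J + card K \<le> Suc (card A)"
  shows "trace_on (kernel_space J K C A V) (tuple_act K C A \<gamma> f)
    = of_real (\<Sum>i\<le>card J. (- 1) ^ i * of_nat (card J choose i)
        * (\<Prod>l<card K - i. real (card C) * (real (card A0) - real l))) * trace_on V f"
proof -
  have "finite J"
    using assms(10,11) by (rule rev_finite_subset)
  then show ?thesis
    using assms(10-12)
  proof (induction J arbitrary: K rule: finite_induct)
    case empty
    have "{x \<in> inj_tuples K C A. (\<lambda>i\<in>K. \<gamma> (x i)) = x} = inj_tuples K C A0"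
    proof (intro equalityI subsetI)
      fix x assume "x \<in> {x \<in> inj_tuples K C A. (\<lambda>i\<in>K. \<gamma> (x i)) = x}"
      then have x: "x \<in> inj_tuples K C A" "(\<lambda>i\<in>K. \<gamma> (x i)) = x"
        by auto
      have "x i \<in> C \<times> A0" if "i \<in> K" for i
        using fun_cong[OF x(2), of i] x(1) that \<gamma>(2) by (auto simp: inj_tuples_def PiE_iff)
      then show "x \<in> inj_tuples K C A0"
        using x(1) by (auto simp: inj_tuples_def PiE_iff)
    next
      fix x assume x: "x \<in> inj_tuples K C A0"
      then have "x i \<in> C \<times> A0" if "i \<in> K" for i
        using that by (auto simp: inj_tuples_def PiE_iff)
      then have "\<gamma> (x i) = x i" if "i \<in> K" for i
        using that \<gamma>(2) by blast
      then have "(\<lambda>i\<in>K. \<gamma> (x i)) = x"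
        using x by (auto simp: inj_tuples_def PiE_iff extensional_def fun_eq_iff)
      then show "x \<in> {x \<in> inj_tuples K C A. (\<lambda>i\<in>K. \<gamma> (x i)) = x}"
        using x inj_tuples_mono[OF \<gamma>(3)] by blast
    qed
    moreover have "kernel_space {} K C A V = tuple_space K C A V"
      unfolding kernel_space_def by simp
    moreover have "complex_of_nat (card (inj_tuples K C A0))
        = of_real (\<Prod>l<card K. real (card C) * (real (card A0) - real l))"
      unfolding card_inj_tuples[OF empty(1) fin(1) finite_subset[OF \<gamma>(3) fin(2)], symmetric] by simp
    ultimately show ?case
      using trace_on_tuple_space[OF V empty(1) fin f, of \<gamma>] by simp
  next
    case (insert q J)
    have q: "q \<in> K" and JK: "J \<subseteq> K - {q}"
      using insert by auto
    have card: "card (insert q J) = Suc (card J)" "card K = Suc (card (K - {q}))"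
      by (rule card_insert_disjoint[OF insert.hyps(1,2)], rule card.remove[OF insert.prems(1) q])
    have le: "card J + card K \<le> card A"
      using insert.prems(3) card(1) by linarith
    have le': "card J + card (K - {q}) \<le> Suc (card A)"
      using le card(2) by linarith
    have JK': "J \<subseteq> K"
      using JK by blast
    let ?U = "\<lambda>J K. kernel_space J K C A V"
    have sub: "cfun.subspace V"
      by (rule fin_dim_imp_subspace[OF V])
    have finU: "fin_dim (?U J K)" if "finite K" for J K
      by (rule fin_dim_subspace[OF fin_dim_tuple_space[OF V that fin] kernel_space_subspace[OF sub]])
        (auto simp: kernel_space_def)
    have ker: "{\<Phi> \<in> ?U J K. tuple_sum q K C A \<Phi> = 0} = ?U (insert q J) K"
      unfolding kernel_space_def by auto
    have finKq: "finite (K - {q})"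
      using insert.prems(1) by simp
    let ?D = "\<lambda>j k. \<Sum>i\<le>j. (- 1) ^ i * of_nat (j choose i)
        * (\<Prod>l<k - i. real (card C) * (real (card A0) - real l))"
    have "trace_on (?U J K) (tuple_act K C A \<gamma> f)
        = trace_on (?U (insert q J) K) (tuple_act K C A \<gamma> f)
          + trace_on (?U J (K - {q})) (tuple_act (K - {q}) C A \<gamma> f)"
      unfolding ker[symmetric]
    proof (rule trace_on_exact[where T = "tuple_sum q K C A" and V = "?U J K" and W = "?U J (K - {q})"
          and f = "tuple_act K C A \<gamma> f" and g = "tuple_act (K - {q}) C A \<gamma> f"])
      show "tuple_sum q K C A ` ?U J K = ?U J (K - {q})"
        by (rule tuple_sum_image_kernel_space[OF sub insert.prems(1) fin assms(4) q JK le])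
      show "tuple_act K C A \<gamma> f \<Phi> \<in> ?U J K" if "\<Phi> \<in> ?U J K" for \<Phi>
        by (rule kernel_space_act[of f C A \<gamma> V, OF f(1) \<gamma>(1) f(2) cfun.subspace_0[OF sub] JK' that])
      show "tuple_sum q K C A (tuple_act K C A \<gamma> f \<Phi>) = tuple_act (K - {q}) C A \<gamma> f (tuple_sum q K C A \<Phi>)" for \<Phi>
        by (rule tuple_sum_act[OF f(1) \<gamma>(1) q])
    qed (rule finU[OF insert.prems(1)] finU[OF finKq] tuple_sum_linear tuple_act_linear[OF f(1)])+
    then have 1: "trace_on (?U (insert q J) K) (tuple_act K C A \<gamma> f)
        = trace_on (?U J K) (tuple_act K C A \<gamma> f)
          - trace_on (?U J (K - {q})) (tuple_act (K - {q}) C A \<gamma> f)"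
      by (simp only: eq_diff_eq)
    have 2: "?D (Suc (card J)) (card K) = ?D (card J) (card K) - ?D (card J) (card (K - {q}))"
      using alternating_binomial_sum_Suc[where ?'b = real, of "card J"
          "\<lambda>i. \<Prod>l<card K - i. real (card C) * (real (card A0) - real l)"]
      unfolding card(2) diff_Suc_Suc .
    show ?case
      unfolding card(1) 1 2 of_real_diff left_diff_distrib insert.IH[OF insert.prems(1) JK' le_SucI[OF le]]
        insert.IH[OF finKq JK le'] ..
  qed
qed

lemma trace_on_kernel_space_charlier:
  fixes \<gamma> :: "'c \<times> 'a \<Rightarrow> 'c \<times> 'a"
  assumes "fin_dim V" "finite C" "finite A" "C \<noteq> {}" "clinear f" "\<And>v. v \<in> V \<Longrightarrow> f v \<in> V"
    and "column_perm C A \<gamma>" "{z \<in> C \<times> A. \<gamma> z = z} = C \<times> A0" "A0 \<subseteq> A"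
    and "finite K" "2 * card K \<le> card A"
  shows "trace_on (kernel_space K K C A V) (tuple_act K C A \<gamma> f)
    = of_real (poly (charlier (1 / real (card C)) (card K)) (real (card A0))) * trace_on V f"
proof -
  have "card C > 0"
    using assms(2,4) by (simp add: card_gt_0_iff)
  then show ?thesis
    using trace_on_kernel_space[OF assms(1-10) subset_refl] assms(11) poly_charlier by simp
qed

section \<open>A representation affording the Charlier class function\<close>

text \<open>The operators are written as matrices in a basis of U; \<open>U \<noteq> {0}\<close>
  supplies the positive degree that \<open>is_character\<close> demands.\<close>

lemma is_character_trace_on:
  fixes R :: "'g \<Rightarrow> ('t \<Rightarrow> complex) \<Rightarrow> 't \<Rightarrow> complex"
  assumes U: "fin_dim U" "U \<noteq> {0}"
    and R: "\<And>x. x \<in> carrier G \<Longrightarrow> clinear (R x)" "\<And>x u. x \<in> carrier G \<Longrightarrow> u \<in> U \<Longrightarrow> R x u \<in> U"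
    and one: "\<one>\<^bsub>G\<^esub> \<in> carrier G" "\<And>u. u \<in> U \<Longrightarrow> R \<one>\<^bsub>G\<^esub> u = u"
    and mult: "\<And>x y u. x \<in> carrier G \<Longrightarrow> y \<in> carrier G \<Longrightarrow> u \<in> U \<Longrightarrow> R (x \<otimes>\<^bsub>G\<^esub> y) u = R x (R y u)"
    and \<chi>: "\<And>x. x \<in> carrier G \<Longrightarrow> \<chi> x = trace_on U (R x)"
  shows "is_character G \<chi>"
proof -
  obtain B where B: "finite B" "cfun.independent B" "cfun.span B = U"
    using U(1) unfolding fin_dim_def by blast
  define d where "d = card B"
  obtain b where b: "bij_betw b {..<d} B"
    using ex_bij_betw_nat_finite[OF B(1)] unfolding d_def lessThan_atLeast0 by blast
  have "B \<noteq> {}"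
    using U(2) B(3) by auto
  then have "d > 0"
    using B(1) by (simp add: d_def card_gt_0_iff)
  have bB: "b i \<in> B" if "i < d" for i
    using b that by (auto simp: bij_betw_def)
  have bU: "b i \<in> U" if "i < d" for i
    using cfun.span_base[OF bB[OF that]] B(3) by simp
  let ?r = "cfun.representation B"
  define \<rho> where "\<rho> x = mat d d (\<lambda>(i, j). ?r (R x (b j)) (b i))" for x
  have "\<rho> (x \<otimes>\<^bsub>G\<^esub> y) = \<rho> x * \<rho> y" if x: "x \<in> carrier G" and y: "y \<in> carrier G" for x y
  proof (rule eq_matI)
    fix i j assume "i < dim_row (\<rho> x * \<rho> y)" "j < dim_col (\<rho> x * \<rho> y)"
    then have ij: "i < d" "j < d"
      by (simp_all add: \<rho>_def)
    have yb: "R y (b j) \<in> U"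
      by (rule R(2)[OF y bU[OF ij(2)]])
    have "R x (R y (b j)) = R x (\<Sum>c\<in>B. (\<lambda>t. ?r (R y (b j)) c * c t))"
      using cfun.sum_representation_eq[OF B(2) _ B(1) subset_refl, of "R y (b j)"] yb B(3) by simp
    also have "\<dots> = (\<Sum>c\<in>B. (\<lambda>t. ?r (R y (b j)) c * R x c t))"
      by (simp only: cfun_pair.linear_sum[OF R(1)[OF x]] cfun_pair.linear_scale[OF R(1)[OF x]])
    finally have "?r (R x (R y (b j))) (b i) = ?r (\<Sum>c\<in>B. (\<lambda>t. ?r (R y (b j)) c * R x c t)) (b i)"
      by simp
    also have "\<dots> = (\<Sum>c\<in>B. ?r (R y (b j)) c * ?r (R x c) (b i))"
    proof (rule functional_on_sum[OF functional_on_representation[OF B(2)] cfun.subspace_span])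
      show "R x c \<in> cfun.span B" if "c \<in> B" for c
        using R(2)[OF x, of c] cfun.span_base[OF that] B(3) by simp
    qed
    also have "\<dots> = (\<Sum>k<d. ?r (R y (b j)) (b k) * ?r (R x (b k)) (b i))"
      by (rule sum.reindex_bij_betw[OF b, symmetric])
    finally show "\<rho> (x \<otimes>\<^bsub>G\<^esub> y) $$ (i, j) = (\<rho> x * \<rho> y) $$ (i, j)"
      using ij mult[OF x y bU[OF ij(2)]]
      by (simp add: \<rho>_def scalar_prod_def mult.commute lessThan_atLeast0)
  qed (simp_all add: \<rho>_def)
  moreover have "\<rho> \<one>\<^bsub>G\<^esub> = 1\<^sub>m d"
  proof (rule eq_matI)
    fix i j assume "i < dim_row (1\<^sub>m d :: complex mat)" "j < dim_col (1\<^sub>m d :: complex mat)"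
    then have ij: "i < d" "j < d"
      by simp_all
    have "b i = b j \<longleftrightarrow> i = j"
      using b ij by (auto simp: bij_betw_def inj_on_def)
    then show "\<rho> \<one>\<^bsub>G\<^esub> $$ (i, j) = 1\<^sub>m d $$ (i, j)"
      using ij one(2)[OF bU[OF ij(2)]] by (simp add: \<rho>_def cfun.representation_basis[OF B(2) bB])
  qed (simp_all add: \<rho>_def)
  moreover have "\<chi> x = (\<Sum>i<d. \<rho> x $$ (i, i))" if x: "x \<in> carrier G" for x
  proof -
    have "trace_on U (R x) = (\<Sum>c\<in>B. ?r (R x c) c)"
      by (rule trace_on_basis[OF B R(1)[OF x]]) (rule R(2)[OF x])
    also have "\<dots> = (\<Sum>i<d. ?r (R x (b i)) (b i))"
      by (rule sum.reindex_bij_betw[OF b, symmetric])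
    finally show ?thesis
      by (simp add: \<chi>[OF x] \<rho>_def)
  qed
  moreover have "\<rho> x \<in> carrier_mat d d" for x
    by (simp add: \<rho>_def)
  ultimately show ?thesis
    unfolding is_character_def using \<open>d > 0\<close> by (intro exI[of _ d] conjI exI[of _ \<rho>]) auto
qed

text \<open>Pulling back reverses the order on points but not on values: \<epsilon> is \<delta>
  after \<gamma>, while h is f after g.\<close>

lemma tuple_act_comp:
  assumes "column_perm C A \<gamma>"
    and "\<And>v. h v = f (g v)" "\<And>z. z \<in> C \<times> A \<Longrightarrow> \<epsilon> z = \<delta> (\<gamma> z)"
  shows "tuple_act K C A \<epsilon> h \<Phi> = tuple_act K C A \<gamma> f (tuple_act K C A \<delta> g \<Phi>)"
proof (rule ext, unfold split_paired_all)
  fix x t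
  show "tuple_act K C A \<epsilon> h \<Phi> (x, t) = tuple_act K C A \<gamma> f (tuple_act K C A \<delta> g \<Phi>) (x, t)"
  proof (cases "x \<in> inj_tuples K C A")
    case True
    have "x i \<in> C \<times> A" if "i \<in> K" for i
      using True that by (auto simp: inj_tuples_def PiE_iff)
    then have "(\<lambda>i\<in>K. \<epsilon> (x i)) = (\<lambda>i\<in>K. \<delta> ((\<lambda>i\<in>K. \<gamma> (x i)) i))"
      using assms(3) by (auto simp: fun_eq_iff)
    then show ?thesis
      using True column_perm_inj_tuples[OF assms(1) True] by (simp add: tuple_act_def assms(2))
  qed (simp add: tuple_act_def)
qed

lemma tuple_act_id:
  assumes "\<And>z. z \<in> C \<times> A \<Longrightarrow> \<gamma> z = z" "\<And>v. v \<in> V \<Longrightarrow> f v = v" "\<Phi> \<in> tuple_space K C A V"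
  shows "tuple_act K C A \<gamma> f \<Phi> = \<Phi>"
proof (rule ext, unfold split_paired_all)
  fix x t
  show "tuple_act K C A \<gamma> f \<Phi> (x, t) = \<Phi> (x, t)"
  proof (cases "x \<in> inj_tuples K C A")
    case True
    then have "(\<lambda>i\<in>K. \<gamma> (x i)) = x"
      using assms(1) by (auto simp: inj_tuples_def PiE_iff extensional_def fun_eq_iff)
    then show ?thesis
      using True assms(2)[OF tuple_spaceD(1)[OF assms(3)]] by (simp add: tuple_act_def)
  next
    case False
    then show ?thesis
      using tuple_spaceD(2)[OF assms(3)] by (simp add: tuple_act_def)
  qed
qed

section \<open>The wreath product and its action on colored points\<close>

lemma wreath_carrier_iff:
  "(g, \<pi>) \<in> carrier (wreath r n) \<longleftrightarrow> g \<in> {1..n} \<rightarrow>\<^sub>E carrier (cyc r) \<and> \<pi> permutes {1..n}"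
  by (simp add: wreath_def sym_group_def)

lemma wreath_mult:
  "(f, \<pi>) \<otimes>\<^bsub>wreath r n\<^esub> (g, \<sigma>) = (\<lambda>i\<in>{1..n}. (f i + g (inv' \<pi> i)) mod int r, \<pi> \<circ> \<sigma>)"
  by (auto simp: wreath_def sym_group_def fun_eq_iff)

lemma wreath_one: "\<one>\<^bsub>wreath r n\<^esub> = (\<lambda>i\<in>{1..n}. 0, id)"
  by (simp add: wreath_def sym_group_def)

lemma cyc_carrier: "r > 0 \<Longrightarrow> carrier (cyc r) = {0..<int r}"
  by (simp add: carrier_integer_mod_group)

lemma group_wreath:
  assumes "r > 0"
  shows "group (wreath r n)"
proof (rule groupI)
  note C = cyc_carrier[OF assms]
  show "\<one>\<^bsub>wreath r n\<^esub> \<in> carrier (wreath r n)"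
    using assms by (simp add: wreath_one wreath_carrier_iff C permutes_id)
  fix x y assume x: "x \<in> carrier (wreath r n)" and y: "y \<in> carrier (wreath r n)"
  obtain f \<pi> where x_eq: "x = (f, \<pi>)"
    by (cases x)
  obtain g \<sigma> where y_eq: "y = (g, \<sigma>)"
    by (cases y)
  have f: "f \<in> {1..n} \<rightarrow>\<^sub>E {0..<int r}" "\<pi> permutes {1..n}"
    using x by (simp_all add: x_eq wreath_carrier_iff C)
  have g: "g \<in> {1..n} \<rightarrow>\<^sub>E {0..<int r}" "\<sigma> permutes {1..n}"
    using y by (simp_all add: y_eq wreath_carrier_iff C)
  show "x \<otimes>\<^bsub>wreath r n\<^esub> y \<in> carrier (wreath r n)"
    using assms f g by (simp add: x_eq y_eq wreath_mult wreath_carrier_iff C permutes_compose)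
  show "\<one>\<^bsub>wreath r n\<^esub> \<otimes>\<^bsub>wreath r n\<^esub> x = x"
    using f by (auto simp: x_eq wreath_one wreath_mult fun_eq_iff PiE_iff extensional_def inv_id)
  show "\<exists>y\<in>carrier (wreath r n). y \<otimes>\<^bsub>wreath r n\<^esub> x = \<one>\<^bsub>wreath r n\<^esub>"
  proof (rule bexI)
    \<comment> \<open>In the product with first permutation \<open>inv' \<pi>\<close> the entry of f
      used at position i is \<open>f (\<pi> i)\<close>, which this witness cancels.\<close>
    show "(\<lambda>i\<in>{1..n}. - f (\<pi> i) mod int r, inv' \<pi>) \<otimes>\<^bsub>wreath r n\<^esub> x = \<one>\<^bsub>wreath r n\<^esub>"
      using f(2) by (auto simp: x_eq wreath_mult wreath_one fun_eq_iff inv_inv_eq[OF permutes_bij]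
          mod_add_left_eq permutes_inverses)
    show "(\<lambda>i\<in>{1..n}. - f (\<pi> i) mod int r, inv' \<pi>) \<in> carrier (wreath r n)"
      using assms f(2) by (simp add: wreath_carrier_iff C permutes_inv)
  qed
  fix z assume z: "z \<in> carrier (wreath r n)"
  obtain h \<tau> where z_eq: "z = (h, \<tau>)"
    by (cases z)
  have inv_comp: "inv' (\<pi> \<circ> \<sigma>) i = inv' \<sigma> (inv' \<pi> i)" for i
    using o_inv_distrib[OF permutes_bij[OF f(2)] permutes_bij[OF g(2)]] by simp
  have "inv' \<pi> i \<in> {1..n}" if "i \<in> {1..n}" for i
    using permutes_in_image[OF permutes_inv[OF f(2)]] that by blast
  then have "(\<lambda>i\<in>{1..n}. ((\<lambda>i\<in>{1..n}. (f i + g (inv' \<pi> i)) mod int r) i + h (inv' (\<pi> \<circ> \<sigma>) i)) mod int r)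
      = (\<lambda>i\<in>{1..n}. (f i + (\<lambda>i\<in>{1..n}. (g i + h (inv' \<sigma> i)) mod int r) (inv' \<pi> i)) mod int r)"
    by (intro restrict_ext) (simp only: restrict_apply' inv_comp mod_simps add.assoc)
  then show "x \<otimes>\<^bsub>wreath r n\<^esub> y \<otimes>\<^bsub>wreath r n\<^esub> z = x \<otimes>\<^bsub>wreath r n\<^esub> (y \<otimes>\<^bsub>wreath r n\<^esub> z)"
    by (simp only: x_eq y_eq z_eq wreath_mult comp_assoc)
qed

lemma wreath_act_closed:
  assumes "r > 0" "w \<in> carrier (wreath r n)" "z \<in> carrier (cyc r) \<times> {1..n}"
  shows "wreath_act r w z \<in> carrier (cyc r) \<times> {1..n}"
proof -
  obtain g \<pi> where w: "w = (g, \<pi>)"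
    by (cases w)
  obtain c i where z: "z = (c, i)"
    by (cases z)
  have "\<pi> i \<in> {1..n}"
    using assms permutes_in_image[of \<pi> "{1..n}" i] by (simp add: w z wreath_carrier_iff)
  then show ?thesis
    using assms(1) by (simp add: w z cyc_carrier)
qed

text \<open>At the arrival column \<open>\<pi> (\<sigma> i)\<close> the twisted entry
  \<open>g (inv' \<pi> j)\<close> is \<open>g (\<sigma> i)\<close>, exactly the shift already made
  by w.\<close>

lemma wreath_act_mult:
  assumes "v \<in> carrier (wreath r n)" "w \<in> carrier (wreath r n)" "z \<in> carrier (cyc r) \<times> {1..n}"
  shows "wreath_act r (v \<otimes>\<^bsub>wreath r n\<^esub> w) z = wreath_act r v (wreath_act r w z)"
proof -
  obtain f \<pi> where v: "v = (f, \<pi>)"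
    by (cases v)
  obtain g \<sigma> where w: "w = (g, \<sigma>)"
    by (cases w)
  obtain c i where z: "z = (c, i)"
    by (cases z)
  have p: "\<pi> permutes {1..n}" "\<sigma> permutes {1..n}"
    using assms by (simp_all add: v w wreath_carrier_iff)
  have "\<pi> (\<sigma> i) \<in> {1..n}"
    using assms(3) permutes_in_image[OF p(1)] permutes_in_image[OF p(2)] by (simp add: z)
  then show ?thesis
    using permutes_inverses(2)[OF p(1)]
    by (simp add: v w z wreath_mult mod_simps add_ac)
qed

lemma wreath_act_one:
  assumes "r > 0" "z \<in> carrier (cyc r) \<times> {1..n}"
  shows "wreath_act r \<one>\<^bsub>wreath r n\<^esub> z = z"
  using assms by (cases z) (simp add: wreath_one cyc_carrier)

lemma wreath_act_inv:
  assumes "r > 0" "w \<in> carrier (wreath r n)" "z \<in> carrier (cyc r) \<times> {1..n}"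
  shows "wreath_act r (inv\<^bsub>wreath r n\<^esub> w) (wreath_act r w z) = z"
    "wreath_act r w (wreath_act r (inv\<^bsub>wreath r n\<^esub> w) z) = z"
proof -
  interpret group "wreath r n"
    by (rule group_wreath[OF assms(1)])
  show "wreath_act r (inv\<^bsub>wreath r n\<^esub> w) (wreath_act r w z) = z"
    "wreath_act r w (wreath_act r (inv\<^bsub>wreath r n\<^esub> w) z) = z"
    using wreath_act_mult[OF inv_closed[OF assms(2)] assms(2,3)] wreath_act_mult[OF assms(2) inv_closed[OF assms(2)] assms(3)]
      wreath_act_one[OF assms(1,3)] assms(2) by simp_all
qed

lemma column_perm_wreath_act:
  assumes "r > 0" "w \<in> carrier (wreath r n)"
  shows "column_perm (carrier (cyc r)) {1..n} (wreath_act r w)"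
proof -
  interpret group "wreath r n"
    by (rule group_wreath[OF assms(1)])
  have "bij_betw (wreath_act r w) (carrier (cyc r) \<times> {1..n}) (carrier (cyc r) \<times> {1..n})"
    by (rule bij_betw_byWitness[where f' = "wreath_act r (inv\<^bsub>wreath r n\<^esub> w)"])
      (use wreath_act_inv[OF assms] wreath_act_closed[OF assms] wreath_act_closed[OF assms(1) inv_closed[OF assms(2)]] in blast)+
  moreover obtain g \<pi> where w: "w = (g, \<pi>)"
    by (cases w)
  then have "\<pi> i = \<pi> j \<longleftrightarrow> i = j" for i j
    using assms(2) permutes_inj[of \<pi> "{1..n}"] by (auto simp: w wreath_carrier_iff dest: injD)
  ultimately show ?thesis
    unfolding column_perm_def by (auto simp: w)
qed

definition fixed_columns :: "nat \<Rightarrow> (nat \<Rightarrow> int) \<times> (nat \<Rightarrow> nat) \<Rightarrow> nat set"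
  where "fixed_columns n w = {i \<in> {1..n}. snd w i = i \<and> fst w i = 0}"

text \<open>A translation of a cyclic group that has a fixed point is trivial, so a column is fixed
  pointwise or contains no fixed point. Hence \<theta> counts the fixed columns.\<close>

lemma wreath_act_fixed_points:
  assumes "r > 0" "w \<in> carrier (wreath r n)"
  shows "{z \<in> carrier (cyc r) \<times> {1..n}. wreath_act r w z = z} = carrier (cyc r) \<times> fixed_columns n w"
proof -
  obtain g \<pi> where w: "w = (g, \<pi>)"
    by (cases w)
  have "(c + g i) mod int r = c \<longleftrightarrow> g i = 0" if "c \<in> {0..<int r}" "i \<in> {1..n}" for c i
  proof -
    have "g i \<in> {0..<int r}"
      using assms that by (auto simp: w wreath_carrier_iff cyc_carrier PiE_iff)
    moreover have "(c + g i) mod int r = c \<longleftrightarrow> (c + g i) mod int r = c mod int r"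
      using that by simp
    moreover have "\<dots> \<longleftrightarrow> int r dvd g i"
      by (simp add: mod_eq_dvd_iff)
    ultimately show ?thesis
      using zdvd_imp_le[of "int r" "g i"] by force
  qed
  then show ?thesis
    using assms(1) by (auto simp: w fixed_columns_def cyc_carrier)
qed

lemma fix_theta_eq:
  assumes "r > 0" "w \<in> carrier (wreath r n)"
  shows "fix_theta r n w = real (card (fixed_columns n w))"
  unfolding fix_theta_def wreath_act_fixed_points[OF assms]
  using assms(1) by (simp add: card_cartesian_product cyc_carrier)

text \<open>The witness is a product of differences of two point masses, position i using the
  columns 2i + 1 and 2i + 2. These k pairs are disjoint and fit into n columns since
  \<open>2 * k \<le> n\<close>. It provides the positive degree of the character.\<close>

lemma kernel_space_nontrivial:
  assumes "c \<in> C" "finite C" "2 * k \<le> n"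
  shows "kernel_space {..<k} {..<k} C {1..n} (UNIV :: (unit \<Rightarrow> complex) set) \<noteq> {0}"
proof
  let ?K = "{..<k}" and ?A = "{1..n}"
  assume triv: "kernel_space ?K ?K C ?A (UNIV :: (unit \<Rightarrow> complex) set) = {0}"
  define h :: "nat \<Rightarrow> _ \<Rightarrow> complex"
    where "h i z = (if z = (c, 2 * i + 1) then 1 else if z = (c, 2 * i + 2) then - 1 else 0)" for i z
  define \<Phi> where "\<Phi> u = (if fst u \<in> inj_tuples ?K C ?A then \<Prod>i<k. h i (fst u i) else 0)"
    for u :: "(nat \<Rightarrow> _ \<times> nat) \<times> unit"
  have "tuple_sum p ?K C ?A \<Phi> (y, t) = 0" if p: "p \<in> ?K" for p y t
  proof (cases "y \<in> inj_tuples (?K - {p}) C ?A")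
    case True
    let ?F = "free_points (?K - {p}) C ?A y"
    have F: "finite ?F"
      using assms(2) by (simp add: finite_free_points)
    have "tuple_sum p ?K C ?A \<Phi> (y, t) = (\<Sum>z\<in>?F. \<Prod>i<k. h i ((y(p := z)) i))"
      using True inj_tuples_upd[OF p True] by (simp add: tuple_sum_def sum_at_def \<Phi>_def)
    also have "\<dots> = (\<Sum>z\<in>?F. h p z * (\<Prod>i\<in>?K - {p}. h i (y i)))"
    proof (rule sum.cong[OF refl])
      fix z
      have "(\<Prod>i<k. h i ((y(p := z)) i)) = h p z * (\<Prod>i\<in>?K - {p}. h i ((y(p := z)) i))"
        by (subst prod.remove[OF _ p]) simp_all
      also have "(\<Prod>i\<in>?K - {p}. h i ((y(p := z)) i)) = (\<Prod>i\<in>?K - {p}. h i (y i))"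
        by (rule prod.cong) auto
      finally show "(\<Prod>i<k. h i ((y(p := z)) i)) = h p z * (\<Prod>i\<in>?K - {p}. h i (y i))" .
    qed
    also have "\<dots> = (\<Sum>z\<in>?F. h p z) * (\<Prod>i\<in>?K - {p}. h i (y i))"
      by (rule sum_distrib_right[symmetric])
    also have "\<dots> = 0"
    \<comment> \<open>If all other factors are nonzero, the other entries lie in their own pairs;
      then both points of pair p are free and the values 1 and -1 cancel.\<close>
    proof (cases "\<forall>i\<in>?K - {p}. h i (y i) \<noteq> 0")
      case True
      have "snd (y i) \<noteq> 2 * p + 1 \<and> snd (y i) \<noteq> 2 * p + 2" if i: "i \<in> ?K - {p}" for i
      proof -
        have "snd (y i) = 2 * i + 1 \<or> snd (y i) = 2 * i + 2"
          using True i unfolding h_def by (metis snd_conv)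
        moreover have "i \<noteq> p"
          using i by blast
        ultimately show ?thesis
          by presburger
      qed
      moreover have "2 * p + 2 \<le> n"
        using p assms(3) by simp
      ultimately have "{(c, 2 * p + 1), (c, 2 * p + 2)} \<subseteq> ?F"
        using assms(1) unfolding free_points_def by force
      then have "(\<Sum>z\<in>?F. h p z) = (\<Sum>z\<in>{(c, 2 * p + 1), (c, 2 * p + 2)}. h p z)"
        by (intro sum.mono_neutral_right[OF F]) (auto simp: h_def)
      also have "\<dots> = 0"
        by (simp add: h_def)
      finally show ?thesis
        by simp
    next
      case False
      then have "(\<Prod>i\<in>?K - {p}. h i (y i)) = 0"
        by (intro prod_zero) auto
      then show ?thesis
        by simp
    qed
    finally show ?thesis .
  next
    case False
    then show ?thesis
      by (simp add: tuple_sum_def)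
  qed
  then have "tuple_sum p ?K C ?A \<Phi> = 0" if "p \<in> ?K" for p
    using that by (simp add: fun_eq_iff)
  moreover have "\<Phi> \<in> tuple_space ?K C ?A UNIV"
    unfolding tuple_space_def by (simp add: \<Phi>_def)
  ultimately have "\<Phi> \<in> kernel_space ?K ?K C ?A UNIV"
    unfolding kernel_space_def by blast
  then have "\<Phi> = 0"
    using triv by simp
  moreover have "(\<lambda>i\<in>?K. (c, 2 * i + 1)) \<in> inj_tuples ?K C ?A"
    using assms by (auto simp: inj_tuples_def inj_on_def)
  then have "\<Phi> (\<lambda>i\<in>?K. (c, 2 * i + 1), ()) = 1"
    by (simp add: \<Phi>_def h_def)
  ultimately show False
    by simp
qed

text \<open>Functions on a one-point type serve as the trivial one-dimensional module, for which the
  trace on the kernel is the Charlier value itself.\<close>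

lemma fin_dim_unit_functions: "fin_dim (UNIV :: (unit \<Rightarrow> complex) set)"
proof -
  have "v \<in> cfun.span {\<lambda>_. 1}" for v :: "unit \<Rightarrow> complex"
  proof -
    have "v = (\<lambda>x. v () * 1)"
      by (simp add: fun_eq_iff)
    moreover have "(\<lambda>x. v () * 1) \<in> cfun.span {\<lambda>_::unit. 1}"
      by (rule cfun.span_scale[OF cfun.span_base]) simp
    ultimately show ?thesis
      by (simp only:)
  qed
  then have "cfun.span {\<lambda>_::unit. 1 :: complex} = UNIV"
    by blast
  then show ?thesis
    using fin_dim_span[of "{\<lambda>_::unit. 1 :: complex}"] by simp
qed

lemma trace_on_unit_functions: "trace_on (UNIV :: (unit \<Rightarrow> complex) set) (\<lambda>v. v) = 1"
proof -
  have id: "clinear (\<lambda>v :: unit \<Rightarrow> complex. v)"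
    by (rule clinearI) auto
  have "trace_on (UNIV :: (unit \<Rightarrow> complex) set) (\<lambda>v. v) = (\<Sum>i\<in>{()}. (\<lambda>v::unit \<Rightarrow> complex. v ()) (\<lambda>_. 1))"
    by (rule trace_on_frame[OF fin_dim_unit_functions id, where e = "\<lambda>_ _. 1" and \<phi> = "\<lambda>_ v. v ()"])
      (auto simp: functional_on_def fun_eq_iff)
  then show ?thesis
    by simp
qed

lemma is_character_charlier_theta:
  assumes r: "r > 0" and k: "2 * k \<le> n"
  shows "is_character (wreath r n) (charlier_theta r n k)"
proof -
  let ?C = "carrier (cyc r)" and ?A = "{1..n}" and ?K = "{..<k}"
  let ?V = "UNIV :: (unit \<Rightarrow> complex) set"
  let ?U = "kernel_space ?K ?K ?C ?A ?V"
  interpret group "wreath r n"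
    by (rule group_wreath[OF r])
  \<comment> \<open>The inverse turns the pullback into a left action.\<close>
  define R where "R w = tuple_act ?K ?C ?A (wreath_act r (inv\<^bsub>wreath r n\<^esub> w)) (\<lambda>v :: unit \<Rightarrow> complex. v)" for w
  have C: "finite ?C" "0 \<in> ?C" "card ?C = r"
    using r by (simp_all add: cyc_carrier)
  have C_ne: "?C \<noteq> {}"
    using C(2) by blast
  have id: "clinear (\<lambda>v :: unit \<Rightarrow> complex. v)"
    by (rule clinearI) auto
  have lin: "clinear (R w)" for w
    unfolding R_def by (rule tuple_act_linear[OF id])
  have perm: "column_perm ?C ?A (wreath_act r (inv\<^bsub>wreath r n\<^esub> w))" if "w \<in> carrier (wreath r n)" for w
    by (rule column_perm_wreath_act[OF r inv_closed[OF that]])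
  have U: "fin_dim ?U"
    by (rule fin_dim_subspace[OF fin_dim_tuple_space[OF fin_dim_unit_functions finite_lessThan C(1) finite_atLeastAtMost]
          kernel_space_subspace[OF cfun.subspace_UNIV]])
      (auto simp: kernel_space_def)
  show ?thesis
  proof (rule is_character_trace_on[where R = R, OF U kernel_space_nontrivial[OF C(2,1) k] lin])
    show "R x u \<in> ?U" if "x \<in> carrier (wreath r n)" "u \<in> ?U" for x u
      unfolding R_def
      by (rule kernel_space_act[OF id perm[OF that(1)] UNIV_I UNIV_I subset_refl that(2)])
    show "R \<one>\<^bsub>wreath r n\<^esub> u = u" if "u \<in> ?U" for u
      unfolding R_def inv_one
    proof (rule tuple_act_id)
      show "u \<in> tuple_space ?K ?C ?A UNIV"
        using that by (simp add: kernel_space_def)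
    qed (auto simp: wreath_act_one[OF r] simp del: wreath_act.simps)
    show "R (x \<otimes>\<^bsub>wreath r n\<^esub> y) u = R x (R y u)"
      if "x \<in> carrier (wreath r n)" "y \<in> carrier (wreath r n)" for x y u
      unfolding R_def inv_mult_group[OF that]
      by (rule tuple_act_comp[OF perm[OF that(1)] refl])
        (rule wreath_act_mult[OF inv_closed[OF that(2)] inv_closed[OF that(1)]])
    show "charlier_theta r n k x = trace_on ?U (R x)" if x: "x \<in> carrier (wreath r n)" for x
    proof -
      \<comment> \<open>An element and its inverse fix the same points, so the inverse in R does not
        change the count.\<close>
      have "{z \<in> ?C \<times> ?A. wreath_act r (inv\<^bsub>wreath r n\<^esub> x) z = z} = {z \<in> ?C \<times> ?A. wreath_act r x z = z}"
        using wreath_act_inv[OF r x] by (metis (lifting))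
      then have fp: "{z \<in> ?C \<times> ?A. wreath_act r (inv\<^bsub>wreath r n\<^esub> x) z = z} = ?C \<times> fixed_columns n x"
        unfolding wreath_act_fixed_points[OF r x] .
      have "trace_on ?U (R x) = of_real (poly (charlier (1 / real (card ?C)) (card ?K)) (real (card (fixed_columns n x))))
          * trace_on ?V (\<lambda>v. v)"
        unfolding R_def
        by (rule trace_on_kernel_space_charlier[OF fin_dim_unit_functions C(1) finite_atLeastAtMost C_ne id UNIV_I perm[OF x] fp])
          (use k in \<open>auto simp: fixed_columns_def\<close>)
      then show ?thesis
        unfolding charlier_theta_def fix_theta_eq[OF r x] trace_on_unit_functions by (simp add: C(3))
    qed
  qed simp
qed

section \<open>Specht modules\<close>

lemma young_diagram_eq_Sigma: "young_diagram \<mu> = (SIGMA i:{..<length \<mu>}. {..<\<mu> ! i})"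
  unfolding young_diagram_def by auto

lemma finite_young_diagram: "finite (young_diagram \<mu>)"
  unfolding young_diagram_eq_Sigma by simp

lemma card_young_diagram: "card (young_diagram \<mu>) = sum_list \<mu>"
  unfolding young_diagram_eq_Sigma by (simp add: sum_list_sum_nth lessThan_atLeast0)

lemma card_first_row: "card {c \<in> young_diagram \<mu>. fst c = 0} = largest_part \<mu>"
proof -
  have "{c \<in> young_diagram \<mu>. fst c = 0} = {0} \<times> {..<largest_part \<mu>}"
    unfolding young_diagram_def largest_part_def by (auto simp: hd_conv_nth)
  then show ?thesis
    by (simp add: card_cartesian_product)
qed

lemma column_less_largest_part:
  assumes "is_partition \<mu>" "c \<in> young_diagram \<mu>"
  shows "snd c < largest_part \<mu>"
proof -
  obtain i j where c: "c = (i, j)" "i < length \<mu>" "j < \<mu> ! i"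
    using assms(2) unfolding young_diagram_def by blast
  have "\<mu> ! i \<le> \<mu> ! 0"
    using assms(1) c(2) unfolding is_partition_def by (cases "i = 0") (auto simp: sorted_wrt_iff_nth_less)
  then show ?thesis
    using c by (auto simp: largest_part_def hd_conv_nth)
qed

lemma ex_tableau:
  assumes "finite A" "sum_list \<mu> = card A"
  obtains t where "t \<in> tableaux A \<mu>"
proof -
  obtain h where "bij_betw h A (young_diagram \<mu>)"
    using finite_same_card_bij[OF assms(1) finite_young_diagram] assms(2) card_young_diagram by metis
  then have "restrict h A \<in> tableaux A \<mu>"
    unfolding tableaux_def by simp
  then show ?thesis
    by (rule that)
qed

lemma card_tableau_first_row:
  assumes "t \<in> tableaux A \<mu>"
  shows "card {a \<in> A. fst (t a) = 0} = largest_part \<mu>"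
proof -
  have t: "inj_on t A" "t ` A = young_diagram \<mu>"
    using assms unfolding tableaux_def bij_betw_def by auto
  have "t ` {a \<in> A. fst (t a) = 0} = {c \<in> young_diagram \<mu>. fst c = 0}"
    unfolding t(2)[symmetric] by auto
  moreover have "inj_on t {a \<in> A. fst (t a) = 0}"
    by (rule inj_on_subset[OF t(1)]) blast
  ultimately show ?thesis
    using card_image[of t "{a \<in> A. fst (t a) = 0}"] card_first_row[of \<mu>] by simp
qed

lemma finite_tableaux:
  assumes "finite A"
  shows "finite (tableaux A \<mu>)"
proof (rule finite_subset)
  show "tableaux A \<mu> \<subseteq> A \<rightarrow>\<^sub>E young_diagram \<mu>"
    unfolding tableaux_def bij_betw_def by (auto simp: extensional_def)
  show "finite (A \<rightarrow>\<^sub>E young_diagram \<mu>)"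
    by (rule finite_PiE[OF assms]) (rule finite_young_diagram)
qed

lemma tableaux_comp_inv:
  assumes "t \<in> tableaux A \<mu>" "\<pi> permutes A"
  shows "t \<circ> inv' \<pi> \<in> tableaux A \<mu>"
proof -
  have "bij_betw (t \<circ> inv' \<pi>) A (young_diagram \<mu>)"
    using assms permutes_imp_bij[OF permutes_inv[OF assms(2)]] unfolding tableaux_def
    by (auto intro: bij_betw_trans)
  moreover have "t \<circ> inv' \<pi> \<in> extensional A"
    using assms permutes_not_in[OF permutes_inv[OF assms(2)]] unfolding tableaux_def extensional_def
    by simp
  ultimately show ?thesis
    unfolding tableaux_def by blast
qed

section \<open>Column groups and polytabloids\<close>

lemma finite_column_group: "finite A \<Longrightarrow> finite (column_group A t)"
  unfolding column_group_def by (rule finite_subset[OF _ finite_permutations]) auto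

lemma column_group_conj:
  assumes "\<sigma> \<in> column_group A t" "\<pi> permutes A"
  shows "\<pi> \<circ> \<sigma> \<circ> inv' \<pi> \<in> column_group A (t \<circ> inv' \<pi>)"
proof -
  have \<sigma>: "\<sigma> permutes A" "\<And>x. x \<in> A \<Longrightarrow> snd (t (\<sigma> x)) = snd (t x)"
    using assms(1) unfolding column_group_def by auto
  have "inv' \<pi> x \<in> A" if "x \<in> A" for x
    using permutes_in_image[OF permutes_inv[OF assms(2)]] that by blast
  then show ?thesis
    unfolding column_group_def
    using \<sigma> permutes_compose[OF permutes_inv[OF assms(2)] permutes_compose[OF \<sigma>(1) assms(2)]]
    by (simp add: permutes_inverses(2)[OF assms(2)] comp_assoc)
qed

lemma sign_conj:
  assumes "finite A" "\<sigma> permutes A" "\<pi> permutes A"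
  shows "sign (\<pi> \<circ> \<sigma> \<circ> inv' \<pi>) = sign \<sigma>"
proof -
  note p = permutes_imp_permutation[OF assms(1)]
  have "sign (\<pi> \<circ> \<sigma> \<circ> inv' \<pi>) = sign \<pi> * sign \<sigma> * sign \<pi>"
    using p[OF assms(2)] p[OF assms(3)] p[OF permutes_inv[OF assms(3)]]
    by (simp add: sign_compose permutation_compose sign_inverse)
  then show ?thesis
    by (simp add: mult.commute mult.left_commute)
qed

text \<open>Conjugation by \<pi> carries the column group of t to that of the permuted tableau and
  preserves signs.\<close>

lemma perm_act_polytabloid:
  assumes "finite A" "\<pi> permutes A"
  shows "perm_act \<pi> (polytabloid A t) = polytabloid A (t \<circ> inv' \<pi>)"
proof
  fix T
  have inv: "inv' \<pi> \<circ> \<pi> = id" "\<pi> \<circ> inv' \<pi> = id" "inv' (inv' \<pi>) = \<pi>"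
    using permutes_inv_o[OF assms(2)] permutes_inv_inv[OF assms(2)] by auto
  have conj: "inv' \<pi> \<circ> (\<pi> \<circ> \<sigma> \<circ> inv' \<pi>) \<circ> \<pi> = \<sigma>" "\<pi> \<circ> (inv' \<pi> \<circ> \<sigma> \<circ> \<pi>) \<circ> inv' \<pi> = \<sigma>" for \<sigma>
    using fun_cong[OF inv(1)] fun_cong[OF inv(2)] by (auto simp: fun_eq_iff)
  show "perm_act \<pi> (polytabloid A t) T = polytabloid A (t \<circ> inv' \<pi>) T"
    unfolding perm_act_def polytabloid_def
  proof (rule sum.reindex_bij_witness[of _ "\<lambda>\<sigma>. inv' \<pi> \<circ> \<sigma> \<circ> \<pi>" "\<lambda>\<sigma>. \<pi> \<circ> \<sigma> \<circ> inv' \<pi>"])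
    fix \<sigma> assume \<sigma>: "\<sigma> \<in> column_group A t"
    then have perm: "\<sigma> permutes A"
      unfolding column_group_def by blast
    show "\<pi> \<circ> \<sigma> \<circ> inv' \<pi> \<in> column_group A (t \<circ> inv' \<pi>)"
      by (rule column_group_conj[OF \<sigma> assms(2)])
    have "inv' (\<pi> \<circ> \<sigma> \<circ> inv' \<pi>) = \<pi> \<circ> inv' \<sigma> \<circ> inv' \<pi>"
      using permutes_bij[OF perm] permutes_bij[OF assms(2)] permutes_bij[OF permutes_inv[OF assms(2)]]
      by (simp add: o_inv_distrib bij_comp inv(3) comp_assoc)
    then have "tabloid (t \<circ> inv' \<pi> \<circ> inv' (\<pi> \<circ> \<sigma> \<circ> inv' \<pi>)) = tabloid (t \<circ> inv' \<sigma>) \<circ> inv' \<pi>"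
      using fun_cong[OF inv(1)] by (simp add: tabloid_def fun_eq_iff)
    moreover have "T = f \<circ> inv' \<pi> \<longleftrightarrow> T \<circ> \<pi> = f" for f
      using fun_cong[OF inv(1)] fun_cong[OF inv(2)] by (auto simp: fun_eq_iff) (metis comp_apply id_apply)+
    ultimately show "of_int (sign (\<pi> \<circ> \<sigma> \<circ> inv' \<pi>))
        * of_bool (T = tabloid (t \<circ> inv' \<pi> \<circ> inv' (\<pi> \<circ> \<sigma> \<circ> inv' \<pi>)))
      = (of_int (sign \<sigma>) * of_bool (T \<circ> \<pi> = tabloid (t \<circ> inv' \<sigma>)) :: complex)"
      by (simp only: sign_conj[OF assms(1) perm assms(2)])
  next
    fix \<sigma> assume "\<sigma> \<in> column_group A (t \<circ> inv' \<pi>)"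
    from column_group_conj[OF this permutes_inv[OF assms(2)]]
    show "inv' \<pi> \<circ> \<sigma> \<circ> \<pi> \<in> column_group A t"
      by (simp add: inv comp_assoc)
  qed (simp_all only: conj)
qed

lemma perm_act_linear: "clinear (perm_act \<pi>)"
  by (rule clinearI) (simp_all add: perm_act_def fun_eq_iff)

lemma perm_act_comp: "perm_act \<pi> (perm_act \<sigma> f) = perm_act (\<pi> \<circ> \<sigma>) f"
  by (simp add: perm_act_def comp_assoc)

lemma perm_act_specht:
  assumes "finite A" "\<pi> permutes A" "v \<in> specht_module A \<mu>"
  shows "perm_act \<pi> v \<in> specht_module A \<mu>"
proof -
  let ?S = "polytabloid A ` tableaux A \<mu>"
  have "perm_act \<pi> v \<in> perm_act \<pi> ` cfun.span ?S"
    using assms(3) unfolding specht_module_def by (rule imageI)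
  also have "\<dots> = cfun.span (perm_act \<pi> ` ?S)"
    by (rule cfun_pair.linear_span_image[OF perm_act_linear, symmetric])
  also have "\<dots> \<subseteq> cfun.span ?S"
  proof (rule cfun.span_mono, rule subsetI)
    fix u assume "u \<in> perm_act \<pi> ` ?S"
    then obtain t where "t \<in> tableaux A \<mu>" "u = perm_act \<pi> (polytabloid A t)"
      by blast
    then show "u \<in> ?S"
      using tableaux_comp_inv[OF _ assms(2)] perm_act_polytabloid[OF assms(1,2)] by auto
  qed
  finally show ?thesis
    unfolding specht_module_def .
qed

lemma fin_dim_specht: "finite A \<Longrightarrow> fin_dim (specht_module A \<mu>)"
  unfolding specht_module_def by (intro fin_dim_span finite_imageI finite_tableaux)

text \<open>Coefficient functions are defined on all row functions, including those that come from
  no tableau of the shape; this lemma confines the check that a vector vanishes to genuine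
  tabloids.\<close>

lemma specht_support:
  assumes "v \<in> specht_module A \<mu>" "v T \<noteq> 0"
  obtains t where "t \<in> tableaux A \<mu>" "T = tabloid t"
proof -
  let ?W = "{v :: ('a \<Rightarrow> nat) \<Rightarrow> complex. \<forall>T. T \<notin> tabloid ` tableaux A \<mu> \<longrightarrow> v T = 0}"
  have "cfun.subspace ?W"
    by (rule cfun.subspaceI) auto
  moreover have "polytabloid A ` tableaux A \<mu> \<subseteq> ?W"
  proof clarify
    fix t T assume t: "t \<in> tableaux A \<mu>" and T: "T \<notin> tabloid ` tableaux A \<mu>"
    have "T \<noteq> tabloid (t \<circ> inv' \<sigma>)" if "\<sigma> \<in> column_group A t" for \<sigma>
      using T tableaux_comp_inv[OF t, of \<sigma>] that unfolding column_group_def by blast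
    then show "polytabloid A t T = 0"
      unfolding polytabloid_def by (intro sum.neutral) simp
  qed
  ultimately have "specht_module A \<mu> \<subseteq> ?W"
    unfolding specht_module_def by (intro cfun.span_minimal)
  then show ?thesis
    using assms that by blast
qed

text \<open>A column permutation that also preserves every row fixes every cell, so only the
  identity contributes. In particular polytabloids are nonzero.\<close>

lemma polytabloid_self:
  assumes "finite A" "t \<in> tableaux A \<mu>"
  shows "polytabloid A t (tabloid t) = 1"
proof -
  have t: "inj_on t A"
    using assms(2) unfolding tableaux_def bij_betw_def by blast
  have "\<sigma> = id" if \<sigma>: "\<sigma> \<in> column_group A t" and eq: "tabloid t = tabloid (t \<circ> inv' \<sigma>)" for \<sigma>
  proof -
    have perm: "\<sigma> permutes A" and col: "\<And>x. x \<in> A \<Longrightarrow> snd (t (\<sigma> x)) = snd (t x)"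
      using \<sigma> unfolding column_group_def by auto
    have "\<sigma> x = x" for x
    proof (cases "x \<in> A")
      case True
      have "fst (t (\<sigma> x)) = fst (t x)"
        using fun_cong[OF eq, of "\<sigma> x"] permutes_inverses(2)[OF perm] by (simp add: tabloid_def)
      then have "t (\<sigma> x) = t x"
        using col[OF True] by (simp add: prod_eq_iff)
      then show ?thesis
        using inj_onD[OF t] True permutes_in_image[OF perm] by blast
    next
      case False
      then show ?thesis
        by (rule permutes_not_in[OF perm])
    qed
    then show ?thesis
      by (simp add: fun_eq_iff)
  qed
  then have "polytabloid A t (tabloid t) = (\<Sum>\<sigma>\<in>{id}. of_int (sign \<sigma>) * of_bool (tabloid t = tabloid (t \<circ> inv' \<sigma>)))"
    unfolding polytabloid_def
    by (intro sum.mono_neutral_right finite_column_group[OF assms(1)])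
      (auto simp: column_group_def permutes_id)
  then show ?thesis
    by simp
qed

text \<open>Left multiplication by the transposition is an involution of the column group that
  reverses signs.\<close>

lemma perm_act_transpose_polytabloid:
  assumes "finite A" "a \<in> A" "b \<in> A" "a \<noteq> b" "snd (t a) = snd (t b)"
  shows "perm_act (transpose a b) (polytabloid A t) = - polytabloid A t"
proof
  fix T
  let ?\<tau> = "transpose a b"
  have \<tau>: "?\<tau> permutes A"
    using assms by (intro permutes_swap_id)
  have \<tau>\<tau>: "?\<tau> \<circ> ?\<tau> = id"
    by (simp add: fun_eq_iff)
  have mem: "?\<tau> \<circ> \<sigma> \<in> column_group A t" if "\<sigma> \<in> column_group A t" for \<sigma>
  proof -
    have "snd (t (?\<tau> x)) = snd (t x)" for x
      using assms(5) by (cases "x = a"; cases "x = b") auto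
    then show ?thesis
      using that \<tau> unfolding column_group_def by (auto intro: permutes_compose)
  qed
  have term_eq: "of_int (sign (?\<tau> \<circ> \<sigma>)) * of_bool (T = tabloid (t \<circ> inv' (?\<tau> \<circ> \<sigma>)))
      = (- (of_int (sign \<sigma>) * of_bool (T \<circ> ?\<tau> = tabloid (t \<circ> inv' \<sigma>))) :: complex)"
    if "\<sigma> \<in> column_group A t" for \<sigma>
  proof -
    have perm: "\<sigma> permutes A"
      using that unfolding column_group_def by blast
    have "inv' (?\<tau> \<circ> \<sigma>) = inv' \<sigma> \<circ> ?\<tau>"
      using permutes_bij[OF perm] permutes_bij[OF \<tau>] by (simp add: o_inv_distrib)
    moreover have "T = f \<circ> ?\<tau> \<longleftrightarrow> T \<circ> ?\<tau> = f" for f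
      using \<tau>\<tau> by (metis comp_assoc comp_id)
    ultimately have "T = tabloid (t \<circ> inv' (?\<tau> \<circ> \<sigma>)) \<longleftrightarrow> T \<circ> ?\<tau> = tabloid (t \<circ> inv' \<sigma>)"
      by (simp add: tabloid_def comp_assoc[symmetric])
    moreover have "sign (?\<tau> \<circ> \<sigma>) = - sign \<sigma>"
      using permutes_imp_permutation[OF assms(1) perm] permutes_imp_permutation[OF assms(1) \<tau>] assms(4)
      by (simp add: sign_compose sign_swap_id)
    ultimately show ?thesis
      by simp
  qed
  have "polytabloid A t T = (\<Sum>\<sigma>\<in>column_group A t. - (of_int (sign \<sigma>) * of_bool (T \<circ> ?\<tau> = tabloid (t \<circ> inv' \<sigma>))))"
    unfolding polytabloid_def
  proof (rule sum.reindex_bij_witness[of _ "\<lambda>\<sigma>. ?\<tau> \<circ> \<sigma>" "\<lambda>\<sigma>. ?\<tau> \<circ> \<sigma>"])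
    fix \<sigma> assume \<sigma>: "\<sigma> \<in> column_group A t"
    show "?\<tau> \<circ> (?\<tau> \<circ> \<sigma>) = \<sigma>"
      by (simp add: comp_assoc[symmetric] \<tau>\<tau>)
    then show "?\<tau> \<circ> (?\<tau> \<circ> \<sigma>) = \<sigma>" .
    show "?\<tau> \<circ> \<sigma> \<in> column_group A t" "?\<tau> \<circ> \<sigma> \<in> column_group A t"
      by (rule mem[OF \<sigma>])+
    show "- (of_int (sign (?\<tau> \<circ> \<sigma>)) * of_bool (T \<circ> ?\<tau> = tabloid (t \<circ> inv' (?\<tau> \<circ> \<sigma>))))
        = (of_int (sign \<sigma>) * of_bool (T = tabloid (t \<circ> inv' \<sigma>)) :: complex)"
      using term_eq[OF mem[OF \<sigma>]] \<open>?\<tau> \<circ> (?\<tau> \<circ> \<sigma>) = \<sigma>\<close> by simp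
  qed
  then show "perm_act ?\<tau> (polytabloid A t) T = (- polytabloid A t) T"
    by (simp add: perm_act_def polytabloid_def sum_negf)
qed

text \<open>By pigeonhole two entries of \<open>B\<close> share a column, and their transposition negates the
  polytabloid.\<close>

lemma sum_perm_act_polytabloid_eq_0:
  assumes "finite A" "is_partition \<mu>" "t \<in> tableaux A \<mu>" "B \<subseteq> A" "largest_part \<mu> < card B"
  shows "(\<Sum>\<pi>\<in>{\<pi>. \<pi> permutes B}. perm_act \<pi> (polytabloid A t)) = 0"
proof -
  have "(\<lambda>a. snd (t a)) ` B \<subseteq> {..<largest_part \<mu>}"
    using assms(3,4) column_less_largest_part[OF assms(2)] unfolding tableaux_def bij_betw_def by blast
  then have "card ((\<lambda>a. snd (t a)) ` B) \<le> card {..<largest_part \<mu>}"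
    by (intro card_mono) simp
  then have "\<not> inj_on (\<lambda>a. snd (t a)) B"
    using pigeonhole[of "\<lambda>a. snd (t a)" B] assms(5) by simp
  then obtain a b where ab: "a \<in> B" "b \<in> B" "a \<noteq> b" "snd (t a) = snd (t b)"
    unfolding inj_on_def by blast
  let ?S = "\<Sum>\<pi>\<in>{\<pi>. \<pi> permutes B}. perm_act \<pi> (polytabloid A t)"
  have "?S = (\<Sum>\<pi>\<in>{\<pi>. \<pi> permutes B}. perm_act (\<pi> \<circ> transpose a b) (polytabloid A t))"
    by (rule sum_permutations_compose_right[OF permutes_swap_id[OF ab(1,2)]])
  also have "\<dots> = (\<Sum>\<pi>\<in>{\<pi>. \<pi> permutes B}. - perm_act \<pi> (polytabloid A t))"
  proof (rule sum.cong[OF refl])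
    fix \<pi>
    have "perm_act (transpose a b) (polytabloid A t) = - polytabloid A t"
      using assms(1,4) ab by (intro perm_act_transpose_polytabloid) auto
    then show "perm_act (\<pi> \<circ> transpose a b) (polytabloid A t) = - perm_act \<pi> (polytabloid A t)"
      by (simp add: perm_act_comp[symmetric] cfun_pair.linear_neg[OF perm_act_linear])
  qed
  also have "\<dots> = - ?S"
    by (rule sum_negf)
  finally have "?S = - ?S" .
  then have "?S T = - ?S T" for T
    by (metis uminus_apply)
  moreover have "x = - x \<Longrightarrow> x = 0" for x :: complex
    by (simp add: complex_eq_iff)
  ultimately have "?S T = 0" for T
    by blast
  then show ?thesis
    by (intro ext) simp
qed

text \<open>Summing over the permutations of B annihilates the span of the polytabloids, but
  multiplies an invariant vector by the nonzero number of these permutations.\<close>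

lemma specht_invariant_eq_0:
  assumes "finite A" "is_partition \<mu>" "B \<subseteq> A" "largest_part \<mu> < card B" "v \<in> specht_module A \<mu>"
    and inv: "\<And>\<pi>. \<pi> permutes B \<Longrightarrow> perm_act \<pi> v = v"
  shows "v = 0"
proof -
  let ?E = "\<lambda>v. \<Sum>\<pi>\<in>{\<pi>. \<pi> permutes B}. perm_act \<pi> v"
  have "clinear ?E"
    by (rule cfun_pair.linear_compose_sum) (simp add: perm_act_linear)
  moreover have "?E u = 0" if "u \<in> polytabloid A ` tableaux A \<mu>" for u
    using that sum_perm_act_polytabloid_eq_0[OF assms(1,2) _ assms(3,4)] by auto
  ultimately have "?E v = 0"
    using assms(5) unfolding specht_module_def by (rule cfun_pair.linear_eq_0_on_span)
  moreover have "?E v = (\<Sum>\<pi>\<in>{\<pi>. \<pi> permutes B}. v)"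
    using inv by (intro sum.cong) auto
  ultimately have zero: "(\<Sum>\<pi>\<in>{\<pi>. \<pi> permutes B}. v) = 0"
    by (simp only:)
  have "of_nat (card {\<pi>. \<pi> permutes B}) * v T = 0" for T
  proof -
    have "(\<Sum>\<pi>\<in>{\<pi>. \<pi> permutes B}. v) T = of_nat (card {\<pi>. \<pi> permutes B}) * v T"
      unfolding sum_apply by (rule sum_constant)
    then show ?thesis
      unfolding zero by simp
  qed
  moreover have "card {\<pi>. \<pi> permutes B} \<noteq> 0"
    using card_permutations[OF refl finite_subset[OF assms(3,1)]] by simp
  ultimately show ?thesis
    by (simp add: fun_eq_iff)
qed

text \<open>The identity projects the Specht module onto itself, and the module contains a nonzero
  polytabloid. These positive degrees are the factors contributed by the blocks of nonzero
  color.\<close>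

lemma sym_char_id:
  assumes "finite A" "sum_list \<mu> = card A"
  obtains d :: nat where "sym_char A \<mu> id = of_nat d" "d > 0"
proof -
  obtain t where t: "t \<in> tableaux A \<mu>"
    by (rule ex_tableau[OF assms])
  have id: "perm_act id v = v" for v :: "('a \<Rightarrow> nat) \<Rightarrow> complex"
    by (simp add: perm_act_def)
  have "polytabloid A t \<in> specht_module A \<mu>"
    unfolding specht_module_def using t by (intro cfun.span_base imageI)
  moreover have "polytabloid A t \<noteq> 0"
    using polytabloid_self[OF assms(1) t] by (metis zero_fun_apply zero_neq_one)
  ultimately have ne: "specht_module A \<mu> \<noteq> {0}"
    by blast
  obtain d :: nat where "trace_on (specht_module A \<mu>) (perm_act id) = of_nat d"
      "d = 0 \<longleftrightarrow> specht_module A \<mu> = {0}"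
    by (rule trace_on_projection[OF fin_dim_specht[OF assms(1)] perm_act_linear[of id],
          where W = "specht_module A \<mu>"])
      (auto simp: id image_iff)
  then show ?thesis
    using that ne unfolding sym_char_def by auto
qed

text \<open>The average over G is a projection onto the common fixed vectors, so its trace d is
  their dimension. The group structure is encoded in \<open>inv\<close>: every operator fixes the
  sum over G.\<close>

lemma trace_on_group_sum:
  fixes R :: "'g \<Rightarrow> ('t \<Rightarrow> complex) \<Rightarrow> 't \<Rightarrow> complex"
  assumes U: "fin_dim U" and G: "finite G" "G \<noteq> {}"
    and R: "\<And>g. g \<in> G \<Longrightarrow> clinear (R g)" "\<And>g u. g \<in> G \<Longrightarrow> u \<in> U \<Longrightarrow> R g u \<in> U"
    and inv: "\<And>g u. g \<in> G \<Longrightarrow> u \<in> U \<Longrightarrow> R g (\<Sum>h\<in>G. R h u) = (\<Sum>h\<in>G. R h u)"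
  obtains d :: nat where "(\<Sum>g\<in>G. trace_on U (R g)) = of_nat (d * card G)"
    "d = 0 \<longleftrightarrow> {u \<in> U. \<forall>g\<in>G. R g u = u} = {0}"
proof -
  define N :: complex where "N = of_nat (card G)"
  have N: "N \<noteq> 0"
    using G by (simp add: N_def)
  let ?W = "{u \<in> U. \<forall>g\<in>G. R g u = u}"
  define S where "S u = (\<Sum>g\<in>G. R g u)" for u
  define E where "E u = (\<lambda>x. inverse N * S u x)" for u
  have sub: "cfun.subspace U"
    by (rule fin_dim_imp_subspace[OF U])
  have S: "clinear S"
    unfolding S_def by (rule cfun_pair.linear_compose_sum) (simp add: R(1))
  have E: "clinear E"
    unfolding E_def by (rule cfun_pair.linear_compose_scale_right[OF S])
  have EU: "E u \<in> U" if "u \<in> U" for u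
    unfolding E_def S_def
    by (rule cfun.subspace_scale[OF sub], rule cfun.subspace_sum[OF sub], rule R(2)[OF _ that])
  have E_W: "E u = u" if "u \<in> ?W" for u
  proof -
    have "S u = (\<Sum>g\<in>G. u)"
      unfolding S_def using that by (intro sum.cong) auto
    then show ?thesis
      using N by (simp add: E_def fun_eq_iff sum_apply N_def)
  qed
  have W_E: "E u \<in> ?W" if "u \<in> U" for u
  proof -
    have "R g (E u) = E u" if "g \<in> G" for g
      using inv[OF that \<open>u \<in> U\<close>] by (simp add: E_def cfun_pair.linear_scale[OF R(1)[OF that]] S_def)
    then show ?thesis
      using EU[OF that] by blast
  qed
  have "E ` U = ?W"
  proof (intro equalityI subsetI)
    fix w assume w: "w \<in> ?W"
    then have "E w \<in> E ` U"
      by blast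
    then show "w \<in> E ` U"
      unfolding E_W[OF w] .
  qed (use W_E in blast)
  then obtain d :: nat where d: "trace_on U E = of_nat d" "d = 0 \<longleftrightarrow> ?W = {0}"
    by (rule trace_on_projection[OF U E _ E_W]) auto
  obtain B where B: "finite B" "cfun.independent B" "cfun.span B = U"
    using U unfolding fin_dim_def by blast
  let ?r = "cfun.representation B"
  have BU: "b \<in> U" if "b \<in> B" for b
    using cfun.span_base[OF that] B(3) by simp
  have "N * trace_on U E = (\<Sum>b\<in>B. N * ?r (E b) b)"
    using trace_on_basis[OF B E EU] by (simp add: sum_distrib_left)
  also have "\<dots> = (\<Sum>b\<in>B. \<Sum>g\<in>G. ?r (R g b) b)"
  proof (rule sum.cong[OF refl])
    fix b assume b: "b \<in> B"
    have "N * ?r (E b) b = N * (inverse N * ?r (S b) b)"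
    proof -
      have "S b \<in> cfun.span B"
        unfolding S_def B(3) by (rule cfun.subspace_sum[OF sub], rule R(2)[OF _ BU[OF b]])
      then show ?thesis
        unfolding E_def by (simp only: cfun.representation_scale[OF B(2)])
    qed
    also have "\<dots> = ?r (S b) b"
      using N by simp
    also have "\<dots> = ?r (\<Sum>g\<in>G. (\<lambda>x. 1 * R g b x)) b"
      by (simp add: S_def)
    also have "\<dots> = (\<Sum>g\<in>G. 1 * ?r (R g b) b)"
      by (rule functional_on_sum[OF functional_on_representation[OF B(2)] cfun.subspace_span])
        (use R(2)[OF _ BU[OF b]] B(3) in simp)
    finally show "N * ?r (E b) b = (\<Sum>g\<in>G. ?r (R g b) b)"
      by simp
  qed
  also have "\<dots> = (\<Sum>g\<in>G. \<Sum>b\<in>B. ?r (R g b) b)"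
    by (rule sum.swap)
  also have "\<dots> = (\<Sum>g\<in>G. trace_on U (R g))"
    by (rule sum.cong[OF refl], rule trace_on_basis[OF B R(1), symmetric]) (auto intro: R(2))
  finally show ?thesis
    using that[of d] d by (simp add: N_def mult.commute)
qed

section \<open>Invariant tuples with values in a Specht module\<close>

text \<open>The inverse compensates for the pullback in \<open>tuple_act\<close>; the unit color
  makes the columns the elements of A themselves.\<close>

definition entry_perm :: "('a \<Rightarrow> 'a) \<Rightarrow> unit \<times> 'a \<Rightarrow> unit \<times> 'a"
  where "entry_perm \<pi> z = (fst z, inv' \<pi> (snd z))"

definition specht_tuple_act ::
  "nat set \<Rightarrow> 'a set \<Rightarrow> ('a \<Rightarrow> 'a) \<Rightarrow> ((nat \<Rightarrow> unit \<times> 'a) \<times> ('a \<Rightarrow> nat) \<Rightarrow> complex)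
    \<Rightarrow> (nat \<Rightarrow> unit \<times> 'a) \<times> ('a \<Rightarrow> nat) \<Rightarrow> complex"
  where "specht_tuple_act K A \<pi> = tuple_act K {()} A (entry_perm \<pi>) (perm_act \<pi>)"

lemma column_perm_entry_perm:
  assumes "\<pi> permutes A"
  shows "column_perm {()} A (entry_perm \<pi>)"
proof -
  have inv: "inv' \<pi> x \<in> A \<longleftrightarrow> x \<in> A" "\<pi> x \<in> A \<longleftrightarrow> x \<in> A" for x
    using permutes_in_image[OF permutes_inv[OF assms]] permutes_in_image[OF assms] by auto
  have "bij_betw (entry_perm \<pi>) ({()} \<times> A) ({()} \<times> A)"
    by (rule bij_betw_byWitness[where f' = "\<lambda>z. (fst z, \<pi> (snd z))"])
      (auto simp: entry_perm_def permutes_inverses[OF assms] inv)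
  moreover have "inv' \<pi> x = inv' \<pi> y \<longleftrightarrow> x = y" for x y
    using permutes_inv_eq[OF assms] permutes_inverses[OF assms] by metis
  ultimately show ?thesis
    unfolding column_perm_def by (simp add: entry_perm_def)
qed

lemma specht_tuple_act_apply:
  "x \<in> inj_tuples K {()} A \<Longrightarrow>
    specht_tuple_act K A \<pi> \<Phi> (x, T) = \<Phi> (\<lambda>i\<in>K. entry_perm \<pi> (x i), T \<circ> \<pi>)"
  by (simp add: specht_tuple_act_def tuple_act_def perm_act_def)

lemma specht_tuple_act_linear: "clinear (specht_tuple_act K A \<pi>)"
  unfolding specht_tuple_act_def by (rule tuple_act_linear[OF perm_act_linear])

lemma specht_tuple_act_comp:
  assumes "\<pi> permutes A" "\<sigma> permutes A"
  shows "specht_tuple_act K A (\<pi> \<circ> \<sigma>) \<Phi> = specht_tuple_act K A \<pi> (specht_tuple_act K A \<sigma> \<Phi>)"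
  unfolding specht_tuple_act_def
  by (rule tuple_act_comp[OF column_perm_entry_perm[OF assms(1)]])
    (simp_all add: perm_act_comp entry_perm_def
      o_inv_distrib[OF permutes_bij[OF assms(1)] permutes_bij[OF assms(2)]])

lemma specht_tuple_act_sum:
  assumes "\<pi> permutes A"
  shows "specht_tuple_act K A \<pi> (\<Sum>\<sigma>\<in>{\<sigma>. \<sigma> permutes A}. specht_tuple_act K A \<sigma> \<Phi>)
    = (\<Sum>\<sigma>\<in>{\<sigma>. \<sigma> permutes A}. specht_tuple_act K A \<sigma> \<Phi>)"
proof -
  have "specht_tuple_act K A \<pi> (\<Sum>\<sigma>\<in>{\<sigma>. \<sigma> permutes A}. specht_tuple_act K A \<sigma> \<Phi>)
      = (\<Sum>\<sigma>\<in>{\<sigma>. \<sigma> permutes A}. specht_tuple_act K A (\<pi> \<circ> \<sigma>) \<Phi>)"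
    unfolding cfun_pair.linear_sum[OF specht_tuple_act_linear]
    by (rule sum.cong[OF refl]) (simp add: specht_tuple_act_comp[OF assms])
  also have "\<dots> = (\<Sum>\<sigma>\<in>{\<sigma>. \<sigma> permutes A}. specht_tuple_act K A \<sigma> \<Phi>)"
    by (rule sum.reindex_bij_witness[of _ "\<lambda>\<sigma>. inv' \<pi> \<circ> \<sigma>" "\<lambda>\<sigma>. \<pi> \<circ> \<sigma>"])
      (auto simp: comp_assoc[symmetric] permutes_inv_o[OF assms] intro: permutes_compose assms permutes_inv)
  finally show ?thesis .
qed

lemma card_ne_0: "x \<in> S \<Longrightarrow> finite S \<Longrightarrow> card S \<noteq> 0"
  by auto

text \<open>Permutations of the entries missed by a tuple leave that tuple alone, so the value there
  is a Specht vector invariant under the permutations of more entries than the shape has columns.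
  The whole tuple space is treated so that the sums of an invariant, indexed by
  \<open>K - {p}\<close>, are covered as well.\<close>

lemma specht_tuple_space_invariant_eq_0:
  assumes A: "finite A" "is_partition \<mu>" and K: "finite K" "largest_part \<mu> < card A - card K"
    and \<Phi>: "\<Phi> \<in> tuple_space K {()} A (specht_module A \<mu>)"
    and inv: "\<And>\<pi>. \<pi> permutes A \<Longrightarrow> specht_tuple_act K A \<pi> \<Phi> = \<Phi>"
  shows "\<Phi> = 0"
proof -
  have "\<Phi> (x, T) = 0" for x T
  proof (cases "x \<in> inj_tuples K {()} A")
    case True
    let ?X = "(\<lambda>i. snd (x i)) ` K"
    have X: "?X \<subseteq> A"
      using inj_tuples_snd[OF True] by blast
    have "card ?X = card K"
      using True by (simp add: inj_tuples_def card_image)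
    then have "card (A - ?X) = card A - card K"
      using X K(1) by (simp add: card_Diff_subset)
    then have less: "largest_part \<mu> < card (A - ?X)"
      using K(2) by simp
    have "(\<lambda>t. \<Phi> (x, t)) = 0"
    proof (rule specht_invariant_eq_0[OF A _ less tuple_spaceD(1)[OF \<Phi>]])
      fix \<pi> assume \<pi>: "\<pi> permutes A - ?X"
      have \<pi>A: "\<pi> permutes A"
        by (rule permutes_subset[OF \<pi>]) blast
      have "inv' \<pi> (snd (x i)) = snd (x i)" if "i \<in> K" for i
        by (rule permutes_not_in[OF permutes_inv[OF \<pi>]]) (use that in blast)
      then have x: "(\<lambda>i\<in>K. entry_perm \<pi> (x i)) = x"
        using True by (auto simp: entry_perm_def inj_tuples_def PiE_iff extensional_def fun_eq_iff)
      have "\<Phi> (x, T \<circ> \<pi>) = \<Phi> (x, T)" for T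
        using fun_cong[OF inv[OF \<pi>A], of "(x, T)"] specht_tuple_act_apply[OF True, of \<pi> \<Phi> T]
        unfolding x by simp
      then show "perm_act \<pi> (\<lambda>t. \<Phi> (x, t)) = (\<lambda>t. \<Phi> (x, t))"
        by (simp add: perm_act_def)
    qed blast
    from fun_cong[OF this, of T] show ?thesis
      by simp
  next
    case False
    then show ?thesis
      by (rule tuple_spaceD(2)[OF \<Phi>])
  qed
  then show ?thesis
    by (simp add: fun_eq_iff)
qed

text \<open>An invariant \<open>\<Phi>\<close> evaluated at a tabloid with first row \<open>R\<close> is invariant under the permutations
  of \<open>R\<close>, and the vanishing sums express its value at a tuple through values at tuples with fewer
  entries in \<open>R\<close>.\<close>

lemma specht_kernel_space_invariant_eq_0:
  assumes A: "finite A" and K: "finite K" "card A - card K < largest_part \<mu>"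
    and \<Phi>: "\<Phi> \<in> kernel_space K K {()} A (specht_module A \<mu>)"
    and inv: "\<And>\<pi>. \<pi> permutes A \<Longrightarrow> specht_tuple_act K A \<pi> \<Phi> = \<Phi>"
  shows "\<Phi> = 0"
proof -
  have \<Phi>T: "\<Phi> \<in> tuple_space K {()} A (specht_module A \<mu>)"
    and \<Phi>0: "\<And>p. p \<in> K \<Longrightarrow> tuple_sum p K {()} A \<Phi> = 0"
    using \<Phi> unfolding kernel_space_def by auto
  have "\<Phi> (x, tabloid t) = 0" if t: "t \<in> tableaux A \<mu>" for x t
  proof -
    let ?T = "tabloid t"
    define R where "R = {a \<in> A. fst (t a) = 0}"
    have R: "R \<subseteq> A" "card R = largest_part \<mu>"
      unfolding R_def using card_tableau_first_row[OF t] by auto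
    have T: "?T a = 0" if "a \<in> R" for a
      using that by (simp add: R_def tabloid_def)
    have "\<Phi> (x, ?T) = 0" if "x \<in> inj_tuples K {()} A" for x
      using that
    proof (induction "card {i \<in> K. snd (x i) \<in> R}" arbitrary: x rule: less_induct)
      case less
      note x = less.prems
      \<comment> \<open>Fewer than |K| entries lie outside R, so every tuple meets R and the
        induction needs no separate base case.\<close>
      have "\<exists>p\<in>K. snd (x p) \<in> R"
      proof (rule ccontr)
        assume "\<not> (\<exists>p\<in>K. snd (x p) \<in> R)"
        then have "(\<lambda>i. snd (x i)) ` K \<subseteq> A - R"
          using inj_tuples_snd[OF x] by blast
        then have "card ((\<lambda>i. snd (x i)) ` K) \<le> card (A - R)"
          using A by (intro card_mono) auto
        moreover have "card ((\<lambda>i. snd (x i)) ` K) = card K"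
          using x by (simp add: inj_tuples_def card_image)
        moreover have "card (A - R) = card A - card R"
          using R(1) A by (simp add: card_Diff_subset finite_subset)
        moreover have "card R \<le> card A"
          by (rule card_mono[OF A R(1)])
        ultimately show False
          using K(2) R(2) by linarith
      qed
      then obtain p where p: "p \<in> K" "snd (x p) \<in> R"
        by blast
      define y where "y = x(p := undefined)"
      have y: "y \<in> inj_tuples (K - {p}) {()} A" "x p \<in> free_points (K - {p}) {()} A y"
        unfolding y_def by (rule inj_tuples_del[OF p(1) x])+
      have xy: "x = y(p := x p)"
        unfolding y_def by simp
      let ?F = "free_points (K - {p}) {()} A y"
      have F: "finite ?F"
        using A by (simp add: finite_free_points)
      have inside: "\<Phi> (y(p := z), ?T) = \<Phi> (x, ?T)" if z: "z \<in> ?F" "snd z \<in> R" for z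
      proof -
        \<comment> \<open>The transposition exchanges two entries of the first row: it fixes the
          tabloid and moves only entry p of the tuple, to z.\<close>
        let ?\<pi> = "transpose (snd z) (snd (x p))"
        have \<pi>: "?\<pi> permutes A"
          using z(2) p(2) R(1) by (intro permutes_swap_id) auto
        have "?T \<circ> ?\<pi> = ?T"
          using T[OF z(2)] T[OF p(2)] by (auto simp: fun_eq_iff transpose_def)
        moreover have "(\<lambda>i\<in>K. entry_perm ?\<pi> (x i)) = y(p := z)"
        proof (rule ext)
          fix i
          show "(\<lambda>i\<in>K. entry_perm ?\<pi> (x i)) i = (y(p := z)) i"
          proof (cases "i \<in> K - {p}")
            case True
            have "snd (x i) \<noteq> snd z"
              using z(1) True unfolding free_points_def y_def by (auto simp: image_iff)
            moreover have "snd (x i) \<noteq> snd (x p)"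
              using x p(1) True by (auto simp: inj_tuples_def inj_on_def)
            ultimately show ?thesis
              using True by (simp add: entry_perm_def y_def prod_eq_iff)
          next
            case False
            show ?thesis
            proof (cases "i = p")
              case True
              then show ?thesis
                using p(1) by (simp add: entry_perm_def prod_eq_iff)
            next
              case False
              then have "i \<notin> K"
                using \<open>i \<notin> K - {p}\<close> by blast
              then show ?thesis
                using x False by (simp add: y_def inj_tuples_def PiE_iff extensional_def)
            qed
          qed
        qed
        ultimately show ?thesis
          using fun_cong[OF inv[OF \<pi>], of "(x, ?T)"] specht_tuple_act_apply[OF x, of ?\<pi> \<Phi> ?T] by simp
      qed
      have outside: "\<Phi> (y(p := z), ?T) = 0" if z: "z \<in> ?F" "snd z \<notin> R" for z
      proof (rule less.hyps)
        show "y(p := z) \<in> inj_tuples K {()} A"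
          by (rule inj_tuples_upd[OF p(1) y(1) z(1)])
        have "{i \<in> K. snd ((y(p := z)) i) \<in> R} \<subset> {i \<in> K. snd (x i) \<in> R}"
          using z(2) p by (auto simp: y_def)
        then show "card {i \<in> K. snd ((y(p := z)) i) \<in> R} < card {i \<in> K. snd (x i) \<in> R}"
          using K(1) by (intro psubset_card_mono) auto
      qed
      have "0 = (\<Sum>z\<in>?F. \<Phi> (y(p := z), ?T))"
        using fun_cong[OF \<Phi>0[OF p(1)], of "(y, ?T)"] y(1) by (simp add: tuple_sum_def sum_at_def)
      also have "\<dots> = (\<Sum>z\<in>?F. if snd z \<in> R then \<Phi> (x, ?T) else 0)"
        using inside outside by (intro sum.cong) auto
      also have "\<dots> = (\<Sum>z\<in>{z \<in> ?F. snd z \<in> R}. \<Phi> (x, ?T))"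
        by (rule sum.inter_filter[OF F, symmetric])
      also have "\<dots> = of_nat (card {z \<in> ?F. snd z \<in> R}) * \<Phi> (x, ?T)"
        by (rule sum_constant)
      finally have "of_nat (card {z \<in> ?F. snd z \<in> R}) * \<Phi> (x, ?T) = 0"
        by simp
      moreover have "card {z \<in> ?F. snd z \<in> R} \<noteq> 0"
      proof -
        have "x p \<in> {z \<in> ?F. snd z \<in> R}"
          using y(2) p(2) by (intro CollectI conjI)
        then show ?thesis
          by (rule card_ne_0[OF _ finite_subset[OF _ F]]) blast
      qed
      ultimately show ?case
        by simp
    qed
    then show ?thesis
      using tuple_spaceD(2)[OF \<Phi>T] by (cases "x \<in> inj_tuples K {()} A") auto
  qed
  moreover have "\<Phi> (x, T) = 0" if "T \<notin> tabloid ` tableaux A \<mu>" for x T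
    using specht_support[OF tuple_spaceD(1)[OF \<Phi>T, of x], of T] that by blast
  ultimately have "\<Phi> (x, T) = 0" for x T
    by (cases "T \<in> tabloid ` tableaux A \<mu>") auto
  then show ?thesis
    by (simp add: fun_eq_iff)
qed

text \<open>The polytabloid of t is placed at a tuple listing the entries outside the first row of t
  and then averaged. The sums of the average vanish because they are invariants indexed by
  \<open>K - {p}\<close>, and a tuple of that size misses one entry more than the first row
  holds.\<close>

lemma specht_kernel_space_ex_invariant:
  assumes A: "finite A" "is_partition \<mu>" "sum_list \<mu> = card A"
    and K: "finite K" "card K \<le> card A" "largest_part \<mu> = card A - card K"
  obtains \<Phi> where "\<Phi> \<in> kernel_space K K {()} A (specht_module A \<mu>)" "\<Phi> \<noteq> 0"
    "\<And>\<pi>. \<pi> permutes A \<Longrightarrow> specht_tuple_act K A \<pi> \<Phi> = \<Phi>"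
proof -
  let ?V = "specht_module A \<mu>"
  let ?P = "{\<pi>. \<pi> permutes A}"
  have sub: "cfun.subspace ?V"
    by (rule fin_dim_imp_subspace[OF fin_dim_specht[OF A(1)]])
  obtain t where t: "t \<in> tableaux A \<mu>"
    by (rule ex_tableau[OF A(1,3)])
  define R where "R = {a \<in> A. fst (t a) = 0}"
  have R: "R \<subseteq> A" "card R = largest_part \<mu>"
    unfolding R_def using card_tableau_first_row[OF t] by auto
  have "card (A - R) = card K"
    using R A(1) K(2,3) by (simp add: card_Diff_subset finite_subset)
  then obtain b where b: "bij_betw b K (A - R)"
    using finite_same_card_bij[OF K(1), of "A - R"] A(1) by auto
  define x0 where "x0 = (\<lambda>i\<in>K. ((), b i))"
  have x0: "x0 \<in> inj_tuples K {()} A"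
    using b unfolding inj_tuples_def x0_def bij_betw_def by (auto simp: inj_on_def)
  define \<Psi> where "\<Psi> u = (if fst u = x0 then polytabloid A t (snd u) else 0)" for u
  have "polytabloid A t \<in> ?V"
    unfolding specht_module_def using t by (intro cfun.span_base imageI)
  then have "(\<lambda>T. \<Psi> (x, T)) \<in> ?V" for x
    using cfun.subspace_0[OF sub] by (cases "x = x0") (simp_all add: \<Psi>_def flip: zero_fun_def)
  then have \<Psi>: "\<Psi> \<in> tuple_space K {()} A ?V"
    unfolding tuple_space_def using x0 by (auto simp: \<Psi>_def)
  define \<Phi> where "\<Phi> = (\<Sum>\<pi>\<in>?P. specht_tuple_act K A \<pi> \<Psi>)"
  have inv: "specht_tuple_act K A \<pi> \<Phi> = \<Phi>" if "\<pi> permutes A" for \<pi>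
    unfolding \<Phi>_def by (rule specht_tuple_act_sum[OF that])
  have "specht_tuple_act K A \<pi> \<Psi> \<in> tuple_space K {()} A ?V" if "\<pi> permutes A" for \<pi>
    unfolding specht_tuple_act_def
    by (rule tuple_act_in_tuple_space[of ?V "perm_act \<pi>", OF perm_act_specht[OF A(1) that] cfun.subspace_0[OF sub] \<Psi>])
  then have \<Phi>T: "\<Phi> \<in> tuple_space K {()} A ?V"
    unfolding \<Phi>_def by (intro cfun.subspace_sum[OF tuple_space_subspace[OF sub]]) simp
  have "tuple_sum p K {()} A \<Phi> = 0" if p: "p \<in> K" for p
  proof (rule specht_tuple_space_invariant_eq_0[OF A(1,2), of "K - {p}"])
    \<comment> \<open>With J empty, the image lemma serves to place the sum in the tuple space for
      \<open>K - {p}\<close>.\<close>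
    have "tuple_sum p K {()} A \<Phi> \<in> tuple_sum p K {()} A ` kernel_space {} K {()} A ?V"
      using \<Phi>T by (intro imageI) (simp add: kernel_space_def)
    also have "\<dots> = kernel_space {} (K - {p}) {()} A ?V"
      by (rule tuple_sum_image_kernel_space[OF sub K(1) _ A(1) _ p]) (use K(2) in auto)
    finally show "tuple_sum p K {()} A \<Phi> \<in> tuple_space (K - {p}) {()} A ?V"
      by (simp add: kernel_space_def)
    show "specht_tuple_act (K - {p}) A \<pi> (tuple_sum p K {()} A \<Phi>) = tuple_sum p K {()} A \<Phi>"
      if "\<pi> permutes A" for \<pi>
      using tuple_sum_act[OF perm_act_linear column_perm_entry_perm[OF that] p, of \<pi> \<Phi>] inv[OF that]
      by (simp add: specht_tuple_act_def)
    have "card K = Suc (card (K - {p}))"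
      by (rule card.remove[OF K(1) p])
    then show "largest_part \<mu> < card A - card (K - {p})"
      using K(2,3) by linarith
  qed (use K(1) in simp)
  then have "\<Phi> \<in> kernel_space K K {()} A ?V"
    using \<Phi>T unfolding kernel_space_def by blast
  moreover have "\<Phi> \<noteq> 0"
  proof -
    \<comment> \<open>The stabilizer of x0 fixes every entry outside R, hence permutes R and fixes
      the tabloid of t. Each of its elements contributes 1 to \<Phi> at this point, all other
      permutations contribute 0, so nothing cancels.\<close>
    let ?G = "{\<pi> \<in> ?P. (\<lambda>i\<in>K. entry_perm \<pi> (x0 i)) = x0}"
    have P: "finite ?P"
      by (rule finite_permutations[OF A(1)])
    have stab: "tabloid t \<circ> \<pi> = tabloid t" if \<pi>: "\<pi> \<in> ?G" for \<pi>
    proof -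
      have perm: "\<pi> permutes A" and eq: "(\<lambda>i\<in>K. entry_perm \<pi> (x0 i)) = x0"
        using \<pi> by auto
      have fixed: "entry_perm \<pi> (x0 i) = x0 i" if "i \<in> K" for i
        using fun_cong[OF eq, of i] that by simp
      have "\<pi> a = a" if a: "a \<in> A - R" for a
      proof -
        obtain i where i: "i \<in> K" "a = b i"
          using b a unfolding bij_betw_def by blast
        then show ?thesis
          using fixed[OF i(1)] permutes_inv_eq[OF perm] by (simp add: x0_def entry_perm_def)
      qed
      then have "\<pi> permutes R"
        by (intro permutes_superset[OF perm])
      then have "tabloid t (\<pi> a) = tabloid t a" for a
        using permutes_in_image[of \<pi> R a] permutes_not_in[of \<pi> R a]
        by (cases "a \<in> R") (auto simp: R_def tabloid_def)
      then show ?thesis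
        by (simp add: fun_eq_iff)
    qed
    have "\<Phi> (x0, tabloid t) = (\<Sum>\<pi>\<in>?P. specht_tuple_act K A \<pi> \<Psi> (x0, tabloid t))"
      unfolding \<Phi>_def by (rule sum_apply)
    also have "\<dots> = (\<Sum>\<pi>\<in>?P. if (\<lambda>i\<in>K. entry_perm \<pi> (x0 i)) = x0 then 1 else 0)"
    proof (rule sum.cong[OF refl])
      fix \<pi> assume \<pi>: "\<pi> \<in> ?P"
      show "specht_tuple_act K A \<pi> \<Psi> (x0, tabloid t) = (if (\<lambda>i\<in>K. entry_perm \<pi> (x0 i)) = x0 then 1 else 0)"
      proof (cases "(\<lambda>i\<in>K. entry_perm \<pi> (x0 i)) = x0")
        case True
        then show ?thesis
          using \<pi> stab[of \<pi>] polytabloid_self[OF A(1) t] specht_tuple_act_apply[OF x0, of \<pi> \<Psi>]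
          by (simp add: \<Psi>_def)
      next
        case False
        then show ?thesis
          using specht_tuple_act_apply[OF x0, of \<pi> \<Psi>] by (simp add: \<Psi>_def)
      qed
    qed
    also have "\<dots> = (\<Sum>\<pi>\<in>?G. 1)"
      by (rule sum.inter_filter[OF P, symmetric])
    also have "\<dots> = of_nat (card ?G)"
      by simp
    finally have "\<Phi> (x0, tabloid t) = of_nat (card ?G)" .
    moreover have "id \<in> ?G"
      using x0 by (auto simp: permutes_id entry_perm_def inv_id inj_tuples_def PiE_iff extensional_def fun_eq_iff)
    then have "card ?G \<noteq> 0"
      by (rule card_ne_0[OF _ finite_subset[OF _ P]]) blast
    ultimately show ?thesis
      by auto
  qed
  ultimately show ?thesis
    by (rule that) (rule inv)
qed

text \<open>A single color makes the Charlier parameter 1. The sum is not normalized: it is the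
  dimension of the invariants of the common kernel times the order of the symmetric group.\<close>

lemma sum_charlier_sym_char:
  assumes A: "finite A" "is_partition \<mu>" "sum_list \<mu> = card A" and k: "2 * k \<le> card A"
  obtains d :: nat where
    "(\<Sum>\<pi>\<in>{\<pi>. \<pi> permutes A}. of_real (poly (charlier 1 k) (real (card {a \<in> A. \<pi> a = a}))) * sym_char A \<mu> \<pi>)
      = of_nat d"
    "d \<noteq> 0 \<longleftrightarrow> largest_part \<mu> = card A - k"
proof -
  let ?K = "{..<k}" and ?V = "specht_module A \<mu>" and ?P = "{\<pi>. \<pi> permutes A}"
  let ?U = "kernel_space ?K ?K {()} A ?V"
  have V: "fin_dim ?V"
    by (rule fin_dim_specht[OF A(1)])
  have sub: "cfun.subspace ?V"
    by (rule fin_dim_imp_subspace[OF V])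
  have U: "fin_dim ?U"
    by (rule fin_dim_subspace[OF fin_dim_tuple_space[OF V finite_lessThan _ A(1)] kernel_space_subspace[OF sub]])
      (auto simp: kernel_space_def)
  have P: "finite ?P" "?P \<noteq> {}"
    using finite_permutations[OF A(1)] permutes_id[of A] by blast+
  have RU: "specht_tuple_act ?K A \<pi> u \<in> ?U" if "\<pi> \<in> ?P" "u \<in> ?U" for \<pi> u
  proof -
    have \<pi>: "\<pi> permutes A"
      using that(1) by simp
    show ?thesis
      unfolding specht_tuple_act_def
      by (rule kernel_space_act[of "perm_act \<pi>" "{()}" A "entry_perm \<pi>" ?V, OF perm_act_linear
            column_perm_entry_perm[OF \<pi>] perm_act_specht[OF A(1) \<pi>] cfun.subspace_0[OF sub] subset_refl that(2)])
  qed
  obtain d :: nat where d: "(\<Sum>\<pi>\<in>?P. trace_on ?U (specht_tuple_act ?K A \<pi>)) = of_nat (d * card ?P)"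
    "d = 0 \<longleftrightarrow> {u \<in> ?U. \<forall>\<pi>\<in>?P. specht_tuple_act ?K A \<pi> u = u} = {0}"
    by (rule trace_on_group_sum[OF U P specht_tuple_act_linear RU specht_tuple_act_sum]) auto
  have "trace_on ?U (specht_tuple_act ?K A \<pi>)
      = of_real (poly (charlier 1 k) (real (card {a \<in> A. \<pi> a = a}))) * sym_char A \<mu> \<pi>"
    if \<pi>: "\<pi> \<in> ?P" for \<pi>
  proof -
    have perm: "\<pi> permutes A"
      using \<pi> by simp
    have fp: "{z \<in> {()} \<times> A. entry_perm \<pi> z = z} = {()} \<times> {a \<in> A. \<pi> a = a}"
      using permutes_inv_eq[OF perm] by (auto simp: entry_perm_def prod_eq_iff)
    have "trace_on ?U (specht_tuple_act ?K A \<pi>)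
        = of_real (poly (charlier (1 / real (card {()})) (card ?K)) (real (card {a \<in> A. \<pi> a = a})))
          * trace_on ?V (perm_act \<pi>)"
      unfolding specht_tuple_act_def
      by (rule trace_on_kernel_space_charlier[OF V _ A(1) _ perm_act_linear perm_act_specht[OF A(1) perm]
            column_perm_entry_perm[OF perm] fp]) (use k in auto)
    then show ?thesis
      by (simp add: sym_char_def)
  qed
  then have sum: "(\<Sum>\<pi>\<in>?P. of_real (poly (charlier 1 k) (real (card {a \<in> A. \<pi> a = a}))) * sym_char A \<mu> \<pi>)
      = of_nat (d * card ?P)"
    using d(1) by simp
  have zero: "0 \<in> {u \<in> ?U. \<forall>\<pi>\<in>?P. specht_tuple_act ?K A \<pi> u = u}"
    by (simp add: cfun.subspace_0[OF kernel_space_subspace[OF sub]]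
        cfun_pair.linear_0[OF specht_tuple_act_linear])
  have "d \<noteq> 0 \<longleftrightarrow> largest_part \<mu> = card A - k"
  proof
    assume "d \<noteq> 0"
    then obtain u where u: "u \<in> ?U" "\<And>\<pi>. \<pi> permutes A \<Longrightarrow> specht_tuple_act ?K A \<pi> u = u" "u \<noteq> 0"
      using d(2) zero by blast
    have "\<not> largest_part \<mu> < card A - k"
      using specht_tuple_space_invariant_eq_0[OF A(1,2), of ?K u] u unfolding kernel_space_def by auto
    moreover have "\<not> card A - k < largest_part \<mu>"
      using specht_kernel_space_invariant_eq_0[OF A(1), of ?K \<mu> u] u by auto
    ultimately show "largest_part \<mu> = card A - k"
      by linarith
  next
    assume lp: "largest_part \<mu> = card A - k"
    obtain u where u: "u \<in> ?U" "u \<noteq> 0" "\<And>\<pi>. \<pi> permutes A \<Longrightarrow> specht_tuple_act ?K A \<pi> u = u"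
      by (rule specht_kernel_space_ex_invariant[OF A, of ?K]) (use k lp in auto)
    then show "d \<noteq> 0"
      using d(2) by blast
  qed
  moreover have "card ?P \<noteq> 0"
    using P by simp
  ultimately show ?thesis
    using that[of "d * card ?P"] sum by simp
qed

section \<open>Frobenius reciprocity and sums over the base group\<close>

text \<open>This is k! times the coefficient of t^k in exp(-t) p(t). Evaluating it at (1 + r t)^m
  extracts a term of the exponential generating function of the Charlier polynomials with parameter
  1/r.\<close>

definition charlier_functional :: "nat \<Rightarrow> complex poly \<Rightarrow> complex"
  where "charlier_functional k p =
    (\<Sum>i\<le>k. (- 1) ^ i * of_nat (k choose i) * fact (k - i) * coeff p (k - i))"

lemma coeff_one_linear_power:
  fixes c :: complex
  shows "coeff ([:1, c:] ^ m) j = of_nat (m choose j) * c ^ j"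
proof (cases "j \<le> m")
  case True
  then show ?thesis
    by (simp add: coeff_linear_poly_power)
next
  case False
  have "degree ([:1, c:] ^ m) \<le> degree [:1, c:] * m"
    by (rule degree_power_le)
  also have "\<dots> \<le> m"
    by simp
  finally have "coeff ([:1, c:] ^ m) j = 0"
    using False by (intro coeff_eq_0) linarith
  then show ?thesis
    using False by (simp add: binomial_eq_0)
qed

lemma charlier_functional_linear_power:
  assumes "r > 0"
  shows "charlier_functional k ([:1, of_nat r:] ^ m) = of_real (poly (charlier (1 / real r) k) (real m))"
proof -
  have "(\<Prod>l<j. real r * (real m - real l)) = fact j * (real (m choose j) * real r ^ j)" for j
  proof -
    have "(\<Prod>l<j. real m - real l) = fact j * real (m choose j)"
      by (simp add: binomial_gbinomial gbinomial_prod_rev lessThan_atLeast0)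
    then show ?thesis
      by (simp add: prod.distrib)
  qed
  then show ?thesis
    by (simp add: charlier_functional_def poly_charlier[OF assms] coeff_one_linear_power mult.assoc)
qed

lemma charlier_functional_sum:
  "charlier_functional k (\<Sum>x\<in>X. p x) = (\<Sum>x\<in>X. charlier_functional k (p x))"
  unfolding charlier_functional_def coeff_sum sum_distrib_left by (rule sum.swap)

lemma charlier_functional_smult:
  "charlier_functional k (Polynomial.smult c p) = c * charlier_functional k p"
  by (simp add: charlier_functional_def sum_distrib_left mult_ac)

text \<open>Multiplying p by t^m shifts the extracted coefficient of exp(-t) p(t) from k to k - m;
  only the normalizing factorial has to be corrected.\<close>

lemma charlier_functional_monom_mult:
  "charlier_functional k (monom 1 m * p)
    = (if m \<le> k then fact k / fact (k - m) * charlier_functional (k - m) p else 0)"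
proof (cases "m \<le> k")
  case True
  have "charlier_functional k (monom 1 m * p)
      = (\<Sum>i\<le>k. if i \<le> k - m then (- 1) ^ i * of_nat (k choose i) * fact (k - i) * coeff p (k - m - i) else 0)"
    unfolding charlier_functional_def
    by (rule sum.cong) (use True in \<open>auto simp: coeff_monom_mult add.commute\<close>)
  also have "\<dots> = (\<Sum>i\<le>k - m. (- 1) ^ i * of_nat (k choose i) * fact (k - i) * coeff p (k - m - i))"
    by (rule sum.mono_neutral_cong_right) auto
  also have "\<dots> = (\<Sum>i\<le>k - m. fact k / fact (k - m)
      * ((- 1) ^ i * of_nat (k - m choose i) * fact (k - m - i) * coeff p (k - m - i)))"
  proof (rule sum.cong[OF refl])
    fix i assume "i \<in> {..k - m}"
    then have i: "i \<le> k - m" "i \<le> k"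
      by auto
    have "of_nat (k choose i) * fact (k - i) = (fact k / fact i :: complex)"
      using binomial_fact[OF i(2), where ?'a = complex] by simp
    moreover have "of_nat (k - m choose i) * fact (k - m - i) = (fact (k - m) / fact i :: complex)"
      using binomial_fact[OF i(1), where ?'a = complex] by simp
    ultimately show "(- 1) ^ i * of_nat (k choose i) * fact (k - i) * coeff p (k - m - i)
        = fact k / fact (k - m) * ((- 1) ^ i * of_nat (k - m choose i) * fact (k - m - i) * coeff p (k - m - i))"
      by (simp add: mult.assoc[symmetric]) (simp add: mult.assoc)
  qed
  also have "\<dots> = fact k / fact (k - m) * charlier_functional (k - m) p"
    unfolding charlier_functional_def by (rule sum_distrib_left[symmetric])
  finally show ?thesis
    using True by simp
next
  case False
  then show ?thesis
    by (auto simp: charlier_functional_def coeff_monom_mult intro!: sum.neutral)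
qed

section \<open>Reciprocity and orthogonality\<close>

text \<open>Frobenius reciprocity: after substituting conjugates, every x in G contributes the same
  sum over H, and the resulting factor |G| cancels.\<close>

lemma class_inner_induced_char:
  fixes G (structure)
  assumes "group G" "finite (carrier G)" "H \<subseteq> carrier G"
    and \<phi>: "\<And>x h. x \<in> carrier G \<Longrightarrow> h \<in> carrier G \<Longrightarrow> \<phi> (x \<otimes>\<^bsub>G\<^esub> h \<otimes>\<^bsub>G\<^esub> inv\<^bsub>G\<^esub> x) = \<phi> h"
  shows "class_inner G \<phi> (induced_char G H \<psi>) = (\<Sum>h\<in>H. \<phi> h * cnj (\<psi> h)) / of_nat (card H)"
proof -
  interpret group G
    by (rule assms(1))
  let ?G = "carrier G" and ?N = "of_nat (card H) :: complex"
  have conj: "(\<Sum>w\<in>?G. if inv x \<otimes> w \<otimes> x \<in> H then \<phi> w * cnj (\<psi> (inv x \<otimes> w \<otimes> x)) else 0)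
      = (\<Sum>h\<in>H. \<phi> h * cnj (\<psi> h))" if x: "x \<in> ?G" for x
  proof -
    have "(\<Sum>w\<in>?G. if inv x \<otimes> w \<otimes> x \<in> H then \<phi> w * cnj (\<psi> (inv x \<otimes> w \<otimes> x)) else 0)
        = (\<Sum>h\<in>?G. if h \<in> H then \<phi> h * cnj (\<psi> h) else 0)"
    proof (rule sum.reindex_bij_witness[of _ "\<lambda>h. x \<otimes> h \<otimes> inv x" "\<lambda>w. inv x \<otimes> w \<otimes> x"])
      fix w assume w: "w \<in> ?G"
      show cancel: "x \<otimes> (inv x \<otimes> w \<otimes> x) \<otimes> inv x = w"
        using x w by (simp add: m_assoc) (simp add: m_assoc[symmetric])
      show "inv x \<otimes> w \<otimes> x \<in> ?G"
        using x w by simp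
      show "(if inv x \<otimes> w \<otimes> x \<in> H then \<phi> (inv x \<otimes> w \<otimes> x) * cnj (\<psi> (inv x \<otimes> w \<otimes> x)) else 0)
          = (if inv x \<otimes> w \<otimes> x \<in> H then \<phi> w * cnj (\<psi> (inv x \<otimes> w \<otimes> x)) else 0)"
        using \<phi>[OF x, of "inv x \<otimes> w \<otimes> x"] x w cancel by simp
    next
      fix h assume h: "h \<in> ?G"
      show "inv x \<otimes> (x \<otimes> h \<otimes> inv x) \<otimes> x = h"
        using x h by (simp add: m_assoc) (simp add: m_assoc[symmetric])
      show "x \<otimes> h \<otimes> inv x \<in> ?G"
        using x h by simp
    qed
    also have "\<dots> = (\<Sum>h\<in>{h \<in> ?G. h \<in> H}. \<phi> h * cnj (\<psi> h))"
      by (rule sum.inter_filter[OF assms(2), symmetric])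
    also have "{h \<in> ?G. h \<in> H} = H"
      using assms(3) by blast
    finally show ?thesis .
  qed
  have "\<phi> w * cnj (induced_char G H \<psi> w)
      = (\<Sum>x\<in>?G. if inv x \<otimes> w \<otimes> x \<in> H then \<phi> w * cnj (\<psi> (inv x \<otimes> w \<otimes> x)) else 0) / ?N" for w
    unfolding induced_char_def sum.inter_filter[OF assms(2)]
    by (simp add: sum_distrib_left if_distrib[of cnj] if_distrib[of "\<lambda>z. \<phi> w * z"] cong: if_cong)
  then have "(\<Sum>w\<in>?G. \<phi> w * cnj (induced_char G H \<psi> w))
      = (\<Sum>w\<in>?G. \<Sum>x\<in>?G. if inv x \<otimes> w \<otimes> x \<in> H then \<phi> w * cnj (\<psi> (inv x \<otimes> w \<otimes> x)) else 0) / ?N"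
    by (simp add: sum_divide_distrib)
  also have "\<dots> = (\<Sum>x\<in>?G. \<Sum>h\<in>H. \<phi> h * cnj (\<psi> h)) / ?N"
    by (subst sum.swap) (simp add: conj)
  finally show ?thesis
    unfolding class_inner_def Coset.order_def using assms(2) one_closed
    by (auto simp: card_eq_0_iff)
qed

text \<open>The action of x carries the fixed points of h bijectively to those of its conjugate;
  this makes \<open>charlier_theta\<close> a class function, as reciprocity requires.\<close>

lemma fix_theta_conj:
  assumes r: "r > 0" and x: "x \<in> carrier (wreath r n)" and h: "h \<in> carrier (wreath r n)"
  shows "fix_theta r n (x \<otimes>\<^bsub>wreath r n\<^esub> h \<otimes>\<^bsub>wreath r n\<^esub> inv\<^bsub>wreath r n\<^esub> x) = fix_theta r n h"
proof -
  interpret group "wreath r n"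
    by (rule group_wreath[OF r])
  let ?Z = "carrier (cyc r) \<times> {1..n}" and ?a = "wreath_act r"
  have closed: "?a w z \<in> ?Z" if "w \<in> carrier (wreath r n)" "z \<in> ?Z" for w z
    by (rule wreath_act_closed[OF r that])
  have act: "?a (x \<otimes>\<^bsub>wreath r n\<^esub> h \<otimes>\<^bsub>wreath r n\<^esub> inv\<^bsub>wreath r n\<^esub> x) z = ?a x (?a h (?a (inv\<^bsub>wreath r n\<^esub> x) z))"
    if "z \<in> ?Z" for z
    using that x h closed by (simp only: wreath_act_mult m_closed inv_closed)
  have "bij_betw (?a x) {z \<in> ?Z. ?a h z = z}
      {z \<in> ?Z. ?a (x \<otimes>\<^bsub>wreath r n\<^esub> h \<otimes>\<^bsub>wreath r n\<^esub> inv\<^bsub>wreath r n\<^esub> x) z = z}"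
  proof (rule bij_betw_byWitness[where f' = "?a (inv\<^bsub>wreath r n\<^esub> x)"])
    show "\<forall>z\<in>{z \<in> ?Z. ?a h z = z}. ?a (inv\<^bsub>wreath r n\<^esub> x) (?a x z) = z"
      using wreath_act_inv(1)[OF r x] by blast
    show "\<forall>z\<in>{z \<in> ?Z. ?a (x \<otimes>\<^bsub>wreath r n\<^esub> h \<otimes>\<^bsub>wreath r n\<^esub> inv\<^bsub>wreath r n\<^esub> x) z = z}. ?a x (?a (inv\<^bsub>wreath r n\<^esub> x) z) = z"
      using wreath_act_inv(2)[OF r x] by blast
    show "?a x ` {z \<in> ?Z. ?a h z = z} \<subseteq> {z \<in> ?Z. ?a (x \<otimes>\<^bsub>wreath r n\<^esub> h \<otimes>\<^bsub>wreath r n\<^esub> inv\<^bsub>wreath r n\<^esub> x) z = z}"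
    proof (rule image_subsetI)
      fix z assume "z \<in> {z \<in> ?Z. ?a h z = z}"
      then have z: "z \<in> ?Z" "?a h z = z"
        by blast+
      show "?a x z \<in> {z \<in> ?Z. ?a (x \<otimes>\<^bsub>wreath r n\<^esub> h \<otimes>\<^bsub>wreath r n\<^esub> inv\<^bsub>wreath r n\<^esub> x) z = z}"
        using act[OF closed[OF x z(1)]] wreath_act_inv(1)[OF r x z(1)] z closed[OF x z(1)] by simp
    qed
    show "?a (inv\<^bsub>wreath r n\<^esub> x) ` {z \<in> ?Z. ?a (x \<otimes>\<^bsub>wreath r n\<^esub> h \<otimes>\<^bsub>wreath r n\<^esub> inv\<^bsub>wreath r n\<^esub> x) z = z} \<subseteq> {z \<in> ?Z. ?a h z = z}"
    proof (rule image_subsetI)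
      fix z assume "z \<in> {z \<in> ?Z. ?a (x \<otimes>\<^bsub>wreath r n\<^esub> h \<otimes>\<^bsub>wreath r n\<^esub> inv\<^bsub>wreath r n\<^esub> x) z = z}"
      then have z: "z \<in> ?Z" "?a x (?a h (?a (inv\<^bsub>wreath r n\<^esub> x) z)) = z"
        using act by auto
      have z': "?a (inv\<^bsub>wreath r n\<^esub> x) z \<in> ?Z"
        by (rule closed[OF inv_closed[OF x] z(1)])
      have "?a h (?a (inv\<^bsub>wreath r n\<^esub> x) z) = ?a (inv\<^bsub>wreath r n\<^esub> x) z"
        using wreath_act_inv(1)[OF r x closed[OF h z']] z(2) by simp
      then show "?a (inv\<^bsub>wreath r n\<^esub> x) z \<in> {z \<in> ?Z. ?a h z = z}"
        using z' by simp
    qed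
  qed
  from bij_betw_same_card[OF this] show ?thesis
    unfolding fix_theta_def by (simp only:)
qed

text \<open>Injectivity of \<Theta> makes \<open>\<Theta> g\<close> nontrivial for g \<noteq> 0;
  translating the summation by some b with \<open>\<Theta> g b \<noteq> 1\<close> multiplies the sum
  by that value and so forces it to vanish.\<close>

lemma linear_character_sum:
  assumes r: "r > 0" and \<Theta>: "\<Theta> \<in> iso (cyc r) (linear_characters (cyc r))" and g: "g \<in> carrier (cyc r)"
  shows "(\<Sum>c\<in>carrier (cyc r). \<Theta> g c) = (if g = 0 then of_nat r else 0)" "\<Theta> g 0 = 1"
proof -
  let ?C = "carrier (cyc r)"
  have C: "finite ?C" "0 \<in> ?C" "card ?C = r"
    using r by (simp_all add: cyc_carrier)
  have hom: "\<Theta> \<in> hom (cyc r) (linear_characters (cyc r))" and inj: "inj_on \<Theta> ?C"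
    using \<Theta> by (auto simp: iso_def bij_betw_def)
  have "\<Theta> g \<in> carrier (linear_characters (cyc r))"
    using hom g unfolding hom_def by blast
  then have mult: "\<Theta> g ((a + b) mod int r) = \<Theta> g a * \<Theta> g b"
    and nz: "\<Theta> g a \<noteq> 0" and ext: "\<Theta> g \<in> extensional ?C" if "a \<in> ?C" "b \<in> ?C" for a b
    using that unfolding linear_characters_def by (auto simp: PiE_iff)
  have one: "\<Theta> g 0 = 1"
    using mult[OF C(2) C(2), symmetric] nz[OF C(2) C(2)] by simp
  then show "\<Theta> g 0 = 1" .
  have trivial: "\<Theta> 0 = (\<lambda>c\<in>?C. 1)"
  proof -
    have T0: "\<Theta> 0 \<in> carrier (linear_characters (cyc r))"
      using hom C(2) unfolding hom_def by blast
    then have ext0: "\<Theta> 0 \<in> extensional ?C" and nz0: "\<Theta> 0 a \<noteq> 0" if "a \<in> ?C" for a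
      using that unfolding linear_characters_def by (auto simp: PiE_iff)
    have "\<Theta> 0 c = 1" if c: "c \<in> ?C" for c
    proof -
      \<comment> \<open>Since 0 + 0 = 0, the values of \<open>\<Theta> 0\<close> are idempotent, and
        they are nonzero.\<close>
      have "(\<Theta> 0 \<otimes>\<^bsub>linear_characters (cyc r)\<^esub> \<Theta> 0) c = \<Theta> (0 \<otimes>\<^bsub>cyc r\<^esub> 0) c"
        by (simp only: hom_mult[OF hom C(2) C(2)])
      then have "\<Theta> 0 c * \<Theta> 0 c = \<Theta> 0 c"
        using c by (simp add: linear_characters_def)
      then show ?thesis
        using nz0[OF c] by simp
    qed
    then show ?thesis
      using ext0[OF C(2)] by (auto simp: extensional_def fun_eq_iff)
  qed
  show "(\<Sum>c\<in>?C. \<Theta> g c) = (if g = 0 then of_nat r else 0)"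
  proof (cases "g = 0")
    case True
    then show ?thesis
      using C(3) by (simp add: trivial)
  next
    case False
    then have "\<Theta> g \<noteq> (\<lambda>c\<in>?C. 1)"
      using inj_onD[OF inj _ g C(2)] trivial by auto
    then obtain b where b: "b \<in> ?C" "\<Theta> g b \<noteq> 1"
      using ext[OF C(2) C(2)] by (auto simp: extensional_def fun_eq_iff split: if_splits)
    have "(\<Sum>c\<in>?C. \<Theta> g c) = (\<Sum>c\<in>?C. \<Theta> g ((c + b) mod int r))"
    proof (rule sum.reindex_bij_betw[symmetric])
      show "bij_betw (\<lambda>c. (c + b) mod int r) ?C ?C"
        by (rule bij_betw_byWitness[where f' = "\<lambda>c. (c - b) mod int r"])
          (use r in \<open>auto simp: cyc_carrier mod_simps\<close>)
    qed
    also have "\<dots> = (\<Sum>c\<in>?C. \<Theta> g c) * \<Theta> g b"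
      using mult b(1) by (simp add: sum_distrib_right)
    finally show ?thesis
      using b(2) False by simp
  qed
qed

lemma prod_if_const:
  fixes c :: "'m::comm_monoid_mult"
  assumes "finite A"
  shows "(\<Prod>i\<in>A. if Q i then c else 1) = c ^ card {i \<in> A. Q i}"
  using prod.inter_filter[OF assms, of "\<lambda>_. c" Q] by simp

text \<open>Once the class function is the image of a power of 1 + r t, the sum over the base group
  factorizes over positions, with factor \<open>F i\<close> at i. A moved position of nonzero color
  kills the product, and pulling r out of r + r t changes the parameter from 1/r to 1.\<close>

lemma sum_charlier_linear_characters:
  assumes r: "r > 0" and \<Theta>: "\<Theta> \<in> iso (cyc r) (linear_characters (cyc r))"
    and color: "\<And>i. i \<in> {1..n} \<Longrightarrow> color i \<in> carrier (cyc r)"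
    and P0: "P0 = {i \<in> {1..n}. color i = 0}"
  shows "(\<Sum>x\<in>{1..n} \<rightarrow>\<^sub>E carrier (cyc r).
      of_real (poly (charlier (1 / real r) k) (real (card {i \<in> {1..n}. \<pi> i = i \<and> x i = 0})))
        * (\<Prod>i\<in>{1..n}. \<Theta> (color i) (x i)))
    = (if (\<forall>i\<in>{1..n} - P0. \<pi> i = i) \<and> n - card P0 \<le> k
       then of_nat r ^ n * fact k / fact (k - (n - card P0))
         * of_real (poly (charlier 1 (k - (n - card P0))) (real (card {i \<in> P0. \<pi> i = i})))
       else 0)"
proof -
  let ?C = "carrier (cyc r)" and ?I = "{1..n}"
  let ?X = "?I \<rightarrow>\<^sub>E ?C"
  let ?q = "[:1, of_nat r:] :: complex poly" and ?L = "charlier_functional k"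
  have C: "finite ?C" "0 \<in> ?C"
    using r by (simp_all add: cyc_carrier)
  have P0_sub: "P0 \<subseteq> ?I"
    unfolding P0 by blast
  have card_diff: "card (?I - P0) = n - card P0"
    using card_Diff_subset[OF finite_subset[OF P0_sub] P0_sub] by simp
  define F where "F i = (\<Sum>c\<in>?C. Polynomial.smult (\<Theta> (color i) c) (if \<pi> i = i \<and> c = 0 then ?q else 1))" for i
  have F: "F i = (if \<pi> i = i then [:if color i = 0 then of_nat r else 0, of_nat r:]
      else [:if color i = 0 then of_nat r else 0:])" if i: "i \<in> ?I" for i
  proof -
    note \<Theta>i = linear_character_sum[OF r \<Theta> color[OF i]]
    have const: "(\<Sum>c\<in>?C. Polynomial.smult (\<Theta> (color i) c) 1) = [:if color i = 0 then of_nat r else 0:]"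
      unfolding smult_sum[symmetric] \<Theta>i(1) by simp
    show ?thesis
    proof (cases "\<pi> i = i")
      case True
      \<comment> \<open>Only c = 0 adds the summand r t, with weight
        \<open>\<Theta> (color i) 0 = 1\<close>.\<close>
      have "F i = (\<Sum>c\<in>?C. Polynomial.smult (\<Theta> (color i) c) 1 + (if c = 0 then [:0, of_nat r:] else 0))"
        unfolding F_def using True \<Theta>i(2) by (intro sum.cong) (auto simp: one_pCons)
      also have "\<dots> = [:if color i = 0 then of_nat r else 0:] + [:0, of_nat r:]"
        unfolding sum.distrib const using C by simp
      finally show ?thesis
        using True by simp
    next
      case False
      then show ?thesis
        unfolding F_def using const by simp
    qed
  qed
  let ?T = "\<lambda>x. \<Prod>i\<in>?I. \<Theta> (color i) (x i)" and ?N = "\<lambda>x. card {i \<in> ?I. \<pi> i = i \<and> x i = 0}"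
  have "(\<Sum>x\<in>?X. of_real (poly (charlier (1 / real r) k) (real (?N x))) * ?T x)
      = (\<Sum>x\<in>?X. ?L (Polynomial.smult (?T x) (?q ^ ?N x)))"
    by (simp add: charlier_functional_linear_power[OF r] charlier_functional_smult mult.commute)
  also have "\<dots> = ?L (\<Sum>x\<in>?X. Polynomial.smult (?T x) (?q ^ ?N x))"
    by (rule charlier_functional_sum[symmetric])
  also have "(\<Sum>x\<in>?X. Polynomial.smult (?T x) (?q ^ ?N x)) = (\<Prod>i\<in>?I. F i)"
  proof -
    have "Polynomial.smult (?T x) (?q ^ ?N x)
        = (\<Prod>i\<in>?I. Polynomial.smult (\<Theta> (color i) (x i)) (if \<pi> i = i \<and> x i = 0 then ?q else 1))" for x
      unfolding prod_smult by (simp only: prod_if_const[OF finite_atLeastAtMost])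
    then show ?thesis
      unfolding F_def using C by (simp only: prod_sum_PiE finite_atLeastAtMost)
  qed
  also have "(\<Prod>i\<in>?I. F i) = (\<Prod>i\<in>?I - P0. F i) * (\<Prod>i\<in>P0. F i)"
    by (rule prod.subset_diff) (auto simp: P0)
  also have "(\<Prod>i\<in>P0. F i) = Polynomial.smult (of_nat r ^ card P0) ([:1, 1:] ^ card {i \<in> P0. \<pi> i = i})"
  proof -
    have "(\<Prod>i\<in>P0. F i) = (\<Prod>i\<in>P0. Polynomial.smult (of_nat r) (if \<pi> i = i then [:1, 1:] else 1))"
      using F by (intro prod.cong) (auto simp: P0 one_pCons)
    also have "\<dots> = Polynomial.smult (\<Prod>i\<in>P0. of_nat r) (\<Prod>i\<in>P0. if \<pi> i = i then [:1, 1:] else 1)"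
      by (rule prod_smult)
    also have "(\<Prod>i\<in>P0. if \<pi> i = i then [:1, 1:] else 1) = ([:1, 1:] :: complex poly) ^ card {i \<in> P0. \<pi> i = i}"
      by (rule prod_if_const) (simp add: P0)
    finally show ?thesis
      by simp
  qed
  also have "(\<Prod>i\<in>?I - P0. F i) = (if \<forall>i\<in>?I - P0. \<pi> i = i
      then Polynomial.smult (of_nat r ^ (n - card P0)) (monom 1 (n - card P0)) else 0)"
  proof (cases "\<forall>i\<in>?I - P0. \<pi> i = i")
    case True
    have "(\<Prod>i\<in>?I - P0. F i) = (\<Prod>i\<in>?I - P0. monom (of_nat r) 1)"
      using F True by (intro prod.cong) (auto simp: P0 monom_altdef monom_Suc monom_0)
    also have "\<dots> = monom (of_nat r ^ (n - card P0)) (n - card P0)"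
      unfolding prod_constant card_diff by (simp add: monom_power)
    finally show ?thesis
      using True by (simp add: smult_monom)
  next
    case False
    then obtain i where i: "i \<in> ?I - P0" "\<pi> i \<noteq> i"
      by blast
    then have "F i = 0"
      using F by (auto simp: P0)
    then show ?thesis
      using False i(1) by (auto intro!: prod_zero)
  qed
  also have "?L ((if \<forall>i\<in>?I - P0. \<pi> i = i
      then Polynomial.smult (of_nat r ^ (n - card P0)) (monom 1 (n - card P0)) else 0)
        * Polynomial.smult (of_nat r ^ card P0) ([:1, 1:] ^ card {i \<in> P0. \<pi> i = i}))
    = (if (\<forall>i\<in>?I - P0. \<pi> i = i) \<and> n - card P0 \<le> k
       then of_nat r ^ n * fact k / fact (k - (n - card P0))
         * of_real (poly (charlier 1 (k - (n - card P0))) (real (card {i \<in> P0. \<pi> i = i})))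
       else 0)"
  proof (cases "\<forall>i\<in>?I - P0. \<pi> i = i")
    case True
    have "card P0 \<le> n"
      using card_mono[OF _ P0_sub] by simp
    then have rn: "(of_nat r ^ card P0 * of_nat r ^ (n - card P0) :: complex) = of_nat r ^ n"
      by (simp flip: power_add)
    have "charlier_functional j ([:1, 1:] ^ f) = of_real (poly (charlier 1 j) (real f))" for j f
      using charlier_functional_linear_power[of 1 j f] by simp
    then show ?thesis
      using True rn by (simp add: charlier_functional_smult charlier_functional_monom_mult mult.assoc[symmetric])
  next
    case False
    then show ?thesis
      by (auto simp: charlier_functional_def)
  qed
  finally show ?thesis .
qed

section \<open>Multiplicities\<close>

lemma largest_part_le: "largest_part \<mu> \<le> sum_list \<mu>"
  unfolding largest_part_def by (cases \<mu>) auto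

text \<open>The block condition concerns the permutation alone, so the base group can be summed out
  for each fixed permutation.\<close>

lemma block_subgroup_eq:
  "block_subgroup r n P = ({1..n} \<rightarrow>\<^sub>E carrier (cyc r))
    \<times> {\<pi>. \<pi> permutes {1..n} \<and> (\<forall>g\<in>carrier (cyc r). \<pi> ` P g = P g)}"
proof (rule Set.set_eqI)
  fix h :: "(nat \<Rightarrow> int) \<times> (nat \<Rightarrow> nat)"
  obtain x \<pi> where "h = (x, \<pi>)"
    by (cases h)
  then show "h \<in> block_subgroup r n P \<longleftrightarrow> h \<in> ({1..n} \<rightarrow>\<^sub>E carrier (cyc r))
      \<times> {\<pi>. \<pi> permutes {1..n} \<and> (\<forall>g\<in>carrier (cyc r). \<pi> ` P g = P g)}"
    by (simp only: block_subgroup_def wreath_carrier_iff mem_Collect_eq case_prod_conv mem_Sigma_iff conj_assoc)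
qed

text \<open>Up to a positive constant this is the one color sum for the block \<open>P 0\<close>.
  The value is real, so the conjugation in the inner product can be restored afterwards.\<close>

lemma sum_charlier_theta_block_char:
  assumes r: "r > 0" and k: "2 * k \<le> n" and \<Theta>: "\<Theta> \<in> iso (cyc r) (linear_characters (cyc r))"
    and L: "L \<in> colored_partitions r n" and P: "is_block_choice r n L P"
  obtains a :: real where
    "(\<Sum>h\<in>block_subgroup r n P. charlier_theta r n k h * block_char r \<Theta> L P h) = of_real a"
    "a \<ge> 0" "a \<noteq> 0 \<longleftrightarrow> largest_part (L 0) = n - k"
proof -
  let ?C = "carrier (cyc r)" and ?I = "{1..n}" and ?P0 = "P 0"
  let ?X = "?I \<rightarrow>\<^sub>E ?C"
  define Q where "Q = {\<pi>. \<pi> permutes ?I \<and> (\<forall>g\<in>?C. \<pi> ` P g = P g)}"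
  have C: "finite ?C" "0 \<in> ?C"
    using r by (simp_all add: cyc_carrier)
  have disj: "P g \<inter> P g' = {}" if "g \<in> ?C" "g' \<in> ?C" "g \<noteq> g'" for g g'
    using P that unfolding is_block_choice_def disjoint_family_on_def by blast
  have union: "(\<Union>g\<in>?C. P g) = ?I" and card: "\<And>g. g \<in> ?C \<Longrightarrow> card (P g) = sum_list (L g)"
    using P unfolding is_block_choice_def by auto
  have sub: "P g \<subseteq> ?I" if "g \<in> ?C" for g
    using union that by blast
  have fin: "finite (P g)" if "g \<in> ?C" for g
    using finite_subset[OF sub[OF that]] by simp
  define color where "color i = (SOME g. g \<in> ?C \<and> i \<in> P g)" for i
  have color: "color i = g" if "g \<in> ?C" "i \<in> P g" for i g
    unfolding color_def
  proof (rule some_equality)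
    fix g' assume g': "g' \<in> ?C \<and> i \<in> P g'"
    then show "g' = g"
      using disj[of g' g] that by blast
  qed (use that in simp)
  have colorC: "color i \<in> ?C" "i \<in> P (color i)" if i: "i \<in> ?I" for i
  proof -
    obtain g where g: "g \<in> ?C" "i \<in> P g"
      using i union by blast
    then show "color i \<in> ?C" "i \<in> P (color i)"
      using color[OF g] by simp_all
  qed
  have P0: "?P0 = {i \<in> ?I. color i = 0}"
  proof (intro equalityI subsetI)
    fix i assume i: "i \<in> ?P0"
    then show "i \<in> {i \<in> ?I. color i = 0}"
      using color[OF C(2) i] sub[OF C(2)] by blast
  next
    fix i assume "i \<in> {i \<in> ?I. color i = 0}"
    then have "i \<in> ?I" "color i = 0"
      by blast+
    then show "i \<in> ?P0"
      using colorC(2)[of i] by simp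
  qed
  define S where "S \<pi> = (\<Prod>g\<in>?C. sym_char (P g) (L g) (perm_restrict \<pi> (P g)))" for \<pi>
  define m where "m = n - card ?P0"
  have card_le: "card ?P0 \<le> n"
    using card_mono[OF _ sub[OF C(2)]] by simp
  define W where "W \<pi> = (if (\<forall>i\<in>?I - ?P0. \<pi> i = i) \<and> m \<le> k
       then of_nat r ^ n * fact k / fact (k - m)
         * of_real (poly (charlier 1 (k - m)) (real (card {i \<in> ?P0. \<pi> i = i})))
       else 0 :: complex)" for \<pi>
  have finQ: "finite Q"
    unfolding Q_def by (rule finite_subset[OF _ finite_permutations[of ?I]]) auto
  have block: "block_char r \<Theta> L P (x, \<pi>) = (\<Prod>i\<in>?I. \<Theta> (color i) (x i)) * S \<pi>" for x \<pi>
  proof -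
    have "(\<Prod>i\<in>?I. \<Theta> (color i) (x i)) = (\<Prod>g\<in>?C. \<Prod>i\<in>P g. \<Theta> (color i) (x i))"
      unfolding union[symmetric] by (rule prod.UNION_disjoint) (use C fin disj in auto)
    also have "\<dots> = (\<Prod>g\<in>?C. \<Prod>i\<in>P g. \<Theta> g (x i))"
      using color by (intro prod.cong) auto
    finally show ?thesis
      by (simp add: S_def prod.distrib)
  qed
  have theta: "charlier_theta r n k (x, \<pi>)
      = of_real (poly (charlier (1 / real r) k) (real (card {i \<in> ?I. \<pi> i = i \<and> x i = 0})))"
    if "x \<in> ?X" "\<pi> \<in> Q" for x \<pi>
  proof -
    have "(x, \<pi>) \<in> carrier (wreath r n)"
      using that by (simp add: wreath_carrier_iff Q_def)
    from fix_theta_eq[OF r this] show ?thesis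
      by (simp add: charlier_theta_def fixed_columns_def)
  qed
  have "(\<Sum>h\<in>block_subgroup r n P. charlier_theta r n k h * block_char r \<Theta> L P h)
      = (\<Sum>x\<in>?X. \<Sum>\<pi>\<in>Q. charlier_theta r n k (x, \<pi>) * block_char r \<Theta> L P (x, \<pi>))"
    unfolding block_subgroup_eq Q_def[symmetric] sum.cartesian_product by (rule sum.cong) auto
  also have "\<dots> = (\<Sum>\<pi>\<in>Q. \<Sum>x\<in>?X. charlier_theta r n k (x, \<pi>) * block_char r \<Theta> L P (x, \<pi>))"
    by (rule sum.swap)
  also have "\<dots> = (\<Sum>\<pi>\<in>Q. W \<pi> * S \<pi>)"
  proof (rule sum.cong[OF refl])
    fix \<pi> assume \<pi>: "\<pi> \<in> Q"
    have "(\<Sum>x\<in>?X. charlier_theta r n k (x, \<pi>) * block_char r \<Theta> L P (x, \<pi>))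
        = (\<Sum>x\<in>?X. of_real (poly (charlier (1 / real r) k) (real (card {i \<in> ?I. \<pi> i = i \<and> x i = 0})))
            * (\<Prod>i\<in>?I. \<Theta> (color i) (x i))) * S \<pi>"
      unfolding sum_distrib_right
      by (rule sum.cong[OF refl]) (simp only: theta[OF _ \<pi>] block mult.assoc)
    also have "(\<Sum>x\<in>?X. of_real (poly (charlier (1 / real r) k) (real (card {i \<in> ?I. \<pi> i = i \<and> x i = 0})))
            * (\<Prod>i\<in>?I. \<Theta> (color i) (x i))) = W \<pi>"
      unfolding W_def m_def by (rule sum_charlier_linear_characters[OF r \<Theta> _ P0]) (rule colorC(1))
    finally show "(\<Sum>x\<in>?X. charlier_theta r n k (x, \<pi>) * block_char r \<Theta> L P (x, \<pi>)) = W \<pi> * S \<pi>" .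
  qed
  finally have total: "(\<Sum>h\<in>block_subgroup r n P. charlier_theta r n k h * block_char r \<Theta> L P h)
      = (\<Sum>\<pi>\<in>Q. W \<pi> * S \<pi>)" .
  show ?thesis
  proof (cases "m \<le> k")
    case False
    \<comment> \<open>With m > k the whole sum vanishes, and the first row has at most n - m cells,
      fewer than n - k.\<close>
    then have "largest_part (L 0) \<noteq> n - k"
      using largest_part_le[of "L 0"] card[OF C(2)] card_le unfolding m_def by linarith
    then show ?thesis
      using that[of 0] total False by (simp add: W_def)
  next
    case True
    let ?Q0 = "{\<pi>. \<pi> permutes ?P0}"
    have "\<exists>d::nat. sym_char (P g) (L g) id = of_nat d \<and> d > 0" if "g \<in> ?C" for g
      using sym_char_id[OF fin[OF that] card[OF that, symmetric]] by metis
    then obtain d :: "int \<Rightarrow> nat" where d: "\<And>g. g \<in> ?C \<Longrightarrow> sym_char (P g) (L g) id = of_nat (d g)"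
      "\<And>g. g \<in> ?C \<Longrightarrow> d g > 0"
      by metis
    \<comment> \<open>Only permutations supported on \<open>P 0\<close> survive; they act as the
      identity on the other blocks, whose characters therefore contribute their degrees.\<close>
    define D where "D = (\<Prod>g\<in>?C - {0}. d g)"
    have Dpos: "D > 0"
      unfolding D_def using d(2) by (intro prod_pos) auto
    have perm0: "\<pi> permutes ?P0" if "\<pi> \<in> Q" "\<forall>i\<in>?I - ?P0. \<pi> i = i" for \<pi>
      by (rule permutes_superset[of \<pi> ?I]) (use that in \<open>auto simp: Q_def\<close>)
    have Q0: "\<pi> \<in> Q" if \<pi>: "\<pi> permutes ?P0" for \<pi>
    proof -
      have "\<pi> ` P g = P g" if g: "g \<in> ?C" for g
      proof (cases "g = 0")
        case True
        then show ?thesis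
          using permutes_image[OF \<pi>] by simp
      next
        case False
        then have "\<pi> i = i" if "i \<in> P g" for i
          using disj[OF g C(2)] permutes_not_in[OF \<pi>, of i] that by blast
        then show ?thesis
          by simp
      qed
      then show ?thesis
        unfolding Q_def using permutes_subset[OF \<pi> sub[OF C(2)]] by blast
    qed
    have S0: "S \<pi> = of_nat D * sym_char ?P0 (L 0) \<pi>" if \<pi>: "\<pi> permutes ?P0" for \<pi>
    proof -
      have "perm_restrict \<pi> (P g) = id" if g: "g \<in> ?C - {0}" for g
      proof
        fix i
        show "perm_restrict \<pi> (P g) i = id i"
          using disj[of g 0] g C(2) permutes_not_in[OF \<pi>, of i] by (auto simp: perm_restrict_def)
      qed
      then have "(\<Prod>g\<in>?C - {0}. sym_char (P g) (L g) (perm_restrict \<pi> (P g))) = of_nat D"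
        unfolding D_def of_nat_prod using d(1) by (intro prod.cong) auto
      then show ?thesis
        unfolding S_def by (subst prod.remove[OF C]) (simp add: perm_restrict_id[OF \<pi>] mult.commute)
    qed
    have le: "2 * (k - m) \<le> card ?P0"
      using k True card_le unfolding m_def by linarith
    have part: "is_partition (L 0)"
      using L C(2) unfolding colored_partitions_def by auto
    obtain e :: nat where e:
      "(\<Sum>\<pi>\<in>?Q0. of_real (poly (charlier 1 (k - m)) (real (card {a \<in> ?P0. \<pi> a = a}))) * sym_char ?P0 (L 0) \<pi>)
        = of_nat e" "e \<noteq> 0 \<longleftrightarrow> largest_part (L 0) = card ?P0 - (k - m)"
      by (rule sum_charlier_sym_char[OF fin[OF C(2)] part card[OF C(2), symmetric] le])
    define c where "c = real D * (real r ^ n * fact k / fact (k - m))"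
    have "(\<Sum>\<pi>\<in>Q. W \<pi> * S \<pi>) = (\<Sum>\<pi>\<in>?Q0. of_real c
        * (of_real (poly (charlier 1 (k - m)) (real (card {a \<in> ?P0. \<pi> a = a}))) * sym_char ?P0 (L 0) \<pi>))"
    proof (rule sum.mono_neutral_cong_right[OF finQ])
      show "?Q0 \<subseteq> Q"
        using Q0 by blast
      show "\<forall>\<pi>\<in>Q - ?Q0. W \<pi> * S \<pi> = 0"
        using perm0 by (auto simp: W_def)
      fix \<pi> assume "\<pi> \<in> ?Q0"
      then have \<pi>: "\<pi> permutes ?P0"
        by simp
      have "\<forall>i\<in>?I - ?P0. \<pi> i = i"
        using permutes_not_in[OF \<pi>] by blast
      then show "W \<pi> * S \<pi> = of_real c
          * (of_real (poly (charlier 1 (k - m)) (real (card {a \<in> ?P0. \<pi> a = a}))) * sym_char ?P0 (L 0) \<pi>)"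
        using True by (simp add: W_def S0[OF \<pi>] c_def mult_ac)
    qed
    also have "\<dots> = of_real (c * real e)"
      by (simp only: sum_distrib_left[symmetric] e(1) of_real_mult of_real_of_nat_eq)
    finally have "(\<Sum>h\<in>block_subgroup r n P. charlier_theta r n k h * block_char r \<Theta> L P h) = of_real (c * real e)"
      using total by simp
    moreover have "c > 0"
      using Dpos r by (simp add: c_def)
    moreover have "card ?P0 - (k - m) = n - k"
      using True card_le unfolding m_def by linarith
    ultimately show ?thesis
      using that[of "c * real e"] e(2) by simp
  qed
qed

theorem theorem6p1:
  fixes r n k :: nat and \<Theta> :: "int \<Rightarrow> int \<Rightarrow> complex"
  assumes "r > 0" and "n > 0" and "2 * k \<le> n"
    and "\<Theta> \<in> iso (cyc r) (linear_characters (cyc r))"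
  shows "(\<forall>L\<in>colored_partitions r n. \<forall>P. is_block_choice r n L P \<longrightarrow>
            class_inner (wreath r n) (charlier_theta r n k) (wreath_char r n \<Theta> L P) \<in> \<real>\<^sub>\<ge>\<^sub>0 \<and>
            (class_inner (wreath r n) (charlier_theta r n k) (wreath_char r n \<Theta> L P) \<noteq> 0
               \<longleftrightarrow> largest_part (L 0) = n - k)) \<and>
         is_character (wreath r n) (charlier_theta r n k)"
proof (intro conjI ballI allI impI)
  show "is_character (wreath r n) (charlier_theta r n k)"
    by (rule is_character_charlier_theta[OF assms(1,3)])
  fix L P assume L: "L \<in> colored_partitions r n" and P: "is_block_choice r n L P"
  let ?W = "wreath r n" and ?H = "block_subgroup r n P"
  obtain a :: real where a:
    "(\<Sum>h\<in>?H. charlier_theta r n k h * block_char r \<Theta> L P h) = of_real a"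
    "a \<ge> 0" "a \<noteq> 0 \<longleftrightarrow> largest_part (L 0) = n - k"
    by (rule sum_charlier_theta_block_char[OF assms(1,3,4) L P])
  have "carrier ?W = ({1..n} \<rightarrow>\<^sub>E carrier (cyc r)) \<times> {\<pi>. \<pi> permutes {1..n}}"
    by (simp add: wreath_def sym_group_def)
  moreover have "finite ({1..n} \<rightarrow>\<^sub>E carrier (cyc r))"
    using assms(1) by (intro finite_PiE) (auto simp: cyc_carrier)
  ultimately have fin: "finite (carrier ?W)"
    using finite_permutations[of "{1..n}"] by simp
  have H: "?H \<subseteq> carrier ?W"
    unfolding block_subgroup_def by blast
  have "((\<lambda>i\<in>{1..n}. 0), id) \<in> ?H"
    using assms(1) by (simp add: block_subgroup_eq permutes_id cyc_carrier)
  then have card: "card ?H \<noteq> 0"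
    by (rule card_ne_0) (rule finite_subset[OF H fin])
  have class_fun: "charlier_theta r n k (x \<otimes>\<^bsub>?W\<^esub> h \<otimes>\<^bsub>?W\<^esub> inv\<^bsub>?W\<^esub> x) = charlier_theta r n k h"
    if "x \<in> carrier ?W" "h \<in> carrier ?W" for x h
    using fix_theta_conj[OF assms(1) that] by (simp add: charlier_theta_def)
  have "class_inner ?W (charlier_theta r n k) (wreath_char r n \<Theta> L P)
      = (\<Sum>h\<in>?H. charlier_theta r n k h * cnj (block_char r \<Theta> L P h)) / of_nat (card ?H)"
    unfolding wreath_char_def
    by (rule class_inner_induced_char[OF group_wreath[OF assms(1)] fin H class_fun])
  \<comment> \<open>As \<open>charlier_theta\<close> is real valued, conjugation passes to the whole
    sum, which is a real number.\<close>
  also have "(\<Sum>h\<in>?H. charlier_theta r n k h * cnj (block_char r \<Theta> L P h))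
      = cnj (\<Sum>h\<in>?H. charlier_theta r n k h * block_char r \<Theta> L P h)"
    by (simp add: charlier_theta_def)
  also have "\<dots> = of_real a"
    using a(1) by simp
  finally have inner: "class_inner ?W (charlier_theta r n k) (wreath_char r n \<Theta> L P)
      = of_real (a / real (card ?H))"
    by simp
  show "class_inner ?W (charlier_theta r n k) (wreath_char r n \<Theta> L P) \<in> \<real>\<^sub>\<ge>\<^sub>0"
    unfolding inner using a(2) by (simp only: nonneg_Reals_of_real_iff) simp
  show "class_inner ?W (charlier_theta r n k) (wreath_char r n \<Theta> L P) \<noteq> 0
      \<longleftrightarrow> largest_part (L 0) = n - k"
    unfolding inner using a(3) card by simp
qed

end
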